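(* Let $\{P_0,\dots,P_8\}$ be a symmetric Clifford system on $\mathbb{R}^{32}$ with $P:=P_0P_1\cdots P_8\ne\pm Id$, and let $\tilde P_\alpha:=P_\alpha P$ ($0\le\alpha\le8$), which is a symmetric Clifford system with $\tilde P_0\cdots\tilde P_8=Id$. Let $M_\pm^I$ and $M_\pm^D$ in $S^{31}(1)$ be the focal submanifolds of the OT-FKM type isoparametric families with multiplicities $(8,7)$ defined by $\{P_\alpha\}$ (indefinite) and $\{\tilde P_\alpha\}$ (definite), respectively. Then there exist isoparametric functions $h$ on $M_-^I$ and $\tilde h$ on $M_-^D$ such that $h^{-1}(0)=M_+^D\subset M_-^I$ and $\tilde h^{-1}(0)=M_+^I\subset M_-^D$, and these isoparametric hypersurfaces $$M_+^D\hookrightarrow M_-^I,\qquad M_+^I\hookrightarrow M_-^D$$ are totally isoparametric, austere hypersurfaces. Moreover, the focal variety of $h$ on $M_-^I$ is exactly the set $C_A^I\subset M_-^I$ of points of $M_-^I$ satisfying Condition A.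
   Context: A symmetric Clifford system $\{P_0,\dots,P_m\}$ on $\mathbb{R}^{2l}$ consists of symmetric matrices with $P_\alpha P_\beta+P_\beta P_\alpha=2\delta_{\alpha\beta}I_{2l}$. The associated OT-FKM isoparametric function is the restriction $f$ to $S^{2l-1}(1)$ of $F(x)=|x|^4-2\sum_{\alpha=0}^m\langle P_\alpha x,x\rangle^2$; its focal submanifolds are $M_+=f^{-1}(1)=\{x\in S^{2l-1}(1):\langle P_\alpha x,x\rangle=0\ \forall\alpha\}$ and $M_-=f^{-1}(-1)=\{x\in S^{2l-1}(1):\sum_\alpha\langle P_\alpha x,x\rangle^2=1\}$, and $(m_1,m_2)=(m,l-m-1)$. All submanifolds carry the metric induced from $S^{31}(1)$. A smooth function $h$ on a Riemannian manifold $N$ is isoparametric if $|\nabla h|^2=b(h)$ and $\Delta h=a(h)$ for a smooth function $b$ and a continuous function $a$. Its regular level sets are isoparametric hypersurfaces, and the union of its singular level sets is its focal variety. An isoparametric hypersurface is totally isoparametric if it and its nearby parallel hypersurfaces have constant principal curvatures. A submanifold is austere if for every normal direction the principal curvatures occur in pairs of opposite signs (the multiset of principal curvatures is invariant under multiplication by $-1$). Condition A at a point $x$ of a focal submanifold $M\subset S^{31}(1)$: the kernels of the shape operators $S_N$ for all unit normal vectors $N\in T_x^\bot M$ (normal space in $S^{31}(1)$) coincide. *)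

theory Defs
  imports "HOL-Analysis.Analysis"
begin

section \<open>Smooth maps and embedded submanifolds of a Euclidean space\<close>

text \<open>\<open>Ck k U f\<close>, for open \<open>U\<close>: \<open>f\<close> is \<open>k\<close> times continuously differentiable on \<open>U\<close>.\<close>

primrec Ck ::
  "nat \<Rightarrow> 'a::euclidean_space set \<Rightarrow> ('a \<Rightarrow> 'b::real_normed_vector) \<Rightarrow> bool" where
  "Ck 0 U f \<longleftrightarrow> continuous_on U f"
| "Ck (Suc k) U f \<longleftrightarrow> (\<forall>x\<in>U. f differentiable (at x)) \<and>
     (\<forall>v. Ck k U (\<lambda>x. frechet_derivative f (at x) v))"

text \<open>As usual, a map on an arbitrary subset is smooth if near each point of the subset it is
  the restriction of a smooth map defined on an open set of the ambient space.\<close>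

definition smooth_on ::
  "'a::euclidean_space set \<Rightarrow> ('a \<Rightarrow> 'b::real_normed_vector) \<Rightarrow> bool" where
  "smooth_on S f \<longleftrightarrow> (\<forall>x\<in>S. \<exists>U g. open U \<and> x \<in> U \<and> (\<forall>k. Ck k U g) \<and>
     (\<forall>y\<in>S \<inter> U. g y = f y))"

text \<open>\<open>M\<close> is a \<open>k\<close>-dimensional embedded submanifold: it is locally diffeomorphic to open
  subsets of a \<open>k\<close>-dimensional vector space, here taken as a subspace of the ambient space.\<close>

definition submanifold :: "nat \<Rightarrow> 'a::euclidean_space set \<Rightarrow> bool" where
  "submanifold k M \<longleftrightarrow> (\<forall>x\<in>M. \<exists>U E V (\<phi> :: 'a \<Rightarrow> 'a) \<psi>. open U \<and> x \<in> U \<and>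
     subspace E \<and> dim E = k \<and> openin (top_of_set E) V \<and>
     homeomorphism (M \<inter> U) V \<phi> \<psi> \<and> smooth_on (M \<inter> U) \<phi> \<and> smooth_on V \<psi>)"

definition tangent_space :: "'a::euclidean_space set \<Rightarrow> 'a \<Rightarrow> 'a set" where
  "tangent_space M x = {v. \<exists>\<gamma> e. 0 < e \<and> smooth_on {-e<..<e::real} \<gamma> \<and>
     \<gamma> ` {-e<..<e} \<subseteq> M \<and> \<gamma> 0 = x \<and> (\<gamma> has_vector_derivative v) (at 0)}"

text \<open>Derivative at \<open>x\<close> of a map given on \<open>M\<close>. The Frechet derivative within \<open>M\<close> is determined
  by the values on \<open>M\<close> only in directions tangent to \<open>M\<close>; it is only used there.\<close>

definition deriv_along ::
  "'a::euclidean_space set \<Rightarrow> ('a \<Rightarrow> 'b::real_normed_vector) \<Rightarrow> 'a \<Rightarrow> 'a \<Rightarrow> 'b" where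
  "deriv_along M f x v = frechet_derivative f (at x within M) v"

definition tangent_proj :: "'a::euclidean_space set \<Rightarrow> 'a \<Rightarrow> 'a \<Rightarrow> 'a" where
  "tangent_proj M x w =
     (THE u. u \<in> tangent_space M x \<and> (\<forall>v\<in>tangent_space M x. (w - u) \<bullet> v = 0))"


section \<open>Riemannian geometry of the induced metric\<close>

definition grad :: "'a::euclidean_space set \<Rightarrow> ('a \<Rightarrow> real) \<Rightarrow> 'a \<Rightarrow> 'a" where
  "grad M h x =
     (THE g. g \<in> tangent_space M x \<and> (\<forall>v\<in>tangent_space M x. g \<bullet> v = deriv_along M h x v))"

text \<open>The Levi-Civita connection of the induced metric is the tangential part of the ambient
  derivative.\<close>

definition covariant_deriv ::
  "'a::euclidean_space set \<Rightarrow> ('a \<Rightarrow> 'a) \<Rightarrow> 'a \<Rightarrow> 'a \<Rightarrow> 'a" where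
  "covariant_deriv M X x v = tangent_proj M x (deriv_along M X x v)"

definition orthonormal_basis_of :: "'a::euclidean_space set \<Rightarrow> 'a set \<Rightarrow> bool" where
  "orthonormal_basis_of B T \<longleftrightarrow>
     B \<subseteq> T \<and> pairwise orthogonal B \<and> (\<forall>e\<in>B. norm e = 1) \<and> span B = T"

text \<open>\<open>div (grad h)\<close>, i.e. the trace of the Hessian; it does not depend on the basis chosen.\<close>

definition laplacian :: "'a::euclidean_space set \<Rightarrow> ('a \<Rightarrow> real) \<Rightarrow> 'a \<Rightarrow> real" where
  "laplacian M h x =
     (let B = (SOME B. orthonormal_basis_of B (tangent_space M x))
      in \<Sum>e\<in>B. covariant_deriv M (grad M h) x e \<bullet> e)"

text \<open>A curve is a geodesic if its covariant acceleration vanishes, i.e. if its ambient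
  acceleration is normal to \<open>M\<close>.\<close>

definition geodesic_on :: "real set \<Rightarrow> 'a::euclidean_space set \<Rightarrow> (real \<Rightarrow> 'a) \<Rightarrow> bool" where
  "geodesic_on I M \<gamma> \<longleftrightarrow> smooth_on I \<gamma> \<and> \<gamma> ` I \<subseteq> M \<and>
     (\<forall>s\<in>I. \<forall>v\<in>tangent_space M (\<gamma> s).
        vector_derivative (\<lambda>r. vector_derivative \<gamma> (at r)) (at s) \<bullet> v = 0)"


section \<open>Submanifolds \<open>H\<close> of a submanifold \<open>N\<close>\<close>

definition normal_space :: "'a::euclidean_space set \<Rightarrow> 'a set \<Rightarrow> 'a \<Rightarrow> 'a set" where
  "normal_space N H x = {\<eta> \<in> tangent_space N x. \<forall>v\<in>tangent_space H x. \<eta> \<bullet> v = 0}"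

text \<open>The shape operator \<open>S\<^sub>\<eta> v = - (\<nabla>\<^sub>v \<zeta>)\<^sup>T\<close> of \<open>H\<close> in \<open>N\<close>, where \<open>\<zeta>\<close> is any local smooth normal
  field with \<open>\<zeta>(x) = \<eta>\<close> (the result does not depend on \<open>\<zeta>\<close>). Since \<open>H \<subseteq> N\<close>, the part of the
  ambient derivative tangent to \<open>H\<close> equals that of the covariant derivative in \<open>N\<close>.\<close>

definition shape_op ::
  "'a::euclidean_space set \<Rightarrow> 'a set \<Rightarrow> 'a \<Rightarrow> 'a \<Rightarrow> 'a \<Rightarrow> 'a" where
  "shape_op N H x \<eta> v = (THE w. \<forall>U \<zeta>.
     open U \<and> x \<in> U \<and> smooth_on (H \<inter> U) \<zeta> \<and>
     (\<forall>y\<in>H \<inter> U. \<zeta> y \<in> normal_space N H y) \<and> \<zeta> x = \<eta>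
     \<longrightarrow> w = - tangent_proj H x (deriv_along H \<zeta> x v))"

text \<open>Multiplicity of \<open>c\<close> as a principal curvature in direction \<open>\<eta>\<close> (zero if \<open>c\<close> is none);
  these numbers encode the multiset of principal curvatures.\<close>

definition pc_mult ::
  "'a::euclidean_space set \<Rightarrow> 'a set \<Rightarrow> 'a \<Rightarrow> 'a \<Rightarrow> real \<Rightarrow> nat" where
  "pc_mult N H x \<eta> c = dim {v \<in> tangent_space H x. shape_op N H x \<eta> v = c *\<^sub>R v}"

definition austere :: "'a::euclidean_space set \<Rightarrow> 'a set \<Rightarrow> bool" where
  "austere N H \<longleftrightarrow> (\<forall>x\<in>H. \<forall>\<eta>\<in>normal_space N H x.
     norm \<eta> = 1 \<longrightarrow> (\<forall>c. pc_mult N H x \<eta> c = pc_mult N H x \<eta> (- c)))"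

definition condition_A :: "'a::euclidean_space set \<Rightarrow> 'a set \<Rightarrow> 'a \<Rightarrow> bool" where
  "condition_A S M x \<longleftrightarrow>
     (\<forall>\<eta>\<in>normal_space S M x. \<forall>\<xi>\<in>normal_space S M x. norm \<eta> = 1 \<longrightarrow> norm \<xi> = 1 \<longrightarrow>
        {v \<in> tangent_space M x. shape_op S M x \<eta> v = 0} =
        {v \<in> tangent_space M x. shape_op S M x \<xi> v = 0})"

definition hypersurface :: "'a::euclidean_space set \<Rightarrow> 'a set \<Rightarrow> bool" where
  "hypersurface N H \<longleftrightarrow> H \<subseteq> N \<and> (\<exists>k. submanifold (Suc k) N \<and> submanifold k H)"

definition unit_normal_field ::
  "'a::euclidean_space set \<Rightarrow> 'a set \<Rightarrow> ('a \<Rightarrow> 'a) \<Rightarrow> bool" where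
  "unit_normal_field N H \<nu> \<longleftrightarrow>
     smooth_on H \<nu> \<and> (\<forall>x\<in>H. \<nu> x \<in> normal_space N H x \<and> norm (\<nu> x) = 1)"

definition const_principal_curvatures :: "'a::euclidean_space set \<Rightarrow> 'a set \<Rightarrow> bool" where
  "const_principal_curvatures N H \<longleftrightarrow> hypersurface N H \<and>
     (\<exists>\<nu>. unit_normal_field N H \<nu> \<and>
        (\<forall>x\<in>H. \<forall>y\<in>H. \<forall>c. pc_mult N H x (\<nu> x) c = pc_mult N H y (\<nu> y) c))"

text \<open>The parallel set \<open>{exp\<^sub>x(t \<nu>(x)) | x \<in> H}\<close> at signed distance \<open>t\<close>, where \<open>exp\<close> is the
  exponential map of \<open>N\<close>.\<close>

definition parallel ::
  "'a::euclidean_space set \<Rightarrow> 'a set \<Rightarrow> ('a \<Rightarrow> 'a) \<Rightarrow> real \<Rightarrow> 'a set" where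
  "parallel N H \<nu> t = {\<gamma> t |\<gamma>. \<exists>a b. 0 \<in> {a<..<b} \<and> t \<in> {a<..<b} \<and>
     geodesic_on {a<..<b} N \<gamma> \<and> \<gamma> 0 \<in> H \<and> vector_derivative \<gamma> (at 0) = \<nu> (\<gamma> 0)}"

definition totally_isoparametric :: "'a::euclidean_space set \<Rightarrow> 'a set \<Rightarrow> bool" where
  "totally_isoparametric N H \<longleftrightarrow> const_principal_curvatures N H \<and>
     (\<exists>\<nu> \<epsilon>. unit_normal_field N H \<nu> \<and> 0 < \<epsilon> \<and>
        (\<forall>t. \<bar>t\<bar> < \<epsilon> \<longrightarrow> const_principal_curvatures N (parallel N H \<nu> t)))"


section \<open>Isoparametric functions\<close>

definition isoparametric :: "'a::euclidean_space set \<Rightarrow> ('a \<Rightarrow> real) \<Rightarrow> bool" where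
  "isoparametric N h \<longleftrightarrow> (\<exists>k. submanifold k N) \<and> smooth_on N h \<and>
     (\<exists>b a. smooth_on (h ` N) b \<and> continuous_on (h ` N) a \<and>
        (\<forall>x\<in>N. (norm (grad N h x))\<^sup>2 = b (h x) \<and> laplacian N h x = a (h x)))"

definition level_set :: "'a set \<Rightarrow> ('a \<Rightarrow> real) \<Rightarrow> real \<Rightarrow> 'a set" where
  "level_set N h c = {x \<in> N. h x = c}"

definition regular_level :: "'a::euclidean_space set \<Rightarrow> ('a \<Rightarrow> real) \<Rightarrow> real \<Rightarrow> bool" where
  "regular_level N h c \<longleftrightarrow> level_set N h c \<noteq> {} \<and> (\<forall>x\<in>level_set N h c. grad N h x \<noteq> 0)"

definition focal_variety :: "'a::euclidean_space set \<Rightarrow> ('a \<Rightarrow> real) \<Rightarrow> 'a set" where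
  "focal_variety N h = \<Union>{level_set N h c |c. \<exists>x\<in>level_set N h c. grad N h x = 0}"


section \<open>Clifford systems and OT-FKM focal submanifolds\<close>

definition symmetric_clifford_system :: "nat \<Rightarrow> (nat \<Rightarrow> real^'n^'n) \<Rightarrow> bool" where
  "symmetric_clifford_system m P \<longleftrightarrow>
     (\<forall>\<alpha>\<le>m. transpose (P \<alpha>) = P \<alpha>) \<and>
     (\<forall>\<alpha>\<le>m. \<forall>\<beta>\<le>m. P \<alpha> ** P \<beta> + P \<beta> ** P \<alpha> = mat (if \<alpha> = \<beta> then 2 else 0))"

definition clifford_prod :: "nat \<Rightarrow> (nat \<Rightarrow> real^'n^'n) \<Rightarrow> real^'n^'n" where
  "clifford_prod m P = foldr (\<lambda>\<alpha> A. P \<alpha> ** A) [0..<Suc m] (mat 1)"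

definition twisted_system :: "nat \<Rightarrow> (nat \<Rightarrow> real^'n^'n) \<Rightarrow> nat \<Rightarrow> real^'n^'n" where
  "twisted_system m P \<alpha> = P \<alpha> ** clifford_prod m P"

definition FKM_poly :: "nat \<Rightarrow> (nat \<Rightarrow> real^'n^'n) \<Rightarrow> real^'n \<Rightarrow> real" where
  "FKM_poly m P x = norm x ^ 4 - 2 * (\<Sum>\<alpha>\<le>m. ((P \<alpha> *v x) \<bullet> x)\<^sup>2)"

definition M_plus :: "nat \<Rightarrow> (nat \<Rightarrow> real^'n^'n) \<Rightarrow> (real^'n) set" where
  "M_plus m P = {x \<in> sphere 0 1. FKM_poly m P x = 1}"

definition M_minus :: "nat \<Rightarrow> (nat \<Rightarrow> real^'n^'n) \<Rightarrow> (real^'n) set" where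
  "M_minus m P = {x \<in> sphere 0 1. FKM_poly m P x = - 1}"

end

theory Submission
  imports Defs
begin

text \<open>A point \<open>x\<close> of \<open>M\<^sub>-\<close> is a unit vector fixed by \<open>A w = \<Sum>\<^sub>\<alpha> w\<^sub>\<alpha> P\<^sub>\<alpha>\<close> for a unique unit vector \<open>w = q x\<close>, so
  \<open>M\<^sub>-\<close> is a bundle of great spheres over a sphere. The symmetric involution \<open>J = P\<^sub>0 \<cdots> P\<^sub>8\<close> commutes
  with all \<open>P\<^sub>\<alpha>\<close>, and \<open>h x = \<langle>J x, x\<rangle>\<close> is the required function: its gradient \<open>2 (J x - h x x)\<close> is
  tangent to the fibres, and \<open>|\<nabla>h|\<^sup>2 = 4 (1 - h\<^sup>2)\<close>, \<open>\<Delta>h = -32 h\<close>. On the level set \<open>h = 0\<close> the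
  field \<open>J x\<close> is a unit normal, the principal curvatures are \<open>\<plusminus>1\<close> and \<open>0\<close>, and the normal geodesics are
  the great circles \<open>cos t x + sin t J x\<close>, so that the parallel hypersurfaces are level sets of \<open>h\<close>.
  The focal variety is \<open>J x = \<plusminus>x\<close>. The kernel of the shape operator of \<open>M\<^sub>-\<close> at \<open>x\<close> in direction
  \<open>\<eta>\<close> consists of the vertical vectors orthogonal to all \<open>A z \<eta>\<close>, and if both \<open>J\<close>-components of \<open>x\<close> are
  nonzero, independence of \<open>\<eta>\<close> contradicts that \<open>P\<^sub>0 \<cdots> P\<^sub>8\<close> has opposite signs on them.\<close>

section \<open>Smooth maps\<close>

lemma Ck_cong:
  assumes "open U" "\<And>x. x \<in> U \<Longrightarrow> f x = g x" "Ck k U f"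
  shows "Ck k U g"
  using assms
proof (induction k arbitrary: f g)
  case 0
  then show ?case by (simp cong: continuous_on_cong)
next
  case (Suc k)
  have fd: "(g has_derivative frechet_derivative f (at x)) (at x)" if "x \<in> U" for x
    using Suc.prems that
    by (auto intro!: has_derivative_transform_within_open[of f _ x UNIV U g] simp: frechet_derivative_works)
  have eq: "frechet_derivative f (at x) = frechet_derivative g (at x)" if "x \<in> U" for x
    using frechet_derivative_at[OF fd[OF that]] .
  have "Ck k U (\<lambda>x. frechet_derivative g (at x) v)" for v
    by (rule Suc.IH[OF Suc.prems(1), of "\<lambda>x. frechet_derivative f (at x) v"])
      (use Suc.prems eq in auto)
  then show ?case using fd by (auto simp: differentiable_def)
qed

lemma Ck_SucI:
  assumes "open U" "\<And>x. x \<in> U \<Longrightarrow> (f has_derivative f' x) (at x)" "\<And>v. Ck k U (\<lambda>x. f' x v)"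
  shows "Ck (Suc k) U f"
proof -
  have "f' x = frechet_derivative f (at x)" if "x \<in> U" for x
    using frechet_derivative_at[OF assms(2)[OF that]] .
  then have "Ck k U (\<lambda>x. frechet_derivative f (at x) v)" for v
    by (intro Ck_cong[OF assms(1) _ assms(3)]) auto
  then show ?thesis using assms(2) by (auto simp: differentiable_def)
qed

lemma Ck_Suc_has_derivative:
  assumes "Ck (Suc k) U f" "x \<in> U"
  shows "(f has_derivative frechet_derivative f (at x)) (at x)"
  using assms by (auto simp: frechet_derivative_works)

lemma Ck_SucD: "Ck (Suc k) U f \<Longrightarrow> Ck k U f"
proof (induction k arbitrary: f)
  case 0
  then have "f differentiable at x within U" if "x \<in> U" for x
    using that by (auto intro: differentiable_at_withinI)
  then show ?case
    by (simp add: continuous_on_eq_continuous_within differentiable_imp_continuous_within)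
next
  case (Suc k)
  have "Ck k U (\<lambda>x. frechet_derivative f (at x) v)" for v
    using Suc.prems by (intro Suc.IH) simp
  then show ?case using Suc.prems by simp
qed

lemma Ck_subset: "Ck k U f \<Longrightarrow> V \<subseteq> U \<Longrightarrow> Ck k V f"
  by (induction k arbitrary: f) (auto intro: continuous_on_subset)

lemma Ck_const: "open U \<Longrightarrow> Ck k U (\<lambda>x. c)"
proof (induction k arbitrary: c)
  case (Suc k)
  show ?case by (rule Ck_SucI[of _ _ "\<lambda>x v. 0"]) (use Suc in auto)
qed auto

lemma Ck_bounded_linear:
  assumes "open U" "bounded_linear f"
  shows "Ck k U f"
proof (cases k)
  case (Suc j)
  show ?thesis unfolding Suc
    by (rule Ck_SucI[of _ _ "\<lambda>x. f"]) (use assms in \<open>auto intro: bounded_linear_imp_has_derivative Ck_const\<close>)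
qed (use assms in \<open>simp add: linear_continuous_on\<close>)

lemma Ck_add: "open U \<Longrightarrow> Ck k U f \<Longrightarrow> Ck k U g \<Longrightarrow> Ck k U (\<lambda>x. f x + g x)"
proof (induction k arbitrary: f g)
  case (Suc k)
  show ?case
    by (rule Ck_SucI[of _ _ "\<lambda>x v. frechet_derivative f (at x) v + frechet_derivative g (at x) v"])
      (use Suc in \<open>auto intro!: derivative_intros simp flip: frechet_derivative_works\<close>)
qed (auto intro: continuous_intros)

lemma Ck_bilinear:
  assumes "bounded_bilinear pr" "open U" "Ck k U f" "Ck k U g"
  shows "Ck k U (\<lambda>x. pr (f x) (g x))"
  using assms(3,4)
proof (induction k arbitrary: f g)
  case 0
  then show ?case using bounded_bilinear.continuous_on[OF assms(1)] by auto
next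
  case (Suc k)
  show ?case
  proof (rule Ck_SucI[of _ _ "\<lambda>x v. pr (f x) (frechet_derivative g (at x) v)
      + pr (frechet_derivative f (at x) v) (g x)"])
    show "((\<lambda>x. pr (f x) (g x)) has_derivative (\<lambda>v. pr (f x) (frechet_derivative g (at x) v)
      + pr (frechet_derivative f (at x) v) (g x))) (at x)" if "x \<in> U" for x
      using that Suc.prems
      by (auto intro!: bounded_bilinear.FDERIV[OF assms(1)] simp flip: frechet_derivative_works)
    show "Ck k U (\<lambda>x. pr (f x) (frechet_derivative g (at x) v) + pr (frechet_derivative f (at x) v) (g x))" for v
      using Suc.prems Ck_SucD[OF Suc.prems(1)] Ck_SucD[OF Suc.prems(2)]
      by (auto intro!: Ck_add Suc.IH assms(2))
  qed fact
qed

lemma Ck_sum: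
  "open U \<Longrightarrow> (\<And>i. i \<in> I \<Longrightarrow> Ck k U (f i)) \<Longrightarrow> Ck k U (\<lambda>x. \<Sum>i\<in>I. f i x)"
  by (induction I rule: infinite_finite_induct) (auto intro: Ck_const Ck_add)

lemma Ck_compose:
  fixes g :: "'a::euclidean_space \<Rightarrow> 'b::euclidean_space"
  assumes "open U" "open V" "g ` U \<subseteq> V" "Ck k U g" "Ck k V f"
  shows "Ck k U (\<lambda>x. f (g x))"
  using assms(4,5)
proof (induction k arbitrary: f)
  case 0
  then show ?case using assms(3) by (auto intro: continuous_on_compose2)
next
  case (Suc k)
  let ?D = "\<lambda>x v. \<Sum>b\<in>Basis. (frechet_derivative g (at x) v \<bullet> b) *\<^sub>R frechet_derivative f (at (g x)) b"
  show ?case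
  proof (rule Ck_SucI[of _ _ ?D])
    fix x assume x: "x \<in> U"
    have df: "(f has_derivative frechet_derivative f (at (g x))) (at (g x))"
      using Suc.prems(2) x assms(3) by (intro Ck_Suc_has_derivative) auto
    have dg: "(g has_derivative frechet_derivative g (at x)) (at x)"
      using Ck_Suc_has_derivative[OF Suc.prems(1) x] .
    have lin: "linear (frechet_derivative f (at (g x)))"
      using df has_derivative_linear by blast
    have rep: "frechet_derivative f (at (g x)) u = (\<Sum>b\<in>Basis. (u \<bullet> b) *\<^sub>R frechet_derivative f (at (g x)) b)" for u
      by (subst (1) euclidean_representation[symmetric])
        (simp add: linear_sum[OF lin] linear_scale[OF lin])
    have "?D x = frechet_derivative f (at (g x)) \<circ> frechet_derivative g (at x)"
      by (rule ext) (simp only: o_def rep[of "frechet_derivative g (at x) _"])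
    then show "((\<lambda>x. f (g x)) has_derivative ?D x) (at x)"
      using diff_chain_at[OF dg df] by (simp add: o_def)
  next
    fix v
    have g: "Ck k U g" using Ck_SucD[OF Suc.prems(1)] .
    have "Ck k U (\<lambda>x. frechet_derivative f (at (g x)) b)" for b
      by (rule Suc.IH[OF g, of "\<lambda>y. frechet_derivative f (at y) b"]) (use Suc.prems in simp)
    moreover have "Ck k U (\<lambda>x. frechet_derivative g (at x) v \<bullet> b)" for b
      using Suc.prems assms(1)
      by (intro Ck_bilinear[OF bounded_bilinear_inner] Ck_const) auto
    ultimately show "Ck k U (\<lambda>x. ?D x v)"
      by (intro Ck_sum Ck_bilinear[OF bounded_bilinear_scaleR] assms(1))
  qed fact
qed

lemma Ck_powr: "Ck k {0<..} (\<lambda>s::real. s powr a)"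
proof (induction k arbitrary: a)
  case 0
  show ?case by (auto intro!: continuous_intros)
next
  case (Suc k)
  show ?case
  proof (rule Ck_SucI[of _ _ "\<lambda>s v. (a * s powr (a - 1)) * v"])
    show "((\<lambda>s. s powr a) has_derivative (\<lambda>v. (a * s powr (a - 1)) * v)) (at s)" if "s \<in> {0<..}" for s
      using that has_real_derivative_powr[of s a] by (simp add: has_field_derivative_def)
    show "Ck k {0<..} (\<lambda>s. (a * s powr (a - 1)) * v)" for v
      by (intro Ck_bilinear[OF bounded_bilinear_mult] Ck_const Suc) auto
  qed auto
qed

lemma Ck_sin_cos: "Ck k UNIV (sin :: real \<Rightarrow> real)" "Ck k UNIV (cos :: real \<Rightarrow> real)"
proof (induction k)
  case (Suc k)
  { case 1
    show ?case
      by (rule Ck_SucI[of _ _ "\<lambda>s v. v * cos s"])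
        (auto intro!: derivative_eq_intros Ck_bilinear[OF bounded_bilinear_mult] Ck_const Suc) }
  { case 2
    show ?case
      by (rule Ck_SucI[of _ _ "\<lambda>s v. (- v) * sin s"])
        (auto intro!: derivative_eq_intros Ck_bilinear[OF bounded_bilinear_mult, of UNIV k "\<lambda>x. - v" for v, simplified] Ck_const Suc) }
qed (auto intro: continuous_intros)

lemma smooth_onI:
  assumes "open U" "S \<subseteq> U" "\<And>k. Ck k U f"
  shows "smooth_on S f"
  unfolding smooth_on_def
proof
  fix x assume "x \<in> S"
  then show "\<exists>U g. open U \<and> x \<in> U \<and> (\<forall>k. Ck k U g) \<and> (\<forall>y\<in>S \<inter> U. g y = f y)"
    by (intro exI[of _ U] exI[of _ f]) (use assms in auto)
qed

lemma smooth_on_cong: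
  assumes "smooth_on T f" "S \<subseteq> T" "\<And>x. x \<in> S \<Longrightarrow> f x = g x"
  shows "smooth_on S g"
  unfolding smooth_on_def
proof
  fix x assume "x \<in> S"
  then have "x \<in> T" using assms(2) by auto
  then obtain U h where "open U" "x \<in> U" "\<And>k. Ck k U h" "\<And>y. y \<in> T \<inter> U \<Longrightarrow> h y = f y"
    using assms(1) unfolding smooth_on_def by meson
  then show "\<exists>U h. open U \<and> x \<in> U \<and> (\<forall>k. Ck k U h) \<and> (\<forall>y\<in>S \<inter> U. h y = g y)"
    by (intro exI[of _ U] exI[of _ h]) (use assms in auto)
qed

lemmas smooth_on_subset = smooth_on_cong[OF _ _ refl]

lemma smooth_on_const: "smooth_on S (\<lambda>x. c)"
  by (rule smooth_onI[of UNIV]) (auto intro: Ck_const)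

lemma smooth_on_bounded_linear: "bounded_linear f \<Longrightarrow> smooth_on S f"
  by (rule smooth_onI[of UNIV]) (auto intro: Ck_bounded_linear)

lemma smooth_on_compose:
  fixes f :: "'a::euclidean_space \<Rightarrow> 'b::euclidean_space"
  assumes f: "smooth_on S f" and g: "smooth_on T g" and sub: "\<And>x. x \<in> S \<Longrightarrow> f x \<in> T"
  shows "smooth_on S (\<lambda>x. g (f x))"
  unfolding smooth_on_def
proof
  fix x assume x: "x \<in> S"
  obtain U f' where U: "open U" "x \<in> U" "\<And>k. Ck k U f'" "\<And>y. y \<in> S \<inter> U \<Longrightarrow> f' y = f y"
    using f x unfolding smooth_on_def by meson
  obtain V g' where V: "open V" "f x \<in> V" "\<And>k. Ck k V g'" "\<And>y. y \<in> T \<inter> V \<Longrightarrow> g' y = g y"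
    using g sub[OF x] unfolding smooth_on_def by meson
  have c: "continuous_on U f'" using U(3)[of 0] by simp
  let ?W = "U \<inter> f' -` V"
  have W: "open ?W" using continuous_open_preimage[OF c U(1) V(1)] .
  show "\<exists>W k. open W \<and> x \<in> W \<and> (\<forall>n. Ck n W k) \<and> (\<forall>y\<in>S \<inter> W. k y = g (f y))"
  proof (intro exI conjI allI ballI)
    show "Ck n ?W (\<lambda>y. g' (f' y))" for n
      by (rule Ck_compose[OF W V(1)]) (use U V in \<open>auto intro: Ck_subset\<close>)
    show "x \<in> ?W" using U V x by auto
    show "g' (f' y) = g (f y)" if "y \<in> S \<inter> ?W" for y
      using that U(4)[of y] V(4)[of "f y"] sub[of y] by auto
  qed (rule W)
qed

lemma smooth_on_binary:
  fixes S :: "'a::euclidean_space set"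
  assumes op: "\<And>(U :: 'a set) k f g. open U \<Longrightarrow> Ck k U f \<Longrightarrow> Ck k U g \<Longrightarrow> Ck k U (\<lambda>x. F (f x) (g x))"
    and f: "smooth_on S f" and g: "smooth_on S g"
  shows "smooth_on S (\<lambda>x. F (f x) (g x))"
  unfolding smooth_on_def
proof
  fix x assume x: "x \<in> S"
  obtain U f' where U: "open U" "x \<in> U" "\<And>k. Ck k U f'" "\<And>y. y \<in> S \<inter> U \<Longrightarrow> f' y = f y"
    using f x unfolding smooth_on_def by meson
  obtain V g' where V: "open V" "x \<in> V" "\<And>k. Ck k V g'" "\<And>y. y \<in> S \<inter> V \<Longrightarrow> g' y = g y"
    using g x unfolding smooth_on_def by meson
  show "\<exists>W k. open W \<and> x \<in> W \<and> (\<forall>n. Ck n W k) \<and> (\<forall>y\<in>S \<inter> W. k y = F (f y) (g y))"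
    by (rule exI[of _ "U \<inter> V"], rule exI[of _ "\<lambda>x. F (f' x) (g' x)"])
      (use U V in \<open>auto intro!: op intro: Ck_subset\<close>)
qed

lemma smooth_on_add: "smooth_on S f \<Longrightarrow> smooth_on S g \<Longrightarrow> smooth_on S (\<lambda>x. f x + g x)"
  by (rule smooth_on_binary[of "(+)"]) (rule Ck_add)

lemma smooth_on_bilinear:
  assumes "bounded_bilinear F" "smooth_on S f" "smooth_on S g"
  shows "smooth_on S (\<lambda>x. F (f x) (g x))"
  by (rule smooth_on_binary[of F, OF Ck_bilinear[OF assms(1)] assms(2,3)])

lemmas smooth_on_scaleR = smooth_on_bilinear[OF bounded_bilinear_scaleR]
lemmas smooth_on_mult = smooth_on_bilinear[OF bounded_bilinear_mult]
lemmas smooth_on_inner = smooth_on_bilinear[OF bounded_bilinear_inner]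

lemma smooth_on_linear:
  fixes f :: "'a::euclidean_space \<Rightarrow> 'b::real_normed_vector"
  shows "linear f \<Longrightarrow> smooth_on S f"
  by (simp add: smooth_on_bounded_linear linear_conv_bounded_linear)

lemma smooth_on_linear_compose:
  fixes f :: "'a::euclidean_space \<Rightarrow> 'b::euclidean_space"
  assumes "linear L" "smooth_on S f"
  shows "smooth_on S (\<lambda>x. L (f x))"
  using smooth_on_compose[OF assms(2) smooth_on_linear[OF assms(1), of UNIV]] by simp

lemma smooth_on_minus:
  assumes "smooth_on S f"
  shows "smooth_on S (\<lambda>x. - f x)"
  using smooth_on_scaleR[OF smooth_on_const[of S "-1::real"] assms] by simp

lemma smooth_on_diff:
  assumes "smooth_on S f" "smooth_on S g"
  shows "smooth_on S (\<lambda>x. f x - g x)"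
  using smooth_on_add[OF assms(1) smooth_on_minus[OF assms(2)]] by simp

lemma smooth_on_id: "smooth_on S (\<lambda>x. x)"
  by (rule smooth_on_bounded_linear) (rule bounded_linear_ident)

lemma smooth_on_powr:
  fixes f :: "'a::euclidean_space \<Rightarrow> real"
  assumes "smooth_on S f" "\<And>x. x \<in> S \<Longrightarrow> 0 < f x"
  shows "smooth_on S (\<lambda>x. f x powr a)"
  by (rule smooth_on_compose[OF assms(1), of "{0<..}"])
    (use assms(2) in \<open>auto intro: smooth_onI[of "{0<..}"] Ck_powr\<close>)

lemma smooth_on_inverse:
  fixes f :: "'a::euclidean_space \<Rightarrow> real"
  assumes "smooth_on S f" "\<And>x. x \<in> S \<Longrightarrow> 0 < f x"
  shows "smooth_on S (\<lambda>x. inverse (f x))"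
  by (rule smooth_on_cong[OF smooth_on_powr[OF assms, of "-1"] subset_refl]) (use assms(2) in \<open>auto simp: powr_minus less_imp_le\<close>)

lemma smooth_on_sqrt:
  assumes "smooth_on S f" "\<And>x. x \<in> S \<Longrightarrow> 0 < f x"
  shows "smooth_on S (\<lambda>x. sqrt (f x))"
  by (rule smooth_on_cong[OF smooth_on_powr[OF assms, of "1/2"] subset_refl]) (use assms(2) in \<open>auto simp: powr_half_sqrt less_imp_le\<close>)

lemma smooth_on_sin:
  fixes f :: "'a::euclidean_space \<Rightarrow> real"
  assumes "smooth_on S f"
  shows "smooth_on S (\<lambda>x. sin (f x))"
  by (rule smooth_on_compose[OF assms smooth_onI[OF open_UNIV subset_UNIV Ck_sin_cos(1)]]) (rule UNIV_I)

lemma smooth_on_cos: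
  fixes f :: "'a::euclidean_space \<Rightarrow> real"
  assumes "smooth_on S f"
  shows "smooth_on S (\<lambda>x. cos (f x))"
  by (rule smooth_on_compose[OF assms smooth_onI[OF open_UNIV subset_UNIV Ck_sin_cos(2)]]) (rule UNIV_I)

lemmas smooth_on_intros = smooth_on_const smooth_on_id smooth_on_add smooth_on_diff smooth_on_minus
  smooth_on_scaleR smooth_on_mult smooth_on_inner smooth_on_sin smooth_on_cos

lemma has_derivative_transform_locally:
  assumes "(f has_derivative f') (at x within S)" "x \<in> S" "open U" "x \<in> U" "\<And>y. y \<in> S \<inter> U \<Longrightarrow> f y = g y"
  shows "(g has_derivative f') (at x within S)"
  by (rule has_derivative_transform_eventually[OF assms(1)])
    (use assms in \<open>auto simp: eventually_at_topological\<close>)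

lemma smooth_on_has_derivative:
  assumes "smooth_on S f" "x \<in> S"
  obtains f' where "(f has_derivative f') (at x within S)"
proof -
  obtain U g where U: "open U" "x \<in> U" "\<And>k. Ck k U g" "\<And>y. y \<in> S \<inter> U \<Longrightarrow> g y = f y"
    using assms unfolding smooth_on_def by meson
  have "(g has_derivative frechet_derivative g (at x)) (at x within S)"
    using Ck_Suc_has_derivative[OF U(3)[of "Suc 0"] U(2)] has_derivative_at_withinI by blast
  then have "(f has_derivative frechet_derivative g (at x)) (at x within S)"
    by (rule has_derivative_transform_locally[OF _ assms(2) U(1,2)]) (use U in auto)
  then show thesis by (rule that)
qed

lemma smooth_on_imp_continuous_on:
  assumes "smooth_on S f"
  shows "continuous_on S f"
  unfolding continuous_on_eq_continuous_within
proof
  fix x assume "x \<in> S"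
  from smooth_on_has_derivative[OF assms this] obtain f' where "(f has_derivative f') (at x within S)" .
  then show "continuous (at x within S) f" by (rule has_derivative_continuous)
qed

lemma smooth_on_open_second_derivative:
  fixes f :: "real \<Rightarrow> 'a::euclidean_space"
  assumes "smooth_on I f" "open I" "s \<in> I"
  shows "(f has_vector_derivative vector_derivative f (at s)) (at s)"
    and "((\<lambda>r. vector_derivative f (at r)) has_vector_derivative
      vector_derivative (\<lambda>r. vector_derivative f (at r)) (at s)) (at s)"
proof -
  obtain U g where U: "open U" "s \<in> U" "\<And>k. Ck k U g" "\<And>y. y \<in> I \<inter> U \<Longrightarrow> g y = f y"
    using assms unfolding smooth_on_def by meson
  have op: "open (I \<inter> U)" using assms U by auto
  have d: "(f has_vector_derivative frechet_derivative g (at r) 1) (at r)" if r: "r \<in> I \<inter> U" for r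
  proof -
    have "(g has_derivative frechet_derivative g (at r)) (at r)"
      using Ck_Suc_has_derivative[OF U(3)[of "Suc 0"]] r by auto
    then have "(f has_derivative frechet_derivative g (at r)) (at r)"
      by (rule has_derivative_transform_within_open[OF _ op r]) (use U r in auto)
    moreover have "frechet_derivative g (at r) = (\<lambda>h. h *\<^sub>R frechet_derivative g (at r) 1)"
    proof
      show "frechet_derivative g (at r) h = h *\<^sub>R frechet_derivative g (at r) 1" for h
        using linear_cmul[OF has_derivative_linear[OF calculation], of h 1] by simp
    qed
    ultimately show ?thesis
      by (simp add: has_vector_derivative_def)
  qed
  have e: "vector_derivative f (at r) = frechet_derivative g (at r) 1" if "r \<in> I \<inter> U" for r
    using d[OF that] vector_derivative_at by blast
  show "(f has_vector_derivative vector_derivative f (at s)) (at s)"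
    using d[of s] e[of s] assms U by auto
  have "Ck (Suc 0) U (\<lambda>x. frechet_derivative g (at x) 1)"
    using U(3)[of "Suc (Suc 0)"] by simp
  then have "(\<lambda>x. frechet_derivative g (at x) 1) differentiable (at s)"
    using U(2) by auto
  then obtain D where "((\<lambda>x. frechet_derivative g (at x) 1) has_derivative D) (at s)"
    by (auto simp: differentiable_def)
  then have "((\<lambda>r. vector_derivative f (at r)) has_derivative D) (at s)"
    by (rule has_derivative_transform_within_open[OF _ op]) (use e assms(3) U(2) in auto)
  then have "(\<lambda>r. vector_derivative f (at r)) differentiable (at s)"
    by (auto simp: differentiable_def)
  then show "((\<lambda>r. vector_derivative f (at r)) has_vector_derivative
      vector_derivative (\<lambda>r. vector_derivative f (at r)) (at s)) (at s)"
    by (simp add: vector_derivative_works)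
qed

section \<open>Tangent spaces, orthonormal bases and shape operators\<close>

lemma tangent_spaceI:
  assumes "0 < e" "smooth_on {-e<..<e::real} \<gamma>" "\<gamma> ` {-e<..<e} \<subseteq> M" "\<gamma> 0 = x"
    "(\<gamma> has_vector_derivative v) (at 0)"
  shows "v \<in> tangent_space M x"
  unfolding tangent_space_def
  by (rule CollectI, rule exI[of _ \<gamma>], rule exI[of _ e]) (use assms in simp)

lemma tangent_spaceE:
  assumes "v \<in> tangent_space M x"
  obtains \<gamma> e where "0 < e" "smooth_on {-e<..<e::real} \<gamma>" "\<gamma> ` {-e<..<e} \<subseteq> M" "\<gamma> 0 = x"
    "(\<gamma> has_vector_derivative v) (at 0)"
  using assms unfolding tangent_space_def by (elim CollectE exE conjE)

lemma tangent_space_mono: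
  assumes "M \<subseteq> N" "v \<in> tangent_space M x"
  shows "v \<in> tangent_space N x"
  using assms(2)
proof (rule tangent_spaceE)
  fix \<gamma> e assume *: "0 < e" "smooth_on {-e<..<e::real} \<gamma>" "\<gamma> ` {-e<..<e} \<subseteq> M" "\<gamma> 0 = x"
    "(\<gamma> has_vector_derivative v) (at 0)"
  show ?thesis by (rule tangent_spaceI[OF *(1,2) _ *(4,5)]) (use * assms(1) in auto)
qed

lemma deriv_along_eq:
  assumes f: "(f has_derivative f') (at x within M)" and v: "v \<in> tangent_space M x"
  shows "deriv_along M f x v = f' v"
proof -
  obtain \<gamma> e where \<gamma>: "0 < e" "\<gamma> ` {-e<..<e::real} \<subseteq> M" "\<gamma> 0 = x" "(\<gamma> has_vector_derivative v) (at 0)"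
    using v by (rule tangent_spaceE)
  let ?I = "{-e<..<e}"
  have I: "at 0 within ?I = at 0" by (rule at_within_open) (use \<gamma> in auto)
  have chain: "((\<lambda>t. f (\<gamma> t)) has_vector_derivative d v) (at 0)"
    if d: "(f has_derivative d) (at x within M)" for d
  proof -
    have "(f has_derivative d) (at (\<gamma> 0) within \<gamma> ` ?I)"
      using has_derivative_subset[OF d \<gamma>(2)] \<gamma>(3) by simp
    from vector_derivative_diff_chain_within[of \<gamma> v 0 ?I f d] this \<gamma>(4) I
    show ?thesis by (simp add: o_def)
  qed
  have "(f has_derivative frechet_derivative f (at x within M)) (at x within M)"
    using f by (auto simp: differentiable_def simp flip: frechet_derivative_works)
  from chain[OF this] chain[OF f] show ?thesis
    unfolding deriv_along_def by (rule vector_derivative_unique_at)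
qed

lemma tangent_space_const:
  assumes f: "(f has_derivative f') (at x)" and c: "\<And>y. y \<in> M \<Longrightarrow> f y = c" and v: "v \<in> tangent_space M x"
  shows "f' v = 0"
proof -
  have x: "x \<in> M"
  proof -
    obtain \<gamma> e where "0 < e" "\<gamma> ` {-e<..<e::real} \<subseteq> M" "\<gamma> 0 = x"
      using v by (rule tangent_spaceE)
    then show ?thesis by force
  qed
  have "(f has_derivative (\<lambda>v. 0)) (at x within M)"
    by (rule has_derivative_transform[OF x _ has_derivative_const[of c]]) (use c in auto)
  then show ?thesis
    using deriv_along_eq[OF has_derivative_at_withinI[OF f] v] deriv_along_eq[OF _ v] by fastforce
qed

lemma tangent_proj_eq:
  assumes "subspace (tangent_space M x)" "u \<in> tangent_space M x"
    and "\<And>v. v \<in> tangent_space M x \<Longrightarrow> (w - u) \<bullet> v = 0"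
  shows "tangent_proj M x w = u"
  unfolding tangent_proj_def
proof (rule the_equality)
  fix u' assume u': "u' \<in> tangent_space M x \<and> (\<forall>v\<in>tangent_space M x. (w - u') \<bullet> v = 0)"
  then have "u - u' \<in> tangent_space M x" using assms by (auto intro: subspace_diff)
  then have "(w - u') \<bullet> (u - u') = 0" "(w - u) \<bullet> (u - u') = 0" using u' assms(3) by auto
  then have "(u - u') \<bullet> (u - u') = 0" by (simp add: inner_diff_left)
  then show "u' = u" by simp
qed (use assms in auto)

lemma tangent_proj_add_normal:
  assumes "\<And>v. v \<in> tangent_space M x \<Longrightarrow> n \<bullet> v = 0"
  shows "tangent_proj M x (n + w) = tangent_proj M x w"
  unfolding tangent_proj_def using assms by (simp add: inner_diff_left inner_add_left cong: conj_cong)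

lemma grad_eq:
  assumes "subspace (tangent_space M x)" "(h has_derivative h') (at x within M)"
    and "g \<in> tangent_space M x" "\<And>v. v \<in> tangent_space M x \<Longrightarrow> g \<bullet> v = h' v"
  shows "grad M h x = g"
  unfolding grad_def
proof (rule the_equality)
  show "g \<in> tangent_space M x \<and> (\<forall>v\<in>tangent_space M x. g \<bullet> v = deriv_along M h x v)"
    using assms deriv_along_eq[OF assms(2)] by simp
  fix g' assume g': "g' \<in> tangent_space M x \<and> (\<forall>v\<in>tangent_space M x. g' \<bullet> v = deriv_along M h x v)"
  then have "g - g' \<in> tangent_space M x" using assms by (auto intro: subspace_diff)
  then have "g \<bullet> (g - g') = g' \<bullet> (g - g')" using g' assms(4) deriv_along_eq[OF assms(2)] by simp
  then have "(g - g') \<bullet> (g - g') = 0" by (simp add: inner_diff_left)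
  then show "g' = g" by simp
qed

lemma orthonormal_basis_of_facts:
  assumes "orthonormal_basis_of B T"
  shows "finite B" "independent B" "card B = dim T" "subspace T"
    "\<And>a b. a \<in> B \<Longrightarrow> b \<in> B \<Longrightarrow> a \<bullet> b = (if a = b then 1 else 0)"
proof -
  have B: "B \<subseteq> T" "pairwise orthogonal B" "\<And>e. e \<in> B \<Longrightarrow> norm e = 1" "span B = T"
    using assms by (auto simp: orthonormal_basis_of_def)
  show i: "independent B" by (rule pairwise_orthogonal_independent) (use B in force)+
  then show "finite B" using independent_imp_finite by blast
  show "card B = dim T" using dim_span_eq_card_independent[OF i] B(4) by simp
  show "subspace T" using B(4) by force
  show "a \<bullet> b = (if a = b then 1 else 0)" if "a \<in> B" "b \<in> B" for a b
    using that B by (auto simp: pairwise_def orthogonal_def norm_eq_1)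
qed

lemma orthonormal_basis_of_inner:
  assumes "orthonormal_basis_of B T" "x \<in> T"
  shows "(\<Sum>b\<in>B. (x \<bullet> b) * (b \<bullet> y)) = x \<bullet> y"
    and "(\<Sum>b\<in>B. (x \<bullet> b) *\<^sub>R b) = x"
proof -
  have B: "pairwise orthogonal B" "\<And>e. e \<in> B \<Longrightarrow> e \<bullet> e = 1" "span B = T"
    using assms by (auto simp: orthonormal_basis_of_def norm_eq_1)
  note f = orthonormal_basis_of_facts[OF assms(1)]
  have "x \<in> span B" using B assms by simp
  then have "\<exists>u. (\<Sum>b\<in>B. u b *\<^sub>R b) = x" using span_finite[OF f(1)] by auto
  then obtain u where u: "x = (\<Sum>b\<in>B. u b *\<^sub>R b)" by metis
  have "x \<bullet> b = u b" if "b \<in> B" for b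
    unfolding u using that f(1) by (simp add: inner_sum_left f(5) if_distrib cong: if_cong)
  then show *: "(\<Sum>b\<in>B. (x \<bullet> b) *\<^sub>R b) = x" by (subst u) simp
  show "(\<Sum>b\<in>B. (x \<bullet> b) * (b \<bullet> y)) = x \<bullet> y"
    by (subst (2) *[symmetric]) (simp add: inner_sum_left)
qed

lemma trace_independent_of_basis:
  assumes B: "orthonormal_basis_of B T" and C: "orthonormal_basis_of C T" and L: "linear L"
  shows "(\<Sum>b\<in>B. L b \<bullet> b) = (\<Sum>c\<in>C. L c \<bullet> c)"
proof -
  have BT: "\<And>b. b \<in> B \<Longrightarrow> b \<in> T" and CT: "\<And>b. b \<in> C \<Longrightarrow> b \<in> T"
    using B C by (auto simp: orthonormal_basis_of_def)
  have "(\<Sum>b\<in>B. L b \<bullet> b) = (\<Sum>b\<in>B. \<Sum>c\<in>C. (b \<bullet> c) * (c \<bullet> L b))"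
    by (rule sum.cong[OF refl]) (use orthonormal_basis_of_inner(1)[OF C BT] in \<open>simp add: inner_commute[of "L _"]\<close>)
  also have "\<dots> = (\<Sum>c\<in>C. L (\<Sum>b\<in>B. (b \<bullet> c) *\<^sub>R b) \<bullet> c)"
    by (subst sum.swap) (simp add: linear_sum[OF L] linear_scale[OF L] inner_sum_left inner_commute[of _ "L _"])
  also have "\<dots> = (\<Sum>c\<in>C. L c \<bullet> c)"
    using orthonormal_basis_of_inner(2)[OF B CT] by (intro sum.cong refl) (simp add: inner_commute)
  finally show ?thesis .
qed

lemma orthonormal_basis_of_exists:
  assumes "subspace T"
  obtains B where "orthonormal_basis_of B T"
proof -
  obtain B where "B \<subseteq> T" "pairwise orthogonal B" "\<And>x. x \<in> B \<Longrightarrow> norm x = 1" "span B = T"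
    using orthonormal_basis_subspace[OF assms] by metis
  then have "orthonormal_basis_of B T" by (auto simp: orthonormal_basis_of_def)
  then show thesis by (rule that)
qed

lemma span_Un_sums: "span (B \<union> C) = {b + c |b c. b \<in> span B \<and> c \<in> span C}"
  by (auto simp: span_Un)

lemma orthonormal_basis_of_sums:
  assumes "orthonormal_basis_of B S" "orthonormal_basis_of C T" "\<And>s t. s \<in> S \<Longrightarrow> t \<in> T \<Longrightarrow> s \<bullet> t = 0"
  shows "orthonormal_basis_of (B \<union> C) {s + t |s t. s \<in> S \<and> t \<in> T}" "B \<inter> C = {}"
proof -
  note f = orthonormal_basis_of_facts[OF assms(1)] orthonormal_basis_of_facts[OF assms(2)]
  have s: "B \<subseteq> S" "C \<subseteq> T" "span B = S" "span C = T" using assms by (auto simp: orthonormal_basis_of_def)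
  show "B \<inter> C = {}"
  proof (rule ccontr)
    assume "B \<inter> C \<noteq> {}"
    then obtain b where "b \<in> B" "b \<in> C" by auto
    then show False using f(5)[of b b] assms(3)[of b b] s by auto
  qed
  have "b \<bullet> c = 0" "c \<bullet> b = 0" if "b \<in> B" "c \<in> C" for b c
    using assms(3) s that by (auto simp: inner_commute)
  then have "pairwise orthogonal (B \<union> C)"
    using f(5) f(10) by (auto simp: pairwise_def orthogonal_def)
  moreover have "span (B \<union> C) = {s + t |s t. s \<in> S \<and> t \<in> T}"
    using s by (simp add: span_Un_sums)
  moreover have "B \<union> C \<subseteq> span (B \<union> C)" by (rule span_superset)
  ultimately show "orthonormal_basis_of (B \<union> C) {s + t |s t. s \<in> S \<and> t \<in> T}"
    using assms by (auto simp: orthonormal_basis_of_def)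
qed

definition chart_at :: "nat \<Rightarrow> 'a::euclidean_space set \<Rightarrow> 'a \<Rightarrow> bool" where
  "chart_at k M x \<longleftrightarrow> (\<exists>U E (\<phi> :: 'a \<Rightarrow> 'a) \<psi>. open U \<and> x \<in> U \<and> subspace E \<and> dim E = k \<and>
    smooth_on (M \<inter> U) \<phi> \<and> smooth_on E \<psi> \<and> \<phi> ` (M \<inter> U) \<subseteq> E \<and> \<psi> ` E \<subseteq> M \<inter> U \<and>
    (\<forall>y\<in>M \<inter> U. \<psi> (\<phi> y) = y) \<and> (\<forall>p\<in>E. \<phi> (\<psi> p) = p))"

lemma submanifoldI:
  fixes M :: "'a::euclidean_space set"
  assumes "\<And>x. x \<in> M \<Longrightarrow> chart_at k M x"
  shows "submanifold k M"
  unfolding submanifold_def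
proof
  fix x assume "x \<in> M"
  from assms[OF this, unfolded chart_at_def] show "\<exists>U E V (\<phi> :: 'a \<Rightarrow> 'a) \<psi>. open U \<and> x \<in> U \<and>
     subspace E \<and> dim E = k \<and> openin (top_of_set E) V \<and>
     homeomorphism (M \<inter> U) V \<phi> \<psi> \<and> smooth_on (M \<inter> U) \<phi> \<and> smooth_on V \<psi>"
  proof (elim exE conjE)
    fix U E :: "'a set" and \<phi> \<psi> :: "'a \<Rightarrow> 'a"
    assume *: "open U" "x \<in> U" "subspace E" "dim E = k"
      "smooth_on (M \<inter> U) \<phi>" "smooth_on E \<psi>" "\<phi> ` (M \<inter> U) \<subseteq> E" "\<psi> ` E \<subseteq> M \<inter> U"
      "\<forall>y\<in>M \<inter> U. \<psi> (\<phi> y) = y" "\<forall>p\<in>E. \<phi> (\<psi> p) = p"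
    have "homeomorphism (M \<inter> U) E \<phi> \<psi>"
      by (rule homeomorphismI) (use * in \<open>simp_all add: smooth_on_imp_continuous_on\<close>)
    with * have "open U \<and> x \<in> U \<and> subspace E \<and> dim E = k \<and> openin (top_of_set E) E \<and>
      homeomorphism (M \<inter> U) E \<phi> \<psi> \<and> smooth_on (M \<inter> U) \<phi> \<and> smooth_on E \<psi>" by simp
    then show ?thesis by (intro exI)
  qed
qed

text \<open>Here \<open>Z y\<close> is a projection onto the normal space at \<open>y\<close>. A normal field \<open>\<zeta>\<close> satisfies
  \<open>\<zeta> y = Z y (\<zeta> y)\<close>, and in the product rule the term \<open>Z x (\<zeta>' v)\<close> is normal.\<close>

lemma shape_op_eq:
  fixes Z :: "'a::euclidean_space \<Rightarrow> 'a \<Rightarrow> 'a"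
  assumes x: "x \<in> H"
    and lin: "\<And>y. y \<in> H \<Longrightarrow> linear (Z y)"
    and range: "\<And>y \<xi>. y \<in> H \<Longrightarrow> Z y \<xi> \<in> normal_space N H y"
    and ident: "\<And>y \<xi>. y \<in> H \<Longrightarrow> \<xi> \<in> normal_space N H y \<Longrightarrow> Z y \<xi> = \<xi>"
    and smooth: "\<And>\<xi>. smooth_on H (\<lambda>y. Z y \<xi>)"
    and \<eta>: "\<eta> \<in> normal_space N H x" and v: "v \<in> tangent_space H x"
    and D: "((\<lambda>y. Z y \<eta>) has_derivative D) (at x within H)"
  shows "shape_op N H x \<eta> v = - tangent_proj H x (D v)"
  unfolding shape_op_def
proof (rule the_equality)
  have rep: "Z y \<xi> = (\<Sum>b\<in>Basis. (\<xi> \<bullet> b) *\<^sub>R Z y b)" if "y \<in> H" for y \<xi>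
    by (subst (1) euclidean_representation[symmetric, of \<xi>])
      (simp add: linear_sum[OF lin[OF that]] linear_scale[OF lin[OF that]])
  have "\<exists>d. ((\<lambda>y. Z y \<xi>) has_derivative d) (at x within H)" for \<xi>
    by (rule smooth_on_has_derivative[OF smooth x, of \<xi>]) (rule exI)
  then have "\<exists>d. \<forall>\<xi>. ((\<lambda>y. Z y \<xi>) has_derivative d \<xi>) (at x within H)" by (intro choice allI)
  then obtain d where d: "((\<lambda>y. Z y \<xi>) has_derivative d \<xi>) (at x within H)" for \<xi> by auto
  have "((\<lambda>y. \<Sum>b\<in>Basis. (\<eta> \<bullet> b) *\<^sub>R Z y b) has_derivative (\<lambda>w. \<Sum>b\<in>Basis. (\<eta> \<bullet> b) *\<^sub>R d b w)) (at x within H)"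
    by (intro derivative_intros d)
  then have "((\<lambda>y. Z y \<eta>) has_derivative (\<lambda>w. \<Sum>b\<in>Basis. (\<eta> \<bullet> b) *\<^sub>R d b w)) (at x within H)"
    by (rule has_derivative_transform[OF x, rotated]) (rule rep)
  then have Dv: "D v = (\<Sum>b\<in>Basis. (\<eta> \<bullet> b) *\<^sub>R d b v)"
    using deriv_along_eq[OF D v] deriv_along_eq[OF _ v] by fastforce
  show eq: "\<forall>U \<zeta>. open U \<and> x \<in> U \<and> smooth_on (H \<inter> U) \<zeta> \<and> (\<forall>y\<in>H \<inter> U. \<zeta> y \<in> normal_space N H y) \<and> \<zeta> x = \<eta>
     \<longrightarrow> - tangent_proj H x (D v) = - tangent_proj H x (deriv_along H \<zeta> x v)"
  proof (intro allI impI, elim conjE)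
    fix U \<zeta> assume U: "open U" "x \<in> U" "smooth_on (H \<inter> U) \<zeta>"
      and nor: "\<forall>y\<in>H \<inter> U. \<zeta> y \<in> normal_space N H y" and \<zeta>x: "\<zeta> x = \<eta>"
    have at: "at x within (H \<inter> U) = at x within H"
      by (rule at_within_nhd[OF U(2,1)]) auto
    obtain \<zeta>' where \<zeta>': "(\<zeta> has_derivative \<zeta>') (at x within H)"
      using smooth_on_has_derivative[OF U(3), of x] x U(2) at by auto
    have "((\<lambda>y. \<Sum>b\<in>Basis. (\<zeta> y \<bullet> b) *\<^sub>R Z y b) has_derivative
        (\<lambda>w. \<Sum>b\<in>Basis. (\<zeta> x \<bullet> b) *\<^sub>R d b w + (\<zeta>' w \<bullet> b) *\<^sub>R Z x b)) (at x within H)"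
      by (intro has_derivative_sum has_derivative_scaleR d has_derivative_inner_left \<zeta>')
    then have "(\<zeta> has_derivative (\<lambda>w. \<Sum>b\<in>Basis. (\<zeta> x \<bullet> b) *\<^sub>R d b w + (\<zeta>' w \<bullet> b) *\<^sub>R Z x b)) (at x within H)"
      by (rule has_derivative_transform_locally[OF _ x U(1,2)]) (use rep nor ident in \<open>metis IntE\<close>)
    from deriv_along_eq[OF this v]
    have "deriv_along H \<zeta> x v = Z x (\<zeta>' v) + D v"
      unfolding Dv rep[OF x, of "\<zeta>' v"] \<zeta>x by (simp add: sum.distrib)
    moreover have "tangent_proj H x (Z x (\<zeta>' v) + D v) = tangent_proj H x (D v)"
      by (rule tangent_proj_add_normal) (use range[OF x] in \<open>auto simp: normal_space_def\<close>)
    ultimately show "- tangent_proj H x (D v) = - tangent_proj H x (deriv_along H \<zeta> x v)" by simp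
  qed
  fix w assume "\<forall>U \<zeta>. open U \<and> x \<in> U \<and> smooth_on (H \<inter> U) \<zeta> \<and>
     (\<forall>y\<in>H \<inter> U. \<zeta> y \<in> normal_space N H y) \<and> \<zeta> x = \<eta> \<longrightarrow> w = - tangent_proj H x (deriv_along H \<zeta> x v)"
  from this[rule_format, of UNIV "\<lambda>y. Z y \<eta>"]
  show "w = - tangent_proj H x (D v)"
    using range ident[OF x \<eta>] smooth deriv_along_eq[OF D v] by simp
qed

section \<open>Clifford actions with a commuting involution\<close>

lemma dim_orthogonal_sums:
  fixes S T :: "'a::euclidean_space set"
  assumes "subspace S" "subspace T" "\<And>s t. s \<in> S \<Longrightarrow> t \<in> T \<Longrightarrow> s \<bullet> t = 0"
  shows "dim {s + t |s t. s \<in> S \<and> t \<in> T} = dim S + dim T"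
proof -
  obtain B where B: "orthonormal_basis_of B S" using orthonormal_basis_of_exists[OF assms(1)] .
  obtain C where C: "orthonormal_basis_of C T" using orthonormal_basis_of_exists[OF assms(2)] .
  note BC = orthonormal_basis_of_sums[OF B C assms(3)]
  show ?thesis
    using orthonormal_basis_of_facts(3)[OF BC(1)] orthonormal_basis_of_facts(1,3)[OF B]
      orthonormal_basis_of_facts(1,3)[OF C] BC(2) by (simp add: card_Un_disjoint)
qed

lemma dim_orthogonal_to_vector:
  fixes S :: "'a::euclidean_space set"
  assumes "subspace S" "a \<in> S" "a \<noteq> 0"
  shows "dim {x \<in> S. x \<bullet> a = 0} = dim S - 1"
proof -
  have "dim {y \<in> S. \<forall>x\<in>span {a}. orthogonal x y} + dim (span {a}) = dim S"
    using assms by (intro dim_subspace_orthogonal_to_vectors) (auto simp: span_minimal)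
  moreover have "{y \<in> S. \<forall>x\<in>span {a}. orthogonal x y} = {x \<in> S. x \<bullet> a = 0}"
    by (auto simp: span_singleton orthogonal_def inner_commute dest: spec[of _ 1])
  moreover have "dim (span {a}) = 1"
    using dim_eq_card_independent[of "{a}"] assms(3) by simp
  ultimately show ?thesis by simp
qed

locale clifford_action =
  fixes A :: "'b::euclidean_space \<Rightarrow> 'a::euclidean_space \<Rightarrow> 'a"
  assumes bilinear_A: "bilinear A"
    and A_A: "A w (A w x) = (w \<bullet> w) *\<^sub>R x"
    and A_sym: "A w x \<bullet> y = x \<bullet> A w y"
begin

lemma linear_A: "linear (A w)" and linear_A_left: "linear (\<lambda>w. A w x)"
  using bilinear_A by (auto simp: bilinear_def)

lemmas A_simps = linear_add[OF linear_A] linear_diff[OF linear_A] linear_scale[OF linear_A]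
  linear_neg[OF linear_A] linear_0[OF linear_A] linear_add[OF linear_A_left] linear_diff[OF linear_A_left]
  linear_scale[OF linear_A_left] linear_neg[OF linear_A_left] linear_0[OF linear_A_left]

declare A_simps [simp]

lemma anticommute: "A w (A z x) + A z (A w x) = (2 * (w \<bullet> z)) *\<^sub>R x"
  using A_A[of "w + z" x] A_A[of w x] A_A[of z x]
  by (simp add: algebra_simps inner_commute scaleR_2[symmetric] del: scaleR_2)

lemma anticommute_orthogonal: "z \<bullet> w = 0 \<Longrightarrow> A w (A z x) = - A z (A w x)"
  using anticommute[of w z x] by (simp add: inner_commute eq_neg_iff_add_eq_0)

lemma A_inner_A: "A w x \<bullet> A z x = (w \<bullet> z) * (x \<bullet> x)"
proof -
  have "2 * (A w x \<bullet> A z x) = A w x \<bullet> A z x + A z x \<bullet> A w x" by (simp add: inner_commute)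
  also have "\<dots> = x \<bullet> (A w (A z x) + A z (A w x))" by (simp add: A_sym inner_add_right)
  finally show ?thesis by (simp add: anticommute)
qed

lemma norm_A: "norm (A w x) = norm w * norm x"
  by (simp add: norm_eq_sqrt_inner A_inner_A real_sqrt_mult)

lemma A_eq_0_iff: "A w x = 0 \<longleftrightarrow> w = 0 \<or> x = 0"
  using norm_A[of w x] by (metis mult_eq_0_iff norm_eq_zero)

definition Q :: "'a \<Rightarrow> 'a \<Rightarrow> 'b" where "Q x y = (\<Sum>b\<in>Basis. (A b x \<bullet> y) *\<^sub>R b)"

lemma inner_Q: "w \<bullet> Q x y = A w x \<bullet> y"
proof -
  have "w \<bullet> Q x y = (\<Sum>b\<in>Basis. (w \<bullet> b) *\<^sub>R A b x) \<bullet> y"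
    by (simp add: Q_def inner_sum_left inner_sum_right mult.commute)
  also have "(\<Sum>b\<in>Basis. (w \<bullet> b) *\<^sub>R A b x) = A (\<Sum>b\<in>Basis. (w \<bullet> b) *\<^sub>R b) x"
    by (simp add: linear_sum[OF linear_A_left] del: euclidean_representation)
  finally show ?thesis by (simp add: euclidean_representation)
qed

lemma Q_inner: "Q x y \<bullet> w = A w x \<bullet> y"
  by (simp add: inner_Q inner_commute[of "Q x y"])

lemma Q_eqI: "(\<And>w. A w x \<bullet> y = w \<bullet> c) \<Longrightarrow> Q x y = c"
  by (rule vector_eq_ldot[THEN iffD1]) (simp add: inner_Q)

lemma Q_commute: "Q x y = Q y x"
  by (rule Q_eqI) (simp add: inner_Q A_sym[of _ x] inner_commute[of x])

lemma bilinear_Q: "bilinear Q"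
  by (auto simp: bilinear_def intro!: linearI Q_eqI simp: inner_Q inner_add_left inner_add_right)

definition q :: "'a \<Rightarrow> 'b" where "q x = Q x x"

lemma inner_q: "w \<bullet> q x = A w x \<bullet> x" and q_inner: "q x \<bullet> w = A w x \<bullet> x"
  by (simp_all add: q_def inner_Q Q_inner)

lemma q_eqI: "(\<And>w. A w x \<bullet> x = w \<bullet> c) \<Longrightarrow> q x = c"
  unfolding q_def by (rule Q_eqI)

lemma q_scaleR: "q (c *\<^sub>R x) = c\<^sup>2 *\<^sub>R q x"
  by (rule q_eqI) (simp add: inner_q power2_eq_square)

lemma bounded_bilinear_A: "bounded_bilinear A" and bounded_bilinear_Q: "bounded_bilinear Q"
  using bilinear_A bilinear_Q by (auto simp: bilinear_conv_bounded_bilinear)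

lemma q_has_derivative: "(q has_derivative (\<lambda>v. 2 *\<^sub>R Q x v)) (at x within S)"
proof -
  have "((\<lambda>x. Q x x) has_derivative (\<lambda>v. Q x v + Q v x)) (at x within S)"
    by (rule bounded_bilinear.FDERIV[OF bounded_bilinear_Q]) (auto intro: derivative_intros)
  then show ?thesis by (simp add: q_def[abs_def] Q_commute[of _ x] scaleR_2)
qed

lemma q_eigenvector: "A w x = x \<Longrightarrow> q x = (x \<bullet> x) *\<^sub>R w"
  using A_inner_A[of _ x w] by (intro q_eqI) simp

lemma A_inner_opposite:
  assumes "A w x = x" "A w y = - y"
  shows "x \<bullet> y = 0"
  using A_sym[of w x y] assms by simp

end

text \<open>In the application \<open>A w\<close> is \<open>\<Sum>\<^sub>\<alpha> w\<^sub>\<alpha> P\<^sub>\<alpha>\<close> and \<open>J = P\<^sub>0 \<cdots> P\<^sub>8\<close>. The twisted system is the pair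
  \<open>(\<lambda>w. A w \<circ> J, J)\<close>, which is again of this kind, so the indefinite and the definite case are
  treated together up to Condition A.\<close>

locale clifford_pair = clifford_action A for A :: "'b::euclidean_space \<Rightarrow> 'a::euclidean_space \<Rightarrow> 'a" +
  fixes J :: "'a \<Rightarrow> 'a" and k :: nat
  assumes linear_J: "linear J"
    and J_J [simp]: "J (J x) = x"
    and J_sym: "J x \<bullet> y = x \<bullet> J y"
    and J_A: "J (A w x) = A w (J x)"
    and DIM_a: "DIM('a) = 4 * k"
    and DIM_b: "DIM('b) = Suc k"
    and k_pos: "0 < k"
    and J_not_id: "\<exists>x. J x \<noteq> x"
    and J_not_uminus: "\<exists>x. J x \<noteq> - x"
begin

lemmas J_simps = linear_add[OF linear_J] linear_diff[OF linear_J] linear_scale[OF linear_J]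
  linear_neg[OF linear_J] linear_0[OF linear_J]

declare J_simps [simp]

lemma J_inner_J: "J x \<bullet> J y = x \<bullet> y"
  by (simp add: J_sym)

lemma J_A_inner: "J (A w x) \<bullet> A z x = (w \<bullet> z) * (J x \<bullet> x)"
proof -
  have "2 * (J (A w x) \<bullet> A z x) = J (A w x) \<bullet> A z x + J (A z x) \<bullet> A w x"
    by (simp add: J_sym[of "A w x"] inner_commute[of "A w x"])
  also have "\<dots> = J x \<bullet> (A w (A z x) + A z (A w x))"
    by (simp add: A_sym J_A inner_add_right)
  finally show ?thesis by (simp add: anticommute)
qed

definition F :: "'b \<Rightarrow> 'a set" where "F w = {x. A w x = x}"

definition V :: "'b \<Rightarrow> real \<Rightarrow> 'a set" where "V w t = {x. A w x = x \<and> J x = t *\<^sub>R x}"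

definition W :: "'b \<Rightarrow> 'b set" where "W w = {z. z \<bullet> w = 0}"

lemma subspace_F: "subspace (F w)" and subspace_V: "subspace (V w t)" and subspace_W: "subspace (W w)"
  by (auto simp: subspace_def F_def V_def W_def algebra_simps inner_add_left)

lemma dim_W: "norm w = 1 \<Longrightarrow> dim (W w) = k"
  using dim_orthogonal_to_vector[of UNIV w] by (cases "w = 0") (auto simp: W_def DIM_b)

lemma dim_A_image: "x \<noteq> 0 \<Longrightarrow> subspace S \<Longrightarrow> dim ((\<lambda>z. A z x) ` S) = dim S"
  by (rule dim_image_eq[OF linear_A_left])
    (simp add: linear_injective_on_subspace_0[OF linear_A_left] A_eq_0_iff)

lemma A_image_subset: "x \<in> V w t \<Longrightarrow> (\<lambda>z. A z x) ` W w \<subseteq> V (- w) t"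
  by (auto simp: V_def W_def J_A anticommute_orthogonal)

lemma V_ne_0_uminus:
  assumes "norm w = 1" "x \<in> V w t" "x \<noteq> 0"
  shows "\<exists>y\<in>V (- w) t. y \<noteq> 0"
proof -
  have "dim (W w) \<noteq> 0" using dim_W[of w] assms(1) k_pos by auto
  then obtain z where "z \<in> W w" "z \<noteq> 0" using dim_eq_0[of "W w"] by auto
  then show ?thesis using A_image_subset[OF assms(2)] A_eq_0_iff[of z x] assms(3) by auto
qed

lemma V_ne_0:
  assumes "norm w = 1" "t = 1 \<or> t = -1"
  shows "\<exists>y\<in>V w t. y \<noteq> 0"
proof -
  have ww: "w \<bullet> w = 1" using assms(1) by (simp add: norm_eq_1)
  obtain x0 where x0: "x0 + t *\<^sub>R J x0 \<noteq> 0"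
    using assms(2) J_not_id J_not_uminus by (metis add.commute add_eq_0_iff2 eq_neg_iff_add_eq_0 minus_equation_iff scaleR_minus1_left scaleR_one)
  define y where "y = x0 + t *\<^sub>R J x0"
  have y: "J y = t *\<^sub>R y" "y \<noteq> 0" using assms(2) x0 by (auto simp: y_def algebra_simps)
  have 1: "y + A w y \<in> V w t" "y - A w y \<in> V (- w) t"
    using y ww by (auto simp: V_def J_A A_A algebra_simps)
  show ?thesis
  proof (cases "y + A w y = 0")
    case False
    then show ?thesis using 1 by blast
  next
    case True
    have "y - A w y \<noteq> 0"
    proof
      assume "y - A w y = 0"
      then have "y + y = 0" using True by (metis eq_iff_diff_eq_0)
      then show False using y(2) by (metis scaleR_2 scaleR_eq_0_iff zero_neq_numeral)
    qed
    then show ?thesis using V_ne_0_uminus[of "- w" "y - A w y" t] assms(1) 1 by auto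
  qed
qed

lemma dim_V_ge:
  assumes "norm w = 1" "t = 1 \<or> t = -1"
  shows "k \<le> dim (V w t)"
proof -
  obtain y where y: "y \<in> V (- w) t" "y \<noteq> 0" using V_ne_0[of "- w" t] assms by auto
  have "dim ((\<lambda>z. A z y) ` W (- w)) \<le> dim (V w t)"
    using A_image_subset[OF y(1)] by (intro dim_subset) auto
  then show ?thesis using dim_A_image[OF y(2) subspace_W[of "- w"]] dim_W[of "- w"] assms(1) by auto
qed

lemma V_orthogonal_uminus:
  assumes "x \<in> V w s" "y \<in> V (- w) t"
  shows "x \<bullet> y = 0"
proof (rule A_inner_opposite)
  show "A w x = x" using assms(1) by (simp add: V_def)
  have "- A w y = y" using assms(2) by (simp add: V_def)
  then show "A w y = - y" by (metis minus_minus)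
qed

lemma V_orthogonal_J:
  "x \<in> V w 1 \<Longrightarrow> y \<in> V w' (-1) \<Longrightarrow> x \<bullet> y = 0"
  using J_sym[of x y] by (auto simp: V_def)

text \<open>Each of the four spaces \<open>V (\<plusminus>w) (\<plusminus>1)\<close> has dimension at least \<open>k\<close>, and they are orthogonal in a
  space of dimension \<open>4k\<close>.\<close>

lemma dim_V:
  assumes "norm w = 1" "t = 1 \<or> t = -1"
  shows "dim (V w t) = k"
proof -
  define S where "S t = {x + y |x y. x \<in> V w t \<and> y \<in> V (- w) t}" for t
  have dS: "dim (S t) = dim (V w t) + dim (V (- w) t)" for t
    unfolding S_def by (intro dim_orthogonal_sums subspace_V V_orthogonal_uminus)
  have "dim {x + y |x y. x \<in> S 1 \<and> y \<in> S (-1)} = dim (S 1) + dim (S (-1))"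
  proof (rule dim_orthogonal_sums)
    show "subspace (S 1)" "subspace (S (-1))" unfolding S_def by (intro subspace_sums subspace_V)+
    show "x \<bullet> y = 0" if "x \<in> S 1" "y \<in> S (-1)" for x y
      using that by (auto simp: S_def inner_add_left inner_add_right V_orthogonal_J)
  qed
  then have "dim (V w 1) + dim (V (- w) 1) + (dim (V w (-1)) + dim (V (- w) (-1))) \<le> 4 * k"
    using dim_subset_UNIV[of "{x + y |x y. x \<in> S 1 \<and> y \<in> S (-1)}"] dS DIM_a by simp
  then show ?thesis
    using dim_V_ge[of w 1] dim_V_ge[of w "-1"] dim_V_ge[of "- w" 1] dim_V_ge[of "- w" "-1"] assms by auto
qed

lemma V_uminus_eq_A_image:
  assumes "norm w = 1" "t = 1 \<or> t = -1" "x \<in> V w t" "x \<noteq> 0"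
  shows "V (- w) t = (\<lambda>z. A z x) ` W w"
  using assms A_image_subset[OF assms(3)] dim_V[of "- w" t] dim_A_image[OF assms(4) subspace_W[of w]] dim_W[of w]
  by (intro subspace_dim_equal[symmetric] linear_subspace_image linear_A_left subspace_W subspace_V) auto

lemma F_eq: "F w = {x + y |x y. x \<in> V w 1 \<and> y \<in> V w (-1)}"
proof
  show "F w \<subseteq> {x + y |x y. x \<in> V w 1 \<and> y \<in> V w (-1)}"
  proof
    fix x assume "x \<in> F w"
    then have "(1/2) *\<^sub>R (x + J x) \<in> V w 1" "(1/2) *\<^sub>R (x - J x) \<in> V w (-1)"
      by (auto simp: F_def V_def algebra_simps simp flip: J_A)
    moreover have "x = (1/2) *\<^sub>R (x + J x) + (1/2) *\<^sub>R (x - J x)"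
      by (simp add: algebra_simps flip: scaleR_left_distrib)
    ultimately show "x \<in> {x + y |x y. x \<in> V w 1 \<and> y \<in> V w (-1)}" by blast
  qed
qed (auto simp: F_def V_def)

lemma dim_F: "norm w = 1 \<Longrightarrow> dim (F w) = 2 * k"
  unfolding F_eq by (subst dim_orthogonal_sums) (auto simp: subspace_V dim_V V_orthogonal_J)

end

section \<open>The sphere bundle structure of the focal submanifold\<close>

context clifford_pair begin

lemma q_graph:
  assumes "A w p = p" "z \<bullet> w = 0"
  shows "q (p + A z p) = (p \<bullet> p) *\<^sub>R ((1 - z \<bullet> z) *\<^sub>R w + 2 *\<^sub>R z)"
proof (rule q_eqI)
  fix y
  have "A (- w) (A z p) = A z p" using assms by (simp add: anticommute_orthogonal)
  from q_eigenvector[OF this] have "A y (A z p) \<bullet> A z p = - (z \<bullet> z) * (p \<bullet> p) * (y \<bullet> w)"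
    by (simp add: A_inner_A flip: inner_q)
  moreover have "A y p \<bullet> p = (p \<bullet> p) * (y \<bullet> w)"
    using q_eigenvector[OF assms(1)] by (simp flip: inner_q)
  moreover have "A y (A z p) \<bullet> p = (p \<bullet> p) * (y \<bullet> z)"
    using A_inner_A[of z p y] by (simp add: A_sym[of y "A z p"] inner_commute[of z])
  ultimately show "A y (p + A z p) \<bullet> (p + A z p) = y \<bullet> ((p \<bullet> p) *\<^sub>R ((1 - z \<bullet> z) *\<^sub>R w + 2 *\<^sub>R z))"
    by (simp add: inner_add_left inner_add_right A_inner_A algebra_simps)
qed

lemma norm_graph_direction:
  assumes "norm w = 1" "z \<bullet> w = 0"
  shows "norm ((1 - z \<bullet> z) *\<^sub>R w + 2 *\<^sub>R z) = 1 + z \<bullet> z"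
proof -
  have "w \<bullet> w = 1" "w \<bullet> z = 0" using assms by (simp_all add: norm_eq_1 inner_commute)
  then have "(norm ((1 - z \<bullet> z) *\<^sub>R w + 2 *\<^sub>R z))\<^sup>2 = (1 + z \<bullet> z)\<^sup>2"
    using assms(2) by (simp add: power2_norm_eq_inner inner_add_left inner_add_right)
      (simp add: power2_eq_square algebra_simps)
  then show ?thesis by simp
qed

lemma inner_A_F: "A w p = p \<Longrightarrow> A w p' = p' \<Longrightarrow> z \<bullet> w = 0 \<Longrightarrow> A z p \<bullet> p' = 0"
  using A_inner_opposite[of w p' "A z p"] by (simp add: anticommute_orthogonal inner_commute)

text \<open>On the eigenspaces of \<open>J\<close> the map \<open>q\<close> is the Hopf map.\<close>

lemma norm_q_J:
  assumes "J x = t *\<^sub>R x" "t = 1 \<or> t = -1"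
  shows "norm (q x) = x \<bullet> x"
proof -
  obtain w :: 'b where w: "w \<in> Basis" using nonempty_Basis by blast
  then have ww: "w \<bullet> w = 1" and nw: "norm w = 1" by simp_all
  define x1 where "x1 = (1/2) *\<^sub>R (x + A w x)"
  define x2 where "x2 = (1/2) *\<^sub>R (x - A w x)"
  have x: "x = x1 + x2" by (simp add: x1_def x2_def algebra_simps flip: scaleR_left_distrib)
  have A: "A w x1 = x1" "A w x2 = - x2" by (simp_all add: x1_def x2_def A_A ww algebra_simps)
  have V: "x1 \<in> V w t" "x2 \<in> V (- w) t"
    using A assms(1) by (simp_all add: V_def x1_def x2_def J_A algebra_simps)
  show ?thesis
  proof (cases "x1 = 0")
    case True
    then have "A (- w) x = x" using x A by simp
    from q_eigenvector[OF this] show ?thesis by (simp add: nw)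
  next
    case False
    then obtain z where z: "z \<bullet> w = 0" "x2 = A z x1"
      using V(2) V_uminus_eq_A_image[OF nw assms(2) V(1)] by (auto simp: W_def)
    have "norm (q x) = (x1 \<bullet> x1) * (1 + z \<bullet> z)"
      unfolding x z(2) q_graph[OF A(1) z(1)] by (simp add: norm_graph_direction[OF nw z(1)])
    also have "\<dots> = x \<bullet> x"
      unfolding x z(2) using inner_A_F[OF A(1) A(1) z(1)]
      by (simp add: inner_add_left inner_add_right A_inner_A inner_commute algebra_simps)
    finally show ?thesis .
  qed
qed

definition N :: "'a set" where "N = {x. norm x = 1 \<and> norm (q x) = 1}"

lemma N_D:
  assumes "x \<in> N"
  shows "norm x = 1" "x \<bullet> x = 1" "norm (q x) = 1" "q x \<bullet> q x = 1" "A (q x) x = x"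
proof -
  show n: "norm x = 1" "x \<bullet> x = 1" "norm (q x) = 1" "q x \<bullet> q x = 1"
    using assms by (auto simp: N_def norm_eq_1)
  have "A (q x) x \<bullet> x = 1" using n inner_q[of "q x" x] by simp
  then have "(A (q x) x - x) \<bullet> (A (q x) x - x) = 0"
    using n by (simp add: inner_diff_left inner_diff_right A_inner_A inner_commute)
  then show "A (q x) x = x" by simp
qed

lemma N_I:
  assumes "x \<bullet> x = 1" "norm w = 1" "A w x = x"
  shows "x \<in> N" "q x = w"
  using q_eigenvector[OF assms(3)] assms by (auto simp: N_def norm_eq_1)

definition h :: "'a \<Rightarrow> real" where "h x = J x \<bullet> x"

lemma h_scaleR: "h (c *\<^sub>R x) = c\<^sup>2 * h x"
  by (simp add: h_def power2_eq_square)

lemma F_J: "A w x = x \<Longrightarrow> A w (J x) = J x"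
  by (simp flip: J_A)

lemma h_bound:
  assumes "x \<bullet> x = 1"
  shows "\<bar>h x\<bar> \<le> 1" "\<bar>h x\<bar> = 1 \<longleftrightarrow> J x = x \<or> J x = - x"
proof -
  have n: "norm x = 1" "norm (J x) = 1" using assms by (simp_all add: norm_eq_1 J_inner_J)
  show "\<bar>h x\<bar> \<le> 1" using Cauchy_Schwarz_ineq2[of "J x" x] n by (simp add: h_def)
  show "\<bar>h x\<bar> = 1 \<longleftrightarrow> J x = x \<or> J x = - x"
    using norm_cauchy_schwarz_abs_eq[of "J x" x] n by (simp add: h_def) (metis minus_minus)
qed

text \<open>For \<open>A w p = p\<close> and \<open>z\<close> orthogonal to \<open>w\<close> this is a point over the inverse stereographic
  projection of \<open>z\<close> from \<open>-w\<close>, see \<open>q_graph\<close>. It trivializes the sphere bundle \<open>q\<close> on \<open>M\<^sub>-\<close> away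
  from the fibre over \<open>-w\<close>.\<close>

definition bun :: "'b \<Rightarrow> 'a \<Rightarrow> 'a" where "bun z p = inverse (sqrt (1 + z \<bullet> z)) *\<^sub>R (p + A z p)"

lemma one_plus_inner_pos: "0 < 1 + (z::'c::real_inner) \<bullet> z"
  by (simp add: add_pos_nonneg)

lemma bun_facts:
  assumes w: "norm w = 1" and p: "A w p = p" "p \<bullet> p = 1" and z: "z \<bullet> w = 0"
  defines "y \<equiv> bun z p"
  shows "y \<in> N" "q y = inverse (1 + z \<bullet> z) *\<^sub>R ((1 - z \<bullet> z) *\<^sub>R w + 2 *\<^sub>R z)" "h y = h p"
    "1 + q y \<bullet> w = 2 / (1 + z \<bullet> z)"
    "inverse (1 + q y \<bullet> w) *\<^sub>R (q y - (q y \<bullet> w) *\<^sub>R w) = z"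
    "inverse (sqrt (2 * (1 + q y \<bullet> w))) *\<^sub>R (y + A w y) = p"
proof -
  define s where "s = 1 + z \<bullet> z"
  have s: "0 < s" "sqrt s * sqrt s = s" using one_plus_inner_pos[of z] by (simp_all add: s_def)
  have ww: "w \<bullet> w = 1" using w by (simp add: norm_eq_1)
  have y: "y = inverse (sqrt s) *\<^sub>R (p + A z p)" by (simp add: y_def bun_def s_def)
  note pz = inner_A_F[OF p(1) p(1) z]
  show qy: "q y = inverse (1 + z \<bullet> z) *\<^sub>R ((1 - z \<bullet> z) *\<^sub>R w + 2 *\<^sub>R z)"
    unfolding y using s by (simp add: q_scaleR q_graph[OF p(1) z] p(2) power_inverse s_def)
  have "y \<bullet> y = (inverse (sqrt s) * inverse (sqrt s)) * ((p + A z p) \<bullet> (p + A z p))"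
    unfolding y by simp
  also have "(p + A z p) \<bullet> (p + A z p) = s"
    using pz by (simp add: inner_add_left inner_add_right A_inner_A p(2) inner_commute s_def)
  finally have yy: "y \<bullet> y = 1" using s by (simp add: field_simps)
  have "norm (q y) = 1"
    unfolding qy using norm_graph_direction[OF w z] one_plus_inner_pos[of z] by simp
  then show "y \<in> N" using yy by (simp add: N_def norm_eq_1)
  have "J (A z p) \<bullet> p = 0" "J p \<bullet> A z p = 0"
    using inner_A_F[OF p(1) F_J[OF p(1)] z] inner_A_F[OF F_J[OF p(1)] p(1) z] by (simp_all add: J_A inner_commute)
  then have "h (p + A z p) = s * h p"
    by (simp add: inner_add_left inner_add_right J_A_inner h_def s_def algebra_simps)
  then show "h y = h p"
    using s unfolding y by (simp add: h_scaleR power_inverse)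
  have qw: "q y \<bullet> w = (2 - s) / s"
    unfolding qy by (simp add: inner_add_left ww z s_def divide_inverse mult.commute)
  then show e: "1 + q y \<bullet> w = 2 / (1 + z \<bullet> z)"
    using s by (simp add: s_def field_simps)
  have qz: "q y - (q y \<bullet> w) *\<^sub>R w = (2 / s) *\<^sub>R z"
    unfolding qw unfolding qy using s
    by (simp add: s_def scaleR_right_distrib algebra_simps divide_inverse_commute flip: scaleR_left_diff_distrib)
  show "inverse (1 + q y \<bullet> w) *\<^sub>R (q y - (q y \<bullet> w) *\<^sub>R w) = z"
    unfolding qz e s_def[symmetric] using s by simp
  have "y + A w y = (2 / sqrt s) *\<^sub>R p"
    unfolding y by (simp add: anticommute_orthogonal[OF z] p algebra_simps divide_inverse flip: scaleR_left_distrib)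
  moreover have "sqrt (2 * (1 + q y \<bullet> w)) = 2 / sqrt s"
    using s by (simp add: e s_def real_sqrt_divide)
  ultimately show "inverse (sqrt (2 * (1 + q y \<bullet> w))) *\<^sub>R (y + A w y) = p"
    using s by simp
qed

lemma bun_inverse:
  assumes w: "norm w = 1" and y: "y \<in> N" and s: "0 < 1 + q y \<bullet> w"
  defines "p \<equiv> inverse (sqrt (2 * (1 + q y \<bullet> w))) *\<^sub>R (y + A w y)"
    and "z \<equiv> inverse (1 + q y \<bullet> w) *\<^sub>R (q y - (q y \<bullet> w) *\<^sub>R w)"
  shows "A w p = p" "p \<bullet> p = 1" "z \<bullet> w = 0" "bun z p = y"
proof -
  define u where "u = q y"
  define c where "c = q y \<bullet> w"
  have ww: "w \<bullet> w = 1" using w by (simp add: norm_eq_1)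
  have u: "u \<bullet> u = 1" "A u y = y" "u \<bullet> w = c" "w \<bullet> u = c" using N_D[OF y] by (auto simp: u_def c_def inner_commute)
  have c: "0 < 1 + c" "sqrt (2 * (1 + c)) * sqrt (2 * (1 + c)) = 2 * (1 + c)" using s by (auto simp: c_def)
  have p: "p = inverse (sqrt (2 * (1 + c))) *\<^sub>R (y + A w y)" by (simp add: p_def c_def)
  have z: "z = inverse (1 + c) *\<^sub>R (u - c *\<^sub>R w)" by (simp add: z_def c_def u_def)
  show "A w p = p" by (simp add: p A_A ww algebra_simps)
  have yy: "y \<bullet> y = 1" "A w y \<bullet> y = c" using N_D[OF y] inner_q[of w y] by (auto simp: c_def inner_commute)
  have "p \<bullet> p = inverse (sqrt (2 * (1 + c)) * sqrt (2 * (1 + c))) * ((y + A w y) \<bullet> (y + A w y))"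
    unfolding p by (simp only: inner_scaleR_left inner_scaleR_right inverse_mult_distrib mult.assoc)
  also have "(y + A w y) \<bullet> (y + A w y) = 2 * (1 + c)"
    using yy by (simp add: inner_add_left inner_add_right A_inner_A ww inner_commute)
  finally show "p \<bullet> p = 1" using c by simp
  show "z \<bullet> w = 0" by (simp add: z inner_diff_left ww u)
  have "(u - c *\<^sub>R w) \<bullet> (u - c *\<^sub>R w) = (1 - c) * (1 + c)"
    by (simp add: inner_diff_left inner_diff_right u ww algebra_simps)
  then have "z \<bullet> z = inverse (1 + c) * (inverse (1 + c) * ((1 - c) * (1 + c)))"
    by (simp only: z inner_scaleR_left inner_scaleR_right)
  then have "z \<bullet> z = (1 - c) / (1 + c)"
    using c(1) by (simp add: divide_inverse)
  then have "1 + z \<bullet> z = 2 / (1 + c)"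
    using c(1) by (simp add: field_simps)
  then have "(1 + z \<bullet> z) * (2 * (1 + c)) = 4" using c(1) by (simp add: field_simps)
  then have "sqrt (1 + z \<bullet> z) * sqrt (2 * (1 + c)) = 2"
    by (simp only: real_sqrt_mult[symmetric] real_sqrt_four)
  then have sz: "inverse (sqrt (1 + z \<bullet> z)) * inverse (sqrt (2 * (1 + c))) = 1 / 2"
    by (simp only: inverse_mult_distrib[symmetric]) simp
  have "A u (A w y) = c *\<^sub>R y + c *\<^sub>R y - A w y"
    using anticommute[of u w y] by (simp add: u algebra_simps flip: scaleR_2)
  then have Auc: "A (u - c *\<^sub>R w) (y + A w y) = (1 + c) *\<^sub>R (y - A w y)"
    by (simp only: A_simps u A_A ww scaleR_left_distrib scaleR_right_diff_distrib scaleR_right_distrib scaleR_one) simp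
  have "A z (y + A w y) = y - A w y"
    unfolding z linear_scale[OF linear_A_left] Auc using c(1) by simp
  then have "bun z p = (inverse (sqrt (1 + z \<bullet> z)) * inverse (sqrt (2 * (1 + c)))) *\<^sub>R ((y + A w y) + (y - A w y))"
    by (simp add: bun_def p scaleR_right_distrib[symmetric])
  then show "bun z p = y" unfolding sz by (simp flip: scaleR_2)
qed

lemma Q_eigenvectors:
  assumes "A w x = x" "A w y = y"
  shows "Q x y = (x \<bullet> y) *\<^sub>R w"
proof (rule Q_eqI)
  fix u
  have "A u x \<bullet> y + A u x \<bullet> A w y = (A u (A w x) + A w (A u x)) \<bullet> y"
    by (simp add: assms(1) inner_add_left A_sym)
  then show "A u x \<bullet> y = u \<bullet> ((x \<bullet> y) *\<^sub>R w)"
    by (simp add: anticommute assms(2))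
qed

lemma smooth_on_bilinear_A: "smooth_on S a \<Longrightarrow> smooth_on S b \<Longrightarrow> smooth_on S (\<lambda>x. A (a x) (b x))"
  by (rule smooth_on_bilinear[OF bounded_bilinear_A])

lemma smooth_on_bilinear_Q: "smooth_on S a \<Longrightarrow> smooth_on S b \<Longrightarrow> smooth_on S (\<lambda>x. Q (a x) (b x))"
  by (rule smooth_on_bilinear[OF bounded_bilinear_Q])

lemma smooth_on_q: "smooth_on S (\<lambda>x. q x)"
  unfolding q_def by (intro smooth_on_bilinear_Q smooth_on_id)

lemma smooth_on_J:
  fixes f :: "'c::euclidean_space \<Rightarrow> 'a"
  shows "smooth_on S f \<Longrightarrow> smooth_on S (\<lambda>x. J (f x))"
  by (rule smooth_on_linear_compose[OF linear_J])

lemmas smooth_intros = smooth_on_intros smooth_on_bilinear_A smooth_on_bilinear_Q smooth_on_q smooth_on_J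

lemma smooth_on_bun:
  fixes a :: "'c::euclidean_space \<Rightarrow> 'b"
  assumes "smooth_on S a" "smooth_on S b"
  shows "smooth_on S (\<lambda>x. bun (a x) (b x))"
  unfolding bun_def
  by (intro smooth_intros smooth_on_inverse smooth_on_sqrt assms)
    (simp_all add: one_plus_inner_pos)

lemma bundle_chart:
  assumes x0: "x0 \<in> M" and MN: "M \<subseteq> N" and w: "w = q x0"
    and sat: "\<And>p z. A w p = p \<Longrightarrow> p \<bullet> p = 1 \<Longrightarrow> z \<bullet> w = 0 \<Longrightarrow> bun z p \<in> M \<longleftrightarrow> p \<in> M"
    and L: "subspace L" "L \<subseteq> F w" and U0: "open U0" "x0 \<in> U0"
    and sf: "smooth_on L f" and sg: "smooth_on (M \<inter> F w \<inter> U0) g"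
    and f: "\<And>e. e \<in> L \<Longrightarrow> f e \<in> M \<inter> F w \<inter> U0" and g: "\<And>p. p \<in> M \<inter> F w \<inter> U0 \<Longrightarrow> g p \<in> L"
    and fg: "\<And>p. p \<in> M \<inter> F w \<inter> U0 \<Longrightarrow> f (g p) = p" and gf: "\<And>e. e \<in> L \<Longrightarrow> g (f e) = e"
    and dL: "dim L + k = n"
  shows "chart_at n M x0"
proof -
  have x0N: "x0 \<in> N" using x0 MN by auto
  have w1: "norm w = 1" "w \<bullet> w = 1" and Aw: "A w x0 = x0" and xx: "x0 \<bullet> x0 = 1" "x0 \<noteq> 0"
    using N_D[OF x0N] w by auto
  define E where "E = {e + r |e r. e \<in> L \<and> r \<in> (\<lambda>z. A z x0) ` W w}"
  define \<pi> where "\<pi> y = inverse (sqrt (2 * (1 + q y \<bullet> w))) *\<^sub>R (y + A w y)" for y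
  define \<zeta> where "\<zeta> y = inverse (1 + q y \<bullet> w) *\<^sub>R (q y - (q y \<bullet> w) *\<^sub>R w)" for y
  define Z where "Z p = Q x0 p - (Q x0 p \<bullet> w) *\<^sub>R w" for p
  define \<psi> where "\<psi> p = bun (Z p) (f ((1/2) *\<^sub>R (p + A w p)))" for p
  define \<phi> where "\<phi> y = g (\<pi> y) + A (\<zeta> y) x0" for y
  define O1 where "O1 = {y. 0 < 1 + q y \<bullet> w}"
  define U where "U = O1 \<inter> \<pi> -` U0"
  have sub2: "subspace ((\<lambda>z. A z x0) ` W w)" by (intro linear_subspace_image linear_A_left subspace_W)
  have E: "subspace E" unfolding E_def by (intro subspace_sums L sub2)
  have "dim E = dim L + dim ((\<lambda>z. A z x0) ` W w)"
    unfolding E_def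
  proof (rule dim_orthogonal_sums[OF L(1) sub2])
    show "s \<bullet> t = 0" if "s \<in> L" "t \<in> (\<lambda>z. A z x0) ` W w" for s t
      using that L inner_A_F[OF Aw, of s] by (auto simp: F_def W_def inner_commute)
  qed
  then have dE: "dim E = n" using dL dim_A_image[OF xx(2) subspace_W] dim_W[OF w1(1)] by simp
  have Einv: "Z (e + A z x0) = z" "(1/2) *\<^sub>R ((e + A z x0) + A w (e + A z x0)) = e"
    if "e \<in> L" "z \<in> W w" for e z
  proof -
    have e: "A w e = e" "z \<bullet> w = 0" using that L by (auto simp: F_def W_def)
    have "Q x0 (A z x0) = z"
      by (rule Q_eqI) (simp add: A_inner_A xx)
    then have "Q x0 (e + A z x0) = (x0 \<bullet> e) *\<^sub>R w + z"
      using Q_eigenvectors[OF Aw e(1)] bilinear_Q by (simp add: bilinear_radd)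
    then show "Z (e + A z x0) = z" by (simp add: Z_def inner_add_left e w1)
    show "(1/2) *\<^sub>R ((e + A z x0) + A w (e + A z x0)) = e"
      by (simp add: e Aw anticommute_orthogonal flip: scaleR_2)
  qed
  have s\<psi>: "smooth_on E \<psi>"
    unfolding \<psi>_def
  proof (rule smooth_on_bun)
    show "smooth_on E Z" unfolding Z_def by (intro smooth_intros)
    show "smooth_on E (\<lambda>p. f ((1/2) *\<^sub>R (p + A w p)))"
      by (rule smooth_on_compose[OF _ sf]) (use Einv(2) in \<open>auto simp: E_def intro!: smooth_intros\<close>)
  qed
  have O1: "open O1" unfolding O1_def
    by (intro open_Collect_less continuous_intros smooth_on_imp_continuous_on smooth_on_q)
  have s\<pi>: "smooth_on O1 \<pi>" unfolding \<pi>_def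
    by (intro smooth_intros smooth_on_inverse smooth_on_sqrt) (auto simp: O1_def)
  have s\<zeta>: "smooth_on O1 \<zeta>" unfolding \<zeta>_def
    by (intro smooth_intros smooth_on_inverse) (auto simp: O1_def)
  have oU: "open U" unfolding U_def
    by (intro continuous_open_preimage smooth_on_imp_continuous_on s\<pi> O1 U0)
  have "\<pi> x0 = x0"
    by (simp add: \<pi>_def Aw w1 flip: w scaleR_2)
  then have x0U: "x0 \<in> U" using U0 by (simp add: U_def O1_def w1 flip: w)
  have MU: "A w (\<pi> y) = \<pi> y" "\<pi> y \<in> M \<inter> F w \<inter> U0" "\<zeta> y \<in> W w" "bun (\<zeta> y) (\<pi> y) = y" if "y \<in> M \<inter> U" for y
  proof -
    have y: "y \<in> N" "0 < 1 + q y \<bullet> w" "\<pi> y \<in> U0" using that MN by (auto simp: U_def O1_def)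
    note * = bun_inverse[OF w1(1) y(1,2), folded \<pi>_def \<zeta>_def]
    show "A w (\<pi> y) = \<pi> y" "\<zeta> y \<in> W w" "bun (\<zeta> y) (\<pi> y) = y" using * by (auto simp: W_def)
    have "\<pi> y \<in> M" using sat[OF *(1-3)] *(4) that by simp
    then show "\<pi> y \<in> M \<inter> F w \<inter> U0" using y * by (simp add: F_def)
  qed
  have s\<phi>: "smooth_on (M \<inter> U) \<phi>"
    unfolding \<phi>_def
  proof (intro smooth_on_add smooth_on_bilinear_A smooth_on_const)
    show "smooth_on (M \<inter> U) (\<lambda>y. g (\<pi> y))"
      by (rule smooth_on_compose[OF smooth_on_subset[OF s\<pi>] sg]) (use MU in \<open>auto simp: U_def\<close>)
    show "smooth_on (M \<inter> U) \<zeta>" by (rule smooth_on_subset[OF s\<zeta>]) (auto simp: U_def)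
  qed
  have \<phi>E: "\<phi> ` (M \<inter> U) \<subseteq> E"
    using MU(2,3) g by (fastforce simp: E_def \<phi>_def)
  have \<psi>\<phi>: "\<psi> (\<phi> y) = y" if "y \<in> M \<inter> U" for y
    using MU[OF that] g[OF MU(2)[OF that]] fg Einv unfolding \<psi>_def \<phi>_def by simp
  have *: "\<psi> p \<in> M \<inter> U" "\<phi> (\<psi> p) = p" if "p \<in> E" for p
  proof -
    obtain e z where p: "p = e + A z x0" "e \<in> L" "z \<in> W w" using \<open>p \<in> E\<close> by (auto simp: E_def)
    have fe: "A w (f e) = f e" "f e \<in> M" "f e \<in> U0" using f[OF p(2)] by (auto simp: F_def)
    have fe1: "f e \<bullet> f e = 1" using fe(2) MN N_D(2) by auto
    have zw: "z \<bullet> w = 0" using p(3) by (simp add: W_def)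
    have \<psi>p: "\<psi> p = bun z (f e)" unfolding \<psi>_def p(1) using Einv[OF p(2,3)] by simp
    note b = bun_facts[OF w1(1) fe(1) fe1 zw, folded \<psi>p, folded \<pi>_def \<zeta>_def]
    have "0 < 1 + q (\<psi> p) \<bullet> w" unfolding b(4) using one_plus_inner_pos[of z] by simp
    moreover have "\<psi> p \<in> M" using sat[OF fe(1) fe1 zw] fe(2) \<psi>p by simp
    ultimately show "\<psi> p \<in> M \<inter> U" using b(6) fe(3) by (simp add: U_def O1_def)
    show "\<phi> (\<psi> p) = p" unfolding \<phi>_def b(5,6) gf[OF p(2)] by (rule p(1)[symmetric])
  qed
  show ?thesis
    unfolding chart_at_def
    by (rule exI[of _ U], rule exI[of _ E], rule exI[of _ \<phi>], rule exI[of _ \<psi>])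
      (use oU x0U E dE s\<phi> s\<psi> \<phi>E \<psi>\<phi> * in auto)
qed

lemma bundle_tangent:
  assumes MN: "M \<subseteq> N" and x0: "x0 \<in> M" and w: "w = q x0"
    and sat: "\<And>p z. A w p = p \<Longrightarrow> p \<bullet> p = 1 \<Longrightarrow> z \<bullet> w = 0 \<Longrightarrow> bun z p \<in> M \<longleftrightarrow> p \<in> M"
    and L: "subspace L"  and sf: "smooth_on L f"
    and f: "\<And>e. e \<in> L \<Longrightarrow> f e \<in> M \<inter> F w"
    and f0: "f 0 = x0" and e: "e \<in> L" and z: "z \<bullet> w = 0"
    and fd: "((\<lambda>t. f (t *\<^sub>R e)) has_vector_derivative e) (at 0)"
  shows "e + A z x0 \<in> tangent_space M x0"
proof (rule tangent_spaceI[of 1 "\<lambda>t. bun (t *\<^sub>R z) (f (t *\<^sub>R e))"])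
  have te: "t *\<^sub>R e \<in> L" for t using L e by (simp add: subspace_scale)
  show "smooth_on {-1<..<1::real} (\<lambda>t. bun (t *\<^sub>R z) (f (t *\<^sub>R e)))"
  proof (rule smooth_on_bun)
    show "smooth_on {-1<..<1::real} (\<lambda>t. f (t *\<^sub>R e))"
      by (rule smooth_on_compose[OF _ sf te]) (intro smooth_intros)
  qed (intro smooth_intros)
  show "(\<lambda>t. bun (t *\<^sub>R z) (f (t *\<^sub>R e))) ` {-1<..<1::real} \<subseteq> M"
  proof clarify
    fix t
    have "A w (f (t *\<^sub>R e)) = f (t *\<^sub>R e)" "f (t *\<^sub>R e) \<bullet> f (t *\<^sub>R e) = 1" "f (t *\<^sub>R e) \<in> M"
      using f[OF te] MN N_D(2) by (auto simp: F_def)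
    then show "bun (t *\<^sub>R z) (f (t *\<^sub>R e)) \<in> M" using sat[of "f (t *\<^sub>R e)" "t *\<^sub>R z"] z by simp
  qed
  show "bun (0 *\<^sub>R z) (f (0 *\<^sub>R e)) = x0" by (simp add: bun_def f0)
  have 1: "((\<lambda>t. inverse (sqrt (1 + t\<^sup>2 * (z \<bullet> z)))) has_real_derivative 0) (at 0)"
    by (auto intro!: derivative_eq_intros)
  have 2: "((\<lambda>t. A (t *\<^sub>R z) (f (t *\<^sub>R e))) has_vector_derivative A (0 *\<^sub>R z) e + A z (f (0 *\<^sub>R e))) (at 0)"
    by (rule bounded_bilinear.has_vector_derivative[OF bounded_bilinear_A _ fd])
      (auto intro!: derivative_eq_intros)
  show "((\<lambda>t. bun (t *\<^sub>R z) (f (t *\<^sub>R e))) has_vector_derivative e + A z x0) (at 0)"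
    using has_vector_derivative_scaleR[OF 1 has_vector_derivative_add[OF fd 2]]
    by (simp add: bun_def f0 power2_eq_square mult.assoc)
qed simp

end

section \<open>Charts and tangent spaces\<close>

text \<open>Central projection of the tangent hyperplane at \<open>u\<close> to the sphere through \<open>u\<close>, and its inverse.\<close>

definition central :: "'a::real_inner \<Rightarrow> 'a \<Rightarrow> 'a" where
  "central u e = (sqrt (u \<bullet> u) * inverse (sqrt (u \<bullet> u + e \<bullet> e))) *\<^sub>R (u + e)"

definition central_inv :: "'a::real_inner \<Rightarrow> 'a \<Rightarrow> 'a" where
  "central_inv u p = ((u \<bullet> u) * inverse (p \<bullet> u)) *\<^sub>R p - u"

lemma central_facts:
  fixes u e :: "'a::real_inner"
  assumes u: "u \<noteq> 0" and e: "e \<bullet> u = 0"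
  shows "central u e \<bullet> central u e = u \<bullet> u" "0 < central u e \<bullet> u" "central_inv u (central u e) = e"
proof -
  define r where "r = u \<bullet> u"
  define s where "s = sqrt r * inverse (sqrt (r + e \<bullet> e))"
  have r: "0 < r" using u by (simp add: r_def)
  then have re: "0 < r + e \<bullet> e" by (simp add: add_pos_nonneg)
  have s: "0 < s" using r re by (simp add: s_def)
  have "s = sqrt (r / (r + e \<bullet> e))" by (simp add: s_def divide_inverse real_sqrt_mult real_sqrt_inverse)
  then have "s * s = r / (r + e \<bullet> e)" using r re by simp
  then have ss: "s * s * (r + e \<bullet> e) = r" using re by simp
  have c: "central u e = s *\<^sub>R (u + e)" by (simp add: central_def r_def s_def)
  have "(u + e) \<bullet> (u + e) = r + e \<bullet> e" using e by (simp add: inner_add_left inner_add_right r_def inner_commute)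
  then show "central u e \<bullet> central u e = u \<bullet> u" using ss by (simp add: c r_def mult.assoc)
  have cu: "central u e \<bullet> u = s * r" by (simp add: c r_def inner_add_left e)
  then show "0 < central u e \<bullet> u" using s r by simp
  have 1: "r * inverse (s * r) * s = 1" using s r by (simp add: field_simps)
  show "central_inv u (central u e) = e"
    unfolding central_inv_def cu unfolding r_def[symmetric] c scaleR_scaleR 1 by simp
qed

lemma central_inv_facts:
  fixes u p :: "'a::real_inner"
  assumes p: "p \<bullet> p = u \<bullet> u" "0 < p \<bullet> u"
  shows "central_inv u p \<bullet> u = 0" "central u (central_inv u p) = p"
proof -
  define r where "r = u \<bullet> u"
  define d where "d = p \<bullet> u"
  have d: "0 < d" using p by (simp add: d_def)
  have "u \<noteq> 0" using p(2) by auto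
  then have r: "0 < r" by (simp add: r_def)
  have c: "central_inv u p = (r * inverse d) *\<^sub>R p - u" by (simp add: central_inv_def r_def d_def)
  show "central_inv u p \<bullet> u = 0" using d by (simp add: c inner_diff_left r_def d_def)
  have "central_inv u p \<bullet> central_inv u p = (r * inverse d) * (r * inverse d) * r - 2 * (r * inverse d) * d + r"
    unfolding c using p(1) by (simp add: inner_diff_left inner_diff_right r_def d_def inner_commute algebra_simps)
  also have "\<dots> = r * (r / d)\<^sup>2 - r" using d by (simp add: power2_eq_square field_simps)
  finally have "r + central_inv u p \<bullet> central_inv u p = r * (r / d)\<^sup>2" by simp
  then have "sqrt (r + central_inv u p \<bullet> central_inv u p) = sqrt r * (r / d)"
    using r d by (simp add: real_sqrt_mult)
  moreover have "u + central_inv u p = (r * inverse d) *\<^sub>R p" by (simp add: c)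
  moreover have "sqrt r * inverse (sqrt r * (r / d)) * (r * inverse d) = 1" using r d by (simp add: field_simps)
  ultimately show "central u (central_inv u p) = p"
    by (simp only: central_def scaleR_scaleR scaleR_one r_def[symmetric])
qed

lemma smooth_on_central:
  fixes u :: "'a::euclidean_space"
  assumes "u \<noteq> 0" "smooth_on S f"
  shows "smooth_on S (\<lambda>x. central u (f x))"
  unfolding central_def
  by (intro smooth_on_intros smooth_on_inverse smooth_on_sqrt assms)
    (use assms(1) in \<open>simp_all add: add_pos_nonneg\<close>)

lemma smooth_on_central_inv:
  fixes u :: "'a::euclidean_space"
  assumes "smooth_on S f" "\<And>x. x \<in> S \<Longrightarrow> 0 < f x \<bullet> u"
  shows "smooth_on S (\<lambda>x. central_inv u (f x))"
  unfolding central_inv_def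
  by (intro smooth_on_intros smooth_on_inverse assms)

lemma central_0: "u \<noteq> 0 \<Longrightarrow> central u 0 = u"
  by (simp add: central_def)

lemma central_has_vector_derivative:
  fixes u :: "'a::real_inner"
  assumes "u \<noteq> 0"
  shows "((\<lambda>t. central u (t *\<^sub>R e)) has_vector_derivative e) (at 0)"
proof -
  have 1: "((\<lambda>t. sqrt (u \<bullet> u) * inverse (sqrt (u \<bullet> u + t * t * (e \<bullet> e)))) has_real_derivative 0) (at 0)"
    using inner_gt_zero_iff[of u, THEN iffD2, OF assms]
    by (auto intro!: derivative_eq_intros simp del: inner_gt_zero_iff)
  have 2: "((\<lambda>t. u + t *\<^sub>R e) has_vector_derivative e) (at 0)"
    by (auto intro!: derivative_eq_intros)
  show ?thesis
    using has_vector_derivative_scaleR[OF 1 2] assms by (simp add: central_def mult.assoc)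
qed

context clifford_pair begin

lemma sat_N:
  assumes "norm w = 1" "A w p = p" "p \<bullet> p = 1" "z \<bullet> w = 0"
  shows "bun z p \<in> N \<longleftrightarrow> p \<in> N"
  using bun_facts(1)[OF assms] N_I(1)[OF assms(3,1,2)] by simp

lemma central_N:
  assumes x0: "x0 \<in> N" and w: "w = q x0" and e: "e \<in> F w" "e \<bullet> x0 = 0"
  shows "central x0 e \<in> N \<inter> F w" "0 < central x0 e \<bullet> x0"
proof -
  have x: "x0 \<noteq> 0" "x0 \<bullet> x0 = 1" "norm w = 1" "A w x0 = x0" using N_D[OF x0] w by auto
  note c = central_facts[OF x(1) e(2)]
  show "0 < central x0 e \<bullet> x0" by (rule c(2))
  have "A w (central x0 e) = central x0 e" using x e by (simp add: central_def F_def)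
  then show "central x0 e \<in> N \<inter> F w" using N_I(1)[of _ w] c(1) x by (simp add: F_def)
qed

lemma submanifold_N: "submanifold (3 * k - 1) N"
proof (rule submanifoldI)
  fix x0 assume x0: "x0 \<in> N"
  define w where "w = q x0"
  have x: "x0 \<noteq> 0" "x0 \<bullet> x0 = 1" "norm w = 1" "A w x0 = x0" using N_D[OF x0] w_def by auto
  define L where "L = {e \<in> F w. e \<bullet> x0 = 0}"
  show "chart_at (3 * k - 1) N x0"
  proof (rule bundle_chart[OF x0 subset_refl w_def, of L "{p. 0 < p \<bullet> x0}" "central x0" "central_inv x0"])
    show "subspace L" using subspace_F[of w] by (auto simp: L_def subspace_def inner_add_left)
    show "open {p. 0 < p \<bullet> x0}" by (intro open_Collect_less continuous_intros)
    show "smooth_on L (central x0)" using smooth_on_central[OF x(1) smooth_on_id] .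
    show "smooth_on (N \<inter> F w \<inter> {p. 0 < p \<bullet> x0}) (central_inv x0)"
      by (rule smooth_on_central_inv[OF smooth_on_id]) simp
    have "dim L = dim (F w) - 1"
      unfolding L_def by (rule dim_orthogonal_to_vector) (use x subspace_F[of w] in \<open>auto simp: F_def\<close>)
    then show "dim L + k = 3 * k - 1" using dim_F[OF x(3)] k_pos by simp
    fix p assume p: "p \<in> N \<inter> F w \<inter> {p. 0 < p \<bullet> x0}"
    then have pp: "p \<bullet> p = x0 \<bullet> x0" "0 < p \<bullet> x0" "A w p = p" using N_D(2) x by (auto simp: F_def)
    show "central_inv x0 p \<in> L"
      using central_inv_facts(1)[OF pp(1,2)] by (simp add: L_def) (simp add: F_def central_inv_def pp x)
    show "central x0 (central_inv x0 p) = p" using central_inv_facts(2)[OF pp(1,2)] .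
  qed (use x sat_N x0 central_N[OF x0 w_def] central_facts(3)[OF x(1)] in \<open>auto simp: L_def\<close>)
qed

definition TN :: "'a \<Rightarrow> 'a set" where
  "TN x = {e + A z x |e z. A (q x) e = e \<and> e \<bullet> x = 0 \<and> z \<bullet> q x = 0}"

lemma TN_I: "A (q x) e = e \<Longrightarrow> e \<bullet> x = 0 \<Longrightarrow> z \<bullet> q x = 0 \<Longrightarrow> e + A z x \<in> TN x"
  by (auto simp: TN_def)

lemma TN_E:
  assumes "v \<in> TN x"
  obtains e z where "v = e + A z x" "A (q x) e = e" "e \<bullet> x = 0" "z \<bullet> q x = 0"
  using assms by (auto simp: TN_def)

lemma A_q_has_derivative:
  "((\<lambda>y. A (q y) y) has_derivative (\<lambda>v. A (q x) v + A (2 *\<^sub>R Q x v) x)) (at x within S)"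
  by (rule bounded_bilinear.FDERIV[OF bounded_bilinear_A q_has_derivative]) (rule has_derivative_ident)

text \<open>Differentiating \<open>q y = Q y y\<close> along a curve with velocity \<open>v\<close> gives \<open>2 Q x v\<close>, so the
  horizontal part of a tangent vector \<open>v\<close> is \<open>A (Q x v) x\<close>.\<close>

lemma tangent_N_horizontal:
  assumes x: "x \<in> N" and v: "v \<in> tangent_space N x"
  shows "v \<bullet> x = 0" "Q x v \<bullet> q x = 0" "v - A (Q x v) x \<in> F (q x)" "(v - A (Q x v) x) \<bullet> x = 0"
proof -
  have 1: "((\<lambda>y. y \<bullet> y) has_derivative (\<lambda>v. x \<bullet> v + v \<bullet> x)) (at x)"
    by (auto intro!: derivative_eq_intros)
  have "x \<bullet> v + v \<bullet> x = 0" by (rule tangent_space_const[OF 1 _ v]) (rule N_D(2))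
  then show vx: "v \<bullet> x = 0" by (simp add: inner_commute)
  have 2: "((\<lambda>y. y - A (q y) y) has_derivative (\<lambda>v. v - (A (q x) v + A (2 *\<^sub>R Q x v) x))) (at x)"
    by (intro has_derivative_diff has_derivative_ident A_q_has_derivative)
  have "v - (A (q x) v + A (2 *\<^sub>R Q x v) x) = 0"
    by (rule tangent_space_const[OF 2 _ v, of 0]) (simp add: N_D(5))
  then have d: "A (q x) v = v - 2 *\<^sub>R A (Q x v) x" by (simp add: algebra_simps)
  note n = N_D[OF x]
  show Qq: "Q x v \<bullet> q x = 0" using n vx by (simp add: Q_inner inner_commute[of x v])
  have "A (q x) (A (Q x v) x) = - A (Q x v) x"
    using anticommute_orthogonal[OF Qq] n by simp
  then show "v - A (Q x v) x \<in> F (q x)" by (simp add: F_def d algebra_simps scaleR_2)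
  show "(v - A (Q x v) x) \<bullet> x = 0"
    using vx inner_A_F[OF n(5) n(5) Qq] by (simp add: inner_diff_left)
qed

lemma tangent_N:
  assumes x: "x \<in> N"
  shows "tangent_space N x = TN x"
proof
  show "tangent_space N x \<subseteq> TN x"
  proof
    fix v assume v: "v \<in> tangent_space N x"
    note h = tangent_N_horizontal[OF x v]
    have "(v - A (Q x v) x) + A (Q x v) x \<in> TN x" by (rule TN_I) (use h in \<open>auto simp: F_def\<close>)
    then show "v \<in> TN x" by simp
  qed
  note n = N_D[OF x]
  show "TN x \<subseteq> tangent_space N x"
  proof
    fix v assume "v \<in> TN x"
    then obtain e z where v: "v = e + A z x" "A (q x) e = e" "e \<bullet> x = 0" "z \<bullet> q x = 0" by (rule TN_E)
    have x0: "x \<noteq> 0" using n by auto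
    show "v \<in> tangent_space N x" unfolding v(1)
      by (rule bundle_tangent[OF subset_refl x refl, of "{e \<in> F (q x). e \<bullet> x = 0}" "central x"])
        (use x0 v n sat_N central_N[OF x refl] subspace_F[of "q x"] in \<open>auto simp: central_0 F_def subspace_def inner_add_left
          intro: smooth_on_central[OF _ smooth_on_id] central_has_vector_derivative\<close>)
  qed
qed

lemma subspace_TN: "subspace (TN x)"
proof -
  have "TN x = {e + r |e r. e \<in> {e \<in> F (q x). e \<bullet> x = 0} \<and> r \<in> (\<lambda>z. A z x) ` W (q x)}"
    by (auto simp: TN_def F_def W_def)
  moreover have "subspace {e \<in> F (q x). e \<bullet> x = 0}"
    using subspace_F[of "q x"] by (auto simp: subspace_def inner_add_left)
  ultimately show ?thesis
    by (simp only:) (intro subspace_sums linear_subspace_image linear_A_left subspace_W)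
qed

definition Mc :: "real \<Rightarrow> 'a set" where "Mc c = level_set N h c"

lemma Mc_iff: "x \<in> Mc c \<longleftrightarrow> x \<in> N \<and> h x = c"
  by (simp add: Mc_def level_set_def)

definition pp :: "'a \<Rightarrow> 'a" where "pp x = (1/2) *\<^sub>R (x + J x)"

definition pm :: "'a \<Rightarrow> 'a" where "pm x = (1/2) *\<^sub>R (x - J x)"

lemma pp_pm: "pp x + pm x = x" "pp x - pm x = J x"
  by (simp_all add: pp_def pm_def algebra_simps flip: scaleR_left_distrib)

lemma linear_pp: "linear pp" and linear_pm: "linear pm"
  by (auto intro!: linearI simp: pp_def pm_def algebra_simps)

lemma J_pp: "J (pp x) = pp x" and J_pm: "J (pm x) = - pm x"
  by (simp_all add: pp_def pm_def algebra_simps)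

lemma pp_inner_pm: "pp x \<bullet> pm y = 0"
  using J_sym[of "pp x" "pm y"] by (simp add: J_pp J_pm)

lemma pp_pm_eqI:
  assumes "J a = a" "J b = - b"
  shows "pp (a + b) = a" "pm (a + b) = b"
  using assms by (simp_all add: pp_def pm_def flip: scaleR_2)

lemma pp_inner_pp: "pp x \<bullet> pp x = (x \<bullet> x + h x) / 2" and pm_inner_pm: "pm x \<bullet> pm x = (x \<bullet> x - h x) / 2"
  by (simp_all add: pp_def pm_def inner_add_left inner_add_right inner_diff_left inner_diff_right J_inner_J h_def inner_commute)

lemma A_pp: "A w x = x \<Longrightarrow> A w (pp x) = pp x" and A_pm: "A w x = x \<Longrightarrow> A w (pm x) = pm x"
  by (simp_all add: pp_def pm_def flip: J_A)

lemma Mc_pp_pm: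
  assumes "x \<in> Mc c"
  shows "pp x \<bullet> pp x = (1 + c) / 2" "pm x \<bullet> pm x = (1 - c) / 2"
  using assms N_D(2) by (auto simp: Mc_iff pp_inner_pp pm_inner_pm)

lemma Mc_I:
  assumes "norm w = 1" "A w x = x" "pp x \<bullet> pp x = (1 + c) / 2" "pm x \<bullet> pm x = (1 - c) / 2"
  shows "x \<in> Mc c"
proof -
  have "x \<bullet> x = 1" "h x = c" using assms(3,4) by (auto simp: pp_inner_pp pm_inner_pm)
  then show ?thesis using N_I(1)[OF _ assms(1,2)] by (simp add: Mc_iff)
qed

lemma sat_Mc:
  assumes "norm w = 1" "A w p = p" "p \<bullet> p = 1" "z \<bullet> w = 0"
  shows "bun z p \<in> Mc c \<longleftrightarrow> p \<in> Mc c"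
  using sat_N[OF assms] bun_facts(3)[OF assms] by (simp add: Mc_iff)

lemma inner_pp_pp: "pp x \<bullet> pp y = x \<bullet> pp y" and inner_pm_pm: "pm x \<bullet> pm y = x \<bullet> pm y"
  using pp_inner_pm[of y x] pp_inner_pm[of x y] pp_pm(1)[of x]
  by (metis add.left_neutral add.right_neutral inner_add_left inner_commute)+

lemma inner_pp_eq_0:
  assumes "e \<bullet> x = 0" "e \<bullet> J x = 0"
  shows "e \<bullet> pp x = 0" "e \<bullet> pm x = 0"
  using assms by (simp_all add: pp_def pm_def inner_add_right inner_diff_right)

lemma TN_inner: "x \<in> N \<Longrightarrow> v \<in> TN x \<Longrightarrow> v \<bullet> x = 0"
  using inner_A_F[OF N_D(5) N_D(5)] by (auto elim!: TN_E simp: inner_add_left)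

context
  fixes c :: real
  assumes c: "-1 < c" "c < 1"
begin

lemma Mc_pp_pm_ne_0:
  assumes "x \<in> Mc c"
  shows "pp x \<noteq> 0" "pm x \<noteq> 0"
  using Mc_pp_pm[OF assms] c by auto

definition Lc :: "'a \<Rightarrow> 'a set" where "Lc x = {e \<in> F (q x). e \<bullet> x = 0 \<and> e \<bullet> J x = 0}"

definition chart_c :: "'a \<Rightarrow> 'a \<Rightarrow> 'a" where
  "chart_c x e = central (pp x) (pp e) + central (pm x) (pm e)"

lemma chart_c_facts:
  assumes x: "x \<in> Mc c" and e: "e \<in> Lc x"
  shows "pp (chart_c x e) = central (pp x) (pp e)" "pm (chart_c x e) = central (pm x) (pm e)"
    "chart_c x e \<in> Mc c \<inter> F (q x)" "0 < pp (chart_c x e) \<bullet> pp x" "0 < pm (chart_c x e) \<bullet> pm x"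
    "central_inv (pp x) (pp (chart_c x e)) + central_inv (pm x) (pm (chart_c x e)) = e"
proof -
  have xN: "x \<in> N" using x by (simp add: Mc_iff)
  note n = N_D[OF xN] and x0 = Mc_pp_pm_ne_0[OF x]
  have e': "A (q x) e = e" "pp e \<bullet> pp x = 0" "pm e \<bullet> pm x = 0"
    using e inner_pp_eq_0[of e x] by (auto simp: Lc_def F_def inner_pp_pp inner_pm_pm)
  have J: "J (central (pp x) (pp e)) = central (pp x) (pp e)" "J (central (pm x) (pm e)) = - central (pm x) (pm e)"
    by (simp_all add: central_def J_pp J_pm algebra_simps)
  show p: "pp (chart_c x e) = central (pp x) (pp e)" "pm (chart_c x e) = central (pm x) (pm e)"
    unfolding chart_c_def by (rule pp_pm_eqI[OF J])+
  note cp = central_facts[OF x0(1) e'(2)] and cm = central_facts[OF x0(2) e'(3)]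
  have "A (q x) (chart_c x e) = chart_c x e"
    using A_pp[OF e'(1)] A_pm[OF e'(1)] A_pp[OF n(5)] A_pm[OF n(5)] by (simp add: chart_c_def central_def)
  then show "chart_c x e \<in> Mc c \<inter> F (q x)"
    using Mc_I[OF n(3), of "chart_c x e" c] Mc_pp_pm[OF x] cp(1) cm(1) by (simp add: F_def p)
  show "0 < pp (chart_c x e) \<bullet> pp x" "0 < pm (chart_c x e) \<bullet> pm x"
    using cp(2) cm(2) by (simp_all add: p)
  show "central_inv (pp x) (pp (chart_c x e)) + central_inv (pm x) (pm (chart_c x e)) = e"
    unfolding p cp(3) cm(3) by (rule pp_pm)
qed

lemma subspace_Lc: "subspace (Lc x)"
  using subspace_F[of "q x"] by (auto simp: Lc_def subspace_def inner_add_left)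

lemma smooth_on_chart_c:
  assumes "x \<in> Mc c"
  shows "smooth_on S (chart_c x)"
  unfolding chart_c_def
  by (intro smooth_on_add smooth_on_central Mc_pp_pm_ne_0[OF assms] smooth_on_linear linear_pp linear_pm)

lemma submanifold_Mc: "submanifold (3 * k - 2) (Mc c)"
proof (rule submanifoldI)
  fix x0 assume x0: "x0 \<in> Mc c"
  then have x0N: "x0 \<in> N" "h x0 = c" by (auto simp: Mc_iff)
  define w where "w = q x0"
  have x: "x0 \<noteq> 0" "x0 \<bullet> x0 = 1" "norm w = 1" "A w x0 = x0" using N_D[OF x0N(1)] w_def by auto
  define U where "U = {p. 0 < pp p \<bullet> pp x0} \<inter> {p. 0 < pm p \<bullet> pm x0}"
  define g where "g p = central_inv (pp x0) (pp p) + central_inv (pm x0) (pm p)" for p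
  have lin: "continuous_on S pp" "continuous_on S pm" for S
    by (intro smooth_on_imp_continuous_on smooth_on_linear linear_pp linear_pm)+
  show "chart_at (3 * k - 2) (Mc c) x0"
  proof (rule bundle_chart[OF x0 _ w_def, of "Lc x0" U "chart_c x0" g])
    show "open U" unfolding U_def
      by (intro open_Int open_Collect_less continuous_intros lin)
    show "x0 \<in> U" using Mc_pp_pm_ne_0[OF x0] by (simp add: U_def)
    show "smooth_on (Mc c \<inter> F w \<inter> U) g"
      unfolding g_def
      by (intro smooth_on_add smooth_on_central_inv smooth_on_linear linear_pp linear_pm) (auto simp: U_def)
    have o: "(J x0 - c *\<^sub>R x0) \<bullet> x0 = 0" using x0N x by (simp add: inner_diff_left h_def)
    have "(J x0 - c *\<^sub>R x0) \<bullet> (J x0 - c *\<^sub>R x0) = 1 - c\<^sup>2"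
      using x0N x by (simp add: inner_diff_left inner_diff_right J_inner_J h_def inner_commute power2_eq_square)
    moreover have "c\<^sup>2 < 1" using c by (simp add: abs_square_less_1 abs_less_iff)
    ultimately have nz: "J x0 - c *\<^sub>R x0 \<noteq> 0" by auto
    have "dim {e \<in> F w. e \<bullet> x0 = 0} = dim (F w) - 1"
      by (rule dim_orthogonal_to_vector) (use x subspace_F[of w] in \<open>auto simp: F_def\<close>)
    moreover have "dim {e \<in> {e \<in> F w. e \<bullet> x0 = 0}. e \<bullet> (J x0 - c *\<^sub>R x0) = 0} = dim {e \<in> F w. e \<bullet> x0 = 0} - 1"
      by (rule dim_orthogonal_to_vector)
        (use x o nz subspace_F[of w] F_J[OF x(4)] in \<open>auto simp: F_def subspace_def inner_add_left\<close>)
    moreover have "{e \<in> {e \<in> F w. e \<bullet> x0 = 0}. e \<bullet> (J x0 - c *\<^sub>R x0) = 0} = Lc x0"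
      by (auto simp: Lc_def w_def inner_diff_right)
    ultimately show "dim (Lc x0) + k = 3 * k - 2" using dim_F[OF x(3)] k_pos by simp
    fix p assume p: "p \<in> Mc c \<inter> F w \<inter> U"
    then have p': "pp p \<bullet> pp p = pp x0 \<bullet> pp x0" "pm p \<bullet> pm p = pm x0 \<bullet> pm x0"
      "0 < pp p \<bullet> pp x0" "0 < pm p \<bullet> pm x0" "A w p = p" using Mc_pp_pm[of p c] Mc_pp_pm[OF x0] p by (auto simp: F_def U_def)
    note cp = central_inv_facts[OF p'(1,3)] and cm = central_inv_facts[OF p'(2,4)]
    have J: "J (central_inv (pp x0) (pp p)) = central_inv (pp x0) (pp p)"
      "J (central_inv (pm x0) (pm p)) = - central_inv (pm x0) (pm p)"
      by (simp_all add: central_inv_def J_pp J_pm algebra_simps)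
    have gp: "pp (g p) = central_inv (pp x0) (pp p)" "pm (g p) = central_inv (pm x0) (pm p)"
      unfolding g_def by (rule pp_pm_eqI[OF J])+
    show "chart_c x0 (g p) = p"
      unfolding chart_c_def gp cp(2) cm(2) by (rule pp_pm)
    have "A w (g p) = g p"
      using A_pp[OF p'(5)] A_pm[OF p'(5)] A_pp[OF x(4)] A_pm[OF x(4)] by (simp add: g_def central_inv_def)
    moreover have "g p \<bullet> pp x0 = 0" "g p \<bullet> pm x0 = 0"
      using cp(1) cm(1) by (simp_all add: gp[symmetric] inner_pp_pp inner_pm_pm)
    then have "g p \<bullet> (pp x0 + pm x0) = 0" "g p \<bullet> (pp x0 - pm x0) = 0"
      by (simp_all only: inner_add_right inner_diff_right)
    then have "g p \<bullet> x0 = 0" "g p \<bullet> J x0 = 0" unfolding pp_pm .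
    ultimately show "g p \<in> Lc x0" by (simp add: Lc_def F_def w_def)
  qed (use x sat_Mc x0 chart_c_facts[OF x0] subspace_Lc smooth_on_chart_c[OF x0] in \<open>auto simp: Lc_def Mc_iff g_def U_def w_def\<close>)
qed

lemma tangent_Mc:
  assumes x: "x \<in> Mc c"
  shows "tangent_space (Mc c) x = {v \<in> TN x. v \<bullet> J x = 0}"
proof
  have xN: "x \<in> N" "h x = c" using x by (auto simp: Mc_iff)
  note n = N_D[OF xN(1)]
  show "tangent_space (Mc c) x \<subseteq> {v \<in> TN x. v \<bullet> J x = 0}"
  proof
    fix v assume v: "v \<in> tangent_space (Mc c) x"
    have "Mc c \<subseteq> N" by (auto simp: Mc_iff)
    from tangent_space_mono[OF this v] have "v \<in> TN x" by (simp add: tangent_N[OF xN(1)])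
    moreover have d: "(h has_derivative (\<lambda>v. J x \<bullet> v + J v \<bullet> x)) (at x)"
      unfolding h_def[abs_def]
      by (intro has_derivative_inner has_derivative_ident linear_imp_has_derivative linear_J)
    have "J x \<bullet> v + J v \<bullet> x = 0" by (rule tangent_space_const[OF d _ v]) (simp add: Mc_iff)
    then have "v \<bullet> J x = 0" by (simp add: J_sym[of v x] inner_commute[of "J x" v])
    ultimately show "v \<in> {v \<in> TN x. v \<bullet> J x = 0}" by simp
  qed
  show "{v \<in> TN x. v \<bullet> J x = 0} \<subseteq> tangent_space (Mc c) x"
  proof
    fix v assume "v \<in> {v \<in> TN x. v \<bullet> J x = 0}"
    then obtain e z where v: "v = e + A z x" "A (q x) e = e" "e \<bullet> x = 0" "z \<bullet> q x = 0" "v \<bullet> J x = 0"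
      by (auto elim: TN_E)
    have "A z x \<bullet> J x = 0" using inner_A_F[OF n(5) F_J[OF n(5)] v(4)] .
    then have e: "e \<in> Lc x" using v by (simp add: Lc_def F_def inner_add_left)
    have d: "((\<lambda>t. chart_c x (t *\<^sub>R e)) has_vector_derivative e) (at 0)"
      using has_vector_derivative_add[OF central_has_vector_derivative[OF Mc_pp_pm_ne_0(1)[OF x], of "pp e"]
          central_has_vector_derivative[OF Mc_pp_pm_ne_0(2)[OF x], of "pm e"]]
      by (simp add: chart_c_def linear_scale[OF linear_pp] linear_scale[OF linear_pm] pp_pm)
    show "v \<in> tangent_space (Mc c) x" unfolding v(1)
    proof (rule bundle_tangent[OF _ x refl _ subspace_Lc smooth_on_chart_c[OF x] _ _ e v(4) d])
      show "chart_c x 0 = x"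
        using Mc_pp_pm_ne_0[OF x]
        by (simp add: chart_c_def linear_0[OF linear_pp] linear_0[OF linear_pm] central_0 pp_pm)
    qed (use sat_Mc n chart_c_facts(3)[OF x] in \<open>auto simp: Mc_iff\<close>)
  qed
qed

definition \<nu> :: "'a \<Rightarrow> 'a" where "\<nu> x = inverse (sqrt (1 - c\<^sup>2)) *\<^sub>R (J x - c *\<^sub>R x)"

lemma linear_\<nu>: "linear \<nu>"
  by (auto intro!: linearI simp: \<nu>_def algebra_simps)

lemma r_pos: "0 < 1 - c\<^sup>2" "0 < sqrt (1 - c\<^sup>2)"
  using c by (simp_all add: abs_square_less_1 abs_less_iff)

lemma \<nu>_facts:
  assumes x: "x \<in> Mc c"
  shows "norm (\<nu> x) = 1" "\<nu> x \<in> TN x" "\<nu> x \<bullet> x = 0"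
proof -
  have xN: "x \<in> N" "h x = c" using x by (auto simp: Mc_iff)
  note n = N_D[OF xN(1)]
  have "(J x - c *\<^sub>R x) \<bullet> (J x - c *\<^sub>R x) = 1 - c\<^sup>2"
    using xN n by (simp add: inner_diff_left inner_diff_right J_inner_J h_def inner_commute power2_eq_square)
  then have "norm (J x - c *\<^sub>R x) = sqrt (1 - c\<^sup>2)" by (simp add: norm_eq_sqrt_inner)
  then show "norm (\<nu> x) = 1" using r_pos by (simp add: \<nu>_def)
  show o: "\<nu> x \<bullet> x = 0" using xN n by (simp add: \<nu>_def inner_diff_left h_def)
  have "A (q x) (\<nu> x) = \<nu> x" using F_J[OF n(5)] n by (simp add: \<nu>_def)
  from TN_I[OF this o, of 0] show "\<nu> x \<in> TN x" by simp
qed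

lemma inner_\<nu>: "v \<bullet> x = 0 \<Longrightarrow> v \<bullet> \<nu> x = inverse (sqrt (1 - c\<^sup>2)) * (v \<bullet> J x)"
  by (simp add: \<nu>_def inner_diff_right)

lemma normal_Mc:
  assumes x: "x \<in> Mc c"
  shows "normal_space N (Mc c) x = range (\<lambda>s. s *\<^sub>R \<nu> x)"
proof
  have xN: "x \<in> N" "h x = c" using x by (auto simp: Mc_iff)
  note nu = \<nu>_facts[OF x]
  have T: "v \<bullet> \<nu> x = 0" if "v \<in> tangent_space (Mc c) x" for v
    using that inner_\<nu>[of v x] TN_inner[OF xN(1)] by (simp add: tangent_Mc[OF x])
  show "range (\<lambda>s. s *\<^sub>R \<nu> x) \<subseteq> normal_space N (Mc c) x"
    using nu T subspace_scale[OF subspace_TN] by (auto simp: normal_space_def tangent_N[OF xN(1)] inner_commute)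
  show "normal_space N (Mc c) x \<subseteq> range (\<lambda>s. s *\<^sub>R \<nu> x)"
  proof
    fix \<eta> assume "\<eta> \<in> normal_space N (Mc c) x"
    then have \<eta>: "\<eta> \<in> TN x" "\<And>v. v \<in> tangent_space (Mc c) x \<Longrightarrow> \<eta> \<bullet> v = 0"
      by (auto simp: normal_space_def tangent_N[OF xN(1)])
    define d where "d = \<eta> - (\<eta> \<bullet> \<nu> x) *\<^sub>R \<nu> x"
    have d: "d \<in> TN x" unfolding d_def by (intro subspace_diff subspace_scale subspace_TN \<eta> nu)
    have "d \<bullet> \<nu> x = 0" using nu(1) by (simp add: d_def inner_diff_left norm_eq_1)
    then have "d \<bullet> J x = 0" using inner_\<nu>[OF TN_inner[OF xN(1) d]] r_pos(2) by simp
    then have "d \<in> tangent_space (Mc c) x" using d by (simp add: tangent_Mc[OF x])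
    then have "\<eta> \<bullet> d = 0" "d \<bullet> \<nu> x = 0" using \<eta> T by auto
    then have "d \<bullet> d = 0" by (simp add: d_def inner_diff_left inner_commute)
    then have "\<eta> = (\<eta> \<bullet> \<nu> x) *\<^sub>R \<nu> x" by (simp add: d_def)
    then show "\<eta> \<in> range (\<lambda>s. s *\<^sub>R \<nu> x)" by blast
  qed
qed

lemma shape_Mc:
  assumes x: "x \<in> Mc c" and e: "A (q x) e = e" "e \<bullet> x = 0" "e \<bullet> J x = 0" and z: "z \<bullet> q x = 0"
  shows "shape_op N (Mc c) x (s *\<^sub>R \<nu> x) (e + A z x) = - (s * inverse (sqrt (1 - c\<^sup>2))) *\<^sub>R (J e - c *\<^sub>R e)"
proof -
  have xN: "x \<in> N" "h x = c" using x by (auto simp: Mc_iff)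
  note nu = \<nu>_facts[OF x] and n = N_D[OF xN(1)]
  have T: "e + A z x \<in> tangent_space (Mc c) x"
    using TN_I[OF e(1,2) z] inner_A_F[OF n(5) F_J[OF n(5)] z] e by (simp add: tangent_Mc[OF x] inner_add_left)
  have D\<nu>: "(\<nu> has_derivative \<nu>) (at x within Mc c)"
    by (intro linear_imp_has_derivative linear_\<nu>)
  define D where "D v = (s *\<^sub>R \<nu> x \<bullet> \<nu> x) *\<^sub>R \<nu> v + (s *\<^sub>R \<nu> x \<bullet> \<nu> v) *\<^sub>R \<nu> x" for v
  have "shape_op N (Mc c) x (s *\<^sub>R \<nu> x) (e + A z x) = - tangent_proj (Mc c) x (D (e + A z x))"
  proof (rule shape_op_eq[OF x, where Z = "\<lambda>y \<xi>. (\<xi> \<bullet> \<nu> y) *\<^sub>R \<nu> y"])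
    show "linear (\<lambda>\<xi>. (\<xi> \<bullet> \<nu> y) *\<^sub>R \<nu> y)" for y
      by (auto intro!: linearI simp: inner_add_left scaleR_add_left)
    show "(\<xi> \<bullet> \<nu> y) *\<^sub>R \<nu> y \<in> normal_space N (Mc c) y" if "y \<in> Mc c" for y \<xi>
      unfolding normal_Mc[OF that] by (rule rangeI)
    show "(\<xi> \<bullet> \<nu> y) *\<^sub>R \<nu> y = \<xi>" if "y \<in> Mc c" "\<xi> \<in> normal_space N (Mc c) y" for y \<xi>
      using that \<nu>_facts(1)[OF that(1)] by (auto simp: normal_Mc norm_eq_1)
    show "smooth_on (Mc c) (\<lambda>y. (\<xi> \<bullet> \<nu> y) *\<^sub>R \<nu> y)" for \<xi>
      by (intro smooth_on_intros smooth_on_linear linear_\<nu>)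
    show "s *\<^sub>R \<nu> x \<in> normal_space N (Mc c) x" unfolding normal_Mc[OF x] by (rule rangeI)
    show "((\<lambda>y. (s *\<^sub>R \<nu> x \<bullet> \<nu> y) *\<^sub>R \<nu> y) has_derivative D) (at x within Mc c)"
      unfolding D_def by (intro has_derivative_scaleR has_derivative_inner_right D\<nu>)
  qed (rule T)
  moreover have "tangent_proj (Mc c) x (D (e + A z x)) = (s * inverse (sqrt (1 - c\<^sup>2))) *\<^sub>R (J e - c *\<^sub>R e)"
    (is "_ = ?u")
  proof (rule tangent_proj_eq)
    show "subspace (tangent_space (Mc c) x)"
      using subspace_TN[of x] by (auto simp: tangent_Mc[OF x] subspace_def inner_add_left)
    have "A (q x) ?u = ?u" "?u \<bullet> x = 0" "?u \<bullet> J x = 0"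
      using e F_J[OF e(1)] by (simp_all add: inner_diff_left J_sym[of e x] J_inner_J)
    moreover from TN_I[OF this(1,2), of 0] have "?u \<in> TN x" by simp
    ultimately show "?u \<in> tangent_space (Mc c) x" by (simp add: tangent_Mc[OF x])
    fix v assume v: "v \<in> tangent_space (Mc c) x"
    then obtain e' z' where v': "v = e' + A z' x" "A (q x) e' = e'" "e' \<bullet> x = 0" "z' \<bullet> q x = 0" and vJ: "v \<bullet> J x = 0"
      by (auto simp: tangent_Mc[OF x] elim: TN_E)
    have "\<nu> x \<bullet> v = 0" using inner_\<nu>[OF TN_inner[OF xN(1)], of v] v by (simp add: tangent_Mc[OF x] inner_commute)
    moreover have "(J (A z x) - c *\<^sub>R A z x) \<bullet> v = 0"
    proof -
      have "J (A z x) \<bullet> e' = 0" "A z x \<bullet> e' = 0"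
        using inner_A_F[OF F_J[OF n(5)] v'(2) z] inner_A_F[OF n(5) v'(2) z] by (simp_all add: J_A)
      moreover have "J (A z x) \<bullet> A z' x = c * (z \<bullet> z')" "A z x \<bullet> A z' x = z \<bullet> z'"
        using xN n by (simp_all add: J_A_inner A_inner_A h_def)
      ultimately show ?thesis by (simp add: v'(1) inner_diff_left inner_add_right)
    qed
    then have "(\<nu> (A z x)) \<bullet> v = 0" by (simp add: \<nu>_def)
    ultimately show "(D (e + A z x) - ?u) \<bullet> v = 0"
      using nu(1) by (simp add: D_def norm_eq_1 linear_add[OF linear_\<nu>] inner_diff_left inner_add_left)
        (simp add: \<nu>_def inner_diff_left)
  qed
  ultimately show ?thesis by simp
qed

end

end

section \<open>Principal curvatures of the level sets\<close>

lemma tangent_proj_inner: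
  assumes "subspace (tangent_space M x)" "v \<in> tangent_space M x"
  shows "tangent_proj M x w \<bullet> v = w \<bullet> v"
proof -
  have sp: "span (tangent_space M x) = tangent_space M x" using assms(1) by (rule span_eq_iff[THEN iffD2])
  obtain y z where yz: "y \<in> tangent_space M x" "\<And>u. u \<in> tangent_space M x \<Longrightarrow> orthogonal z u" "w = y + z"
    using orthogonal_subspace_decomp_exists[of "tangent_space M x" w] unfolding sp by blast
  have "tangent_proj M x w = y"
    by (rule tangent_proj_eq) (use assms(1) yz in \<open>auto simp: orthogonal_def\<close>)
  then show ?thesis
    using yz(2)[of v] assms by (simp add: yz(3) orthogonal_def inner_add_left)
qed

lemma orthogonal_sum_eq_0:
  fixes a b d :: "'a::real_inner"
  assumes "a \<bullet> b = 0" "a \<bullet> d = 0" "b \<bullet> d = 0"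
  shows "a + b + d = 0 \<longleftrightarrow> a = 0 \<and> b = 0 \<and> d = 0"
proof
  assume *: "a + b + d = 0"
  have "a \<bullet> (a + b + d) = a \<bullet> a" "b \<bullet> (a + b + d) = b \<bullet> b" "d \<bullet> (a + b + d) = d \<bullet> d"
    using assms by (simp_all add: inner_add_right inner_commute)
  then show "a = 0 \<and> b = 0 \<and> d = 0" unfolding * by simp
qed simp

context clifford_pair begin

lemma pp_eq_0_iff: "pp e = 0 \<longleftrightarrow> J e = - e" and pm_eq_0_iff: "pm e = 0 \<longleftrightarrow> J e = e"
  by (auto simp: pp_def pm_def eq_neg_iff_add_eq_0 add.commute)

lemma J_minus_scaleR: "J e - c *\<^sub>R e = (1 - c) *\<^sub>R pp e - (1 + c) *\<^sub>R pm e"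
proof -
  have "J e - c *\<^sub>R e = (pp e - pm e) - c *\<^sub>R (pp e + pm e)" by (simp only: pp_pm)
  then show ?thesis by (simp add: algebra_simps)
qed

context
  fixes c :: real
  assumes c: "-1 < c" "c < 1"
begin

lemma pc_mult_Mc:
  assumes x: "x \<in> Mc c" and s: "s \<noteq> 0"
  defines "\<alpha> \<equiv> - (s * inverse (sqrt (1 - c\<^sup>2))) * (1 - c)" and "\<beta> \<equiv> s * inverse (sqrt (1 - c\<^sup>2)) * (1 + c)"
  shows "pc_mult N (Mc c) x (s *\<^sub>R \<nu> c x) l = (if l = \<alpha> \<or> l = \<beta> then k - 1 else if l = 0 then k else 0)"
proof -
  have xN: "x \<in> N" "h x = c" using x by (auto simp: Mc_iff)
  note n = N_D[OF xN(1)] and x0 = Mc_pp_pm_ne_0[OF c x]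
  have "\<alpha> < 0 \<and> 0 < \<beta> \<or> \<beta> < 0 \<and> 0 < \<alpha>"
    using s r_pos[OF c] c by (auto simp: \<alpha>_def \<beta>_def mult_less_0_iff zero_less_mult_iff neq_iff)
  then have ne: "\<alpha> \<noteq> \<beta>" "\<alpha> \<noteq> 0" "\<beta> \<noteq> 0" by auto
  define w where "w = q x"
  have w: "norm w = 1" "A w x = x" using n by (auto simp: w_def)
  define R where "R = {v \<in> tangent_space (Mc c) x. shape_op N (Mc c) x (s *\<^sub>R \<nu> c x) v = l *\<^sub>R v}"
  have R: "v \<in> R \<longleftrightarrow> (\<exists>e z. v = e + A z x \<and> A w e = e \<and> e \<bullet> x = 0 \<and> e \<bullet> J x = 0 \<and> z \<bullet> w = 0 \<and>
      (l = \<alpha> \<or> pp e = 0) \<and> (l = \<beta> \<or> pm e = 0) \<and> (l = 0 \<or> z = 0))" (is "_ \<longleftrightarrow> ?rhs") for v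
  proof -
    have *: "shape_op N (Mc c) x (s *\<^sub>R \<nu> c x) (e + A z x) = l *\<^sub>R (e + A z x) \<longleftrightarrow>
        (l = \<alpha> \<or> pp e = 0) \<and> (l = \<beta> \<or> pm e = 0) \<and> (l = 0 \<or> z = 0)"
      if e: "A w e = e" "e \<bullet> x = 0" "e \<bullet> J x = 0" and z: "z \<bullet> w = 0" for e z
    proof -
      have "shape_op N (Mc c) x (s *\<^sub>R \<nu> c x) (e + A z x) = \<alpha> *\<^sub>R pp e + \<beta> *\<^sub>R pm e"
        using shape_Mc[OF c x e[unfolded w_def] z[unfolded w_def], of s]
        by (simp add: J_minus_scaleR \<alpha>_def \<beta>_def scaleR_right_diff_distrib)
      moreover have "l *\<^sub>R (e + A z x) = l *\<^sub>R pp e + l *\<^sub>R pm e + l *\<^sub>R A z x"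
        by (simp only: scaleR_right_distrib[symmetric] pp_pm)
      ultimately have "shape_op N (Mc c) x (s *\<^sub>R \<nu> c x) (e + A z x) = l *\<^sub>R (e + A z x) \<longleftrightarrow>
          (\<alpha> - l) *\<^sub>R pp e + (\<beta> - l) *\<^sub>R pm e + (- l) *\<^sub>R A z x = 0"
        by (simp add: scaleR_left_diff_distrib) (auto simp: algebra_simps)
      also have "\<dots> \<longleftrightarrow> (\<alpha> - l) *\<^sub>R pp e = 0 \<and> (\<beta> - l) *\<^sub>R pm e = 0 \<and> (- l) *\<^sub>R A z x = 0"
        by (rule orthogonal_sum_eq_0)
          (use inner_A_F[OF w(2) A_pp[OF e(1)] z] inner_A_F[OF w(2) A_pm[OF e(1)] z] pp_inner_pm[of e e] in
            \<open>simp_all add: inner_commute\<close>)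
      finally show ?thesis using n(2) by (auto simp: A_eq_0_iff)
    qed
    have Az: "A z x \<bullet> J x = 0" if "z \<bullet> w = 0" for z
      using inner_A_F[OF w(2) F_J[OF w(2)] that] .
    show ?thesis
    proof
      assume v: "v \<in> R"
      then obtain e z where ez: "v = e + A z x" "A w e = e" "e \<bullet> x = 0" "z \<bullet> w = 0" "v \<bullet> J x = 0"
        by (auto simp: R_def tangent_Mc[OF c x] w_def elim: TN_E)
      then have "e \<bullet> J x = 0" using Az[of z] by (simp add: inner_add_left)
      then show ?rhs using v *[OF ez(2,3) _ ez(4)] ez by (auto simp: R_def)
    next
      assume ?rhs
      then obtain e z where ez: "v = e + A z x" "A w e = e" "e \<bullet> x = 0" "e \<bullet> J x = 0" "z \<bullet> w = 0"
        and l: "(l = \<alpha> \<or> pp e = 0) \<and> (l = \<beta> \<or> pm e = 0) \<and> (l = 0 \<or> z = 0)" by auto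
      have "v \<in> TN x" unfolding ez(1) by (rule TN_I) (use ez in \<open>simp_all add: w_def\<close>)
      moreover have "v \<bullet> J x = 0" using ez Az by (simp add: inner_add_left)
      ultimately show "v \<in> R" using *[OF ez(2-5)] l by (simp add: R_def tangent_Mc[OF c x] flip: ez(1))
    qed
  qed
  have eq: "pc_mult N (Mc c) x (s *\<^sub>R \<nu> c x) l = dim R" by (simp add: pc_mult_def R_def)
  have Jx: "e \<bullet> J x = J e \<bullet> x" for e by (simp add: J_sym)
  consider "l = \<alpha>" | "l = \<beta>" | "l = 0" | "l \<noteq> \<alpha>" "l \<noteq> \<beta>" "l \<noteq> 0" by blast
  then show ?thesis
  proof cases
    case 1
    have "R = {e \<in> V w 1. e \<bullet> pp x = 0}"
      using 1 ne by (auto simp: R V_def pm_eq_0_iff Jx pp_def inner_add_right)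
    moreover have "dim {e \<in> V w 1. e \<bullet> pp x = 0} = dim (V w 1) - 1"
      by (rule dim_orthogonal_to_vector) (use subspace_V[of w 1] A_pp[OF w(2)] x0 J_pp in \<open>auto simp: V_def\<close>)
    ultimately show ?thesis using eq 1 dim_V[OF w(1)] by simp
  next
    case 2
    have "R = {e \<in> V w (-1). e \<bullet> pm x = 0}"
      using 2 ne by (auto simp: R V_def pp_eq_0_iff Jx pm_def inner_diff_right)
    moreover have "dim {e \<in> V w (-1). e \<bullet> pm x = 0} = dim (V w (-1)) - 1"
      by (rule dim_orthogonal_to_vector) (use subspace_V[of w "-1"] A_pm[OF w(2)] x0 J_pm in \<open>auto simp: V_def\<close>)
    ultimately show ?thesis using eq 2 dim_V[OF w(1)] by simp
  next
    case 3
    have pp0: "pp e = 0 \<and> pm e = 0 \<longleftrightarrow> e = 0" for e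
      using pp_pm(1)[of e] by (auto simp: linear_0[OF linear_pp] linear_0[OF linear_pm])
    have "R = (\<lambda>z. A z x) ` W w"
    proof (intro equalityI subsetI)
      fix v assume "v \<in> R"
      then obtain e z where "v = e + A z x" "z \<bullet> w = 0" "pp e = 0" "pm e = 0" using 3 ne by (auto simp: R)
      then show "v \<in> (\<lambda>z. A z x) ` W w" using pp0[of e] by (auto simp: W_def)
    next
      fix v assume "v \<in> (\<lambda>z. A z x) ` W w"
      then obtain z where "v = A z x" "z \<bullet> w = 0" by (auto simp: W_def)
      then show "v \<in> R"
        unfolding R
        by - (rule exI[of _ 0], rule exI[of _ z], simp add: 3 linear_0[OF linear_pp] linear_0[OF linear_pm])
    qed
    moreover have "x \<noteq> 0" using n(2) by auto
    ultimately show ?thesis using eq 3 ne dim_A_image[OF _ subspace_W, of x w] dim_W[OF w(1)] by simp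
  next
    case 4
    have "R = {0}"
    proof -
      have "v = 0" if "v \<in> R" for v
      proof -
        have "pp v = 0" "pm v = 0" using that 4 by (auto simp: R)
        then show ?thesis using pp_pm(1)[of v] by simp
      qed
      moreover have "0 \<in> R"
        unfolding R by (rule exI[of _ 0], rule exI[of _ 0]) (simp add: linear_0[OF linear_pp] linear_0[OF linear_pm])
      ultimately show ?thesis by blast
    qed
    then show ?thesis using eq 4 by simp
  qed
qed

lemma hypersurface_Mc: "hypersurface N (Mc c)"
  unfolding hypersurface_def
proof
  show "Mc c \<subseteq> N" by (auto simp: Mc_iff)
  have "3 * k - 1 = Suc (3 * k - 2)" using k_pos by simp
  then show "\<exists>j. submanifold (Suc j) N \<and> submanifold j (Mc c)"
    using submanifold_N submanifold_Mc[OF c] by auto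
qed

lemma unit_normal_field_Mc: "unit_normal_field N (Mc c) (\<nu> c)"
  unfolding unit_normal_field_def
proof (intro conjI ballI)
  show "smooth_on (Mc c) (\<nu> c)" by (intro smooth_on_linear linear_\<nu>[OF c])
  fix x assume x: "x \<in> Mc c"
  show "norm (\<nu> c x) = 1" by (rule \<nu>_facts(1)[OF c x])
  show "\<nu> c x \<in> normal_space N (Mc c) x"
    unfolding normal_Mc[OF c x] using rangeI[of "\<lambda>s. s *\<^sub>R \<nu> c x" 1] by simp
qed

lemma const_principal_curvatures_Mc: "const_principal_curvatures N (Mc c)"
  unfolding const_principal_curvatures_def
proof (intro conjI exI ballI allI)
  show "pc_mult N (Mc c) x (\<nu> c x) l = pc_mult N (Mc c) y (\<nu> c y) l" if "x \<in> Mc c" "y \<in> Mc c" for x y l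
    using pc_mult_Mc[OF that(1), of 1] pc_mult_Mc[OF that(2), of 1] by simp
qed (fact hypersurface_Mc unit_normal_field_Mc)+

end

lemma austere_Mc: "austere N (Mc 0)"
  unfolding austere_def
proof (intro ballI impI allI)
  fix x \<eta> l assume x: "x \<in> Mc 0" and \<eta>: "\<eta> \<in> normal_space N (Mc 0) x" "norm \<eta> = 1"
  obtain s where s: "\<eta> = s *\<^sub>R \<nu> 0 x" using \<eta>(1) normal_Mc[of 0 x] x by auto
  then have "s \<noteq> 0" using \<eta>(2) by auto
  then show "pc_mult N (Mc 0) x \<eta> l = pc_mult N (Mc 0) x \<eta> (- l)"
    using pc_mult_Mc[of 0 x s] x unfolding s by auto
qed

end

section \<open>Geodesics and parallel level sets\<close>

context clifford_pair begin

text \<open>The speed of the projection of a geodesic to the base of the sphere bundle \<open>q\<close> is constant. A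
  geodesic that starts vertically therefore stays in one fibre, which is a great sphere.\<close>

lemma geodesic_vertical:
  assumes \<gamma>: "geodesic_on {a<..<b} N \<gamma>" and ab: "0 \<in> {a<..<b}" and x: "\<gamma> 0 = x" "x \<in> Mc 0"
    and v: "vector_derivative \<gamma> (at 0) = J x" and t: "t \<in> {a<..<b}"
  shows "\<gamma> t = cos t *\<^sub>R x + sin t *\<^sub>R J x"
proof -
  let ?I = "{a<..<b}"
  define \<gamma>1 where "\<gamma>1 s = vector_derivative \<gamma> (at s)" for s
  define \<gamma>2 where "\<gamma>2 s = vector_derivative \<gamma>1 (at s)" for s
  have sm: "smooth_on ?I \<gamma>" and N: "\<And>s. s \<in> ?I \<Longrightarrow> \<gamma> s \<in> N"
    and acc': "\<And>s v. s \<in> ?I \<Longrightarrow> v \<in> tangent_space N (\<gamma> s) \<Longrightarrow> \<gamma>2 s \<bullet> v = 0"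
    using \<gamma> unfolding geodesic_on_def \<gamma>2_def \<gamma>1_def[abs_def] by auto
  have acc: "\<gamma>2 s \<bullet> v = 0" if "s \<in> ?I" "v \<in> TN (\<gamma> s)" for s v
    using acc'[OF that(1)] that(2) tangent_N[OF N[OF that(1)]] by simp
  have d1: "(\<gamma> has_vector_derivative \<gamma>1 s) (at s)" and d2: "(\<gamma>1 has_vector_derivative \<gamma>2 s) (at s)" if "s \<in> ?I" for s
    using smooth_on_open_second_derivative[OF sm _ that]
    unfolding \<gamma>2_def \<gamma>1_def[abs_def] by simp_all
  have const: "f s = f 0" if d: "\<And>s. s \<in> ?I \<Longrightarrow> (f has_vector_derivative 0) (at s)" and s: "s \<in> ?I"
    for f :: "real \<Rightarrow> 'c::real_normed_vector" and s
  proof -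
    have "\<exists>c. \<forall>s\<in>?I. f s = c"
      by (rule has_vector_derivative_zero_constant[of ?I f])
        (use d in \<open>auto intro: has_vector_derivative_at_within\<close>)
    then show ?thesis using s ab by metis
  qed
  have tang: "\<gamma>1 s \<in> tangent_space N (\<gamma> s)" if s: "s \<in> ?I" for s
  proof -
    define e where "e = min (s - a) (b - s)"
    have e: "0 < e" "\<And>r. r \<in> {-e<..<e} \<Longrightarrow> s + r \<in> ?I" using s by (auto simp: e_def)
    show ?thesis
    proof (rule tangent_spaceI[OF e(1), of "\<lambda>r. \<gamma> (s + r)"])
      show "smooth_on {- e<..<e} (\<lambda>r. \<gamma> (s + r))"
        by (rule smooth_on_compose[OF _ sm e(2)]) (intro smooth_on_intros)
      show "(\<lambda>r. \<gamma> (s + r)) ` {- e<..<e} \<subseteq> N" using e(2) N by blast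
      have "((\<lambda>r. s + r) has_vector_derivative 1) (at 0)" by (auto intro!: derivative_eq_intros)
      from vector_diff_chain_at[OF this, of \<gamma> "\<gamma>1 s"] d1[OF s]
      show "((\<lambda>r. \<gamma> (s + r)) has_vector_derivative \<gamma>1 s) (at 0)" by (simp add: o_def)
    qed simp
  qed
  define z where "z s = Q (\<gamma> s) (\<gamma>1 s)" for s
  note hor = tangent_N_horizontal[OF N tang]
  have dz: "(z has_vector_derivative Q (\<gamma> s) (\<gamma>2 s) + Q (\<gamma>1 s) (\<gamma>1 s)) (at s)" if "s \<in> ?I" for s
    unfolding z_def by (rule bounded_bilinear.has_vector_derivative[OF bounded_bilinear_Q d1[OF that] d2[OF that]])
  have zz: "z s \<bullet> (Q (\<gamma> s) (\<gamma>2 s) + Q (\<gamma>1 s) (\<gamma>1 s)) = 0" if s: "s \<in> ?I" for s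
  proof -
    note n = N_D[OF N[OF s]]
    define e where "e = \<gamma>1 s - A (z s) (\<gamma> s)"
    have e: "A (q (\<gamma> s)) e = e" "e \<bullet> \<gamma> s = 0" "z s \<bullet> q (\<gamma> s) = 0"
      using hor[OF s s] by (simp_all add: e_def z_def F_def)
    have "A (z s) (\<gamma> s) \<in> TN (\<gamma> s)" using TN_I[of "\<gamma> s" 0 "z s"] e by simp
    then have "z s \<bullet> Q (\<gamma> s) (\<gamma>2 s) = 0" using acc[OF s] by (simp add: inner_Q inner_commute[of "A (z s) (\<gamma> s)"])
    moreover have "A (z s) (e + A (z s) (\<gamma> s)) \<bullet> (e + A (z s) (\<gamma> s)) = 0"
      using inner_A_F[OF e(1) e(1) e(3)] inner_A_F[OF n(5) n(5) e(3)] e(2)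
      by (simp add: inner_add_left inner_add_right A_inner_A A_A inner_commute)
        (simp add: A_sym[of "z s" e] A_A inner_commute)
    then have "z s \<bullet> Q (\<gamma>1 s) (\<gamma>1 s) = 0" by (simp add: inner_Q e_def)
    ultimately show ?thesis by (simp add: inner_add_right)
  qed
  have xN: "x \<in> N" "h x = 0" using x by (auto simp: Mc_iff)
  note n = N_D[OF xN(1)]
  have xJ: "x \<bullet> J x = 0" using xN by (simp add: h_def inner_commute)
  have 0: "\<gamma>1 0 = J x" using v by (simp add: \<gamma>1_def)
  have dzz: "((\<lambda>s. z s \<bullet> z s) has_vector_derivative 0) (at s)" if s: "s \<in> ?I" for s
    using bounded_bilinear.has_vector_derivative[OF bounded_bilinear_inner dz[OF s] dz[OF s]] zz[OF s]
    by (simp add: inner_commute)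
  have "z s \<bullet> z s = z 0 \<bullet> z 0" if "s \<in> ?I" for s by (rule const[OF dzz that])
  moreover have "z 0 = 0" using Q_eigenvectors[OF n(5) F_J[OF n(5)]] xJ by (simp add: z_def x 0)
  ultimately have z0: "z s = 0" if "s \<in> ?I" for s using that by simp
  define w where "w = q x"
  have dq: "((\<lambda>s. q (\<gamma> s)) has_vector_derivative 0) (at s)" if s: "s \<in> ?I" for s
    using bounded_bilinear.has_vector_derivative[OF bounded_bilinear_Q d1[OF s] d1[OF s]] z0[OF s]
    by (simp add: q_def z_def Q_commute[of "\<gamma>1 s"])
  have qw: "q (\<gamma> s) = w" if "s \<in> ?I" for s
    using const[OF dq that] by (simp add: w_def x)
  have A0: "A w (\<gamma> s) = \<gamma> s" and A1: "A w (\<gamma>1 s) = \<gamma>1 s" and o: "\<gamma>1 s \<bullet> \<gamma> s = 0" if s: "s \<in> ?I" for s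
    using N_D(5)[OF N[OF s]] hor[OF s s] qw[OF s] z0[OF s] by (auto simp: F_def z_def)
  have A2: "A w (\<gamma>2 s) = \<gamma>2 s" if s: "s \<in> ?I" for s
  proof -
    have "((\<lambda>r. A w (\<gamma>1 r)) has_vector_derivative A w (\<gamma>2 s)) (at s)"
      by (rule bounded_linear.has_vector_derivative[OF _ d2[OF s]]) (simp add: linear_A linear_conv_bounded_linear[symmetric])
    then have "(\<gamma>1 has_vector_derivative A w (\<gamma>2 s)) (at s)"
      by (rule has_vector_derivative_transform_within_open[OF _ open_greaterThanLessThan s]) (rule A1)
    then show ?thesis using d2[OF s] by (rule vector_derivative_unique_at)
  qed
  have dv: "((\<lambda>s. \<gamma>1 s \<bullet> \<gamma>1 s) has_vector_derivative 0) (at s)" if s: "s \<in> ?I" for s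
    using bounded_bilinear.has_vector_derivative[OF bounded_bilinear_inner d2[OF s] d2[OF s]]
      acc[OF s] tang[OF s] tangent_N[OF N[OF s]] by (simp add: inner_commute)
  have v1: "\<gamma>1 s \<bullet> \<gamma>1 s = 1" if "s \<in> ?I" for s
    using const[OF dv that] n by (simp add: 0 J_inner_J)
  have g2: "\<gamma>2 s = - \<gamma> s" if s: "s \<in> ?I" for s
  proof -
    have "((\<lambda>s. \<gamma>1 s \<bullet> \<gamma> s) has_vector_derivative \<gamma>1 s \<bullet> \<gamma>1 s + \<gamma>2 s \<bullet> \<gamma> s) (at s)"
      by (rule bounded_bilinear.has_vector_derivative[OF bounded_bilinear_inner d2[OF s] d1[OF s]])
    then have "((\<lambda>s. 0::real) has_vector_derivative \<gamma>1 s \<bullet> \<gamma>1 s + \<gamma>2 s \<bullet> \<gamma> s) (at s)"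
      by (rule has_vector_derivative_transform_within_open[OF _ open_greaterThanLessThan s]) (rule o)
    then have "\<gamma>1 s \<bullet> \<gamma>1 s + \<gamma>2 s \<bullet> \<gamma> s = 0"
      using has_vector_derivative_const by (rule vector_derivative_unique_at)
    then have g: "\<gamma>2 s \<bullet> \<gamma> s = -1" using v1[OF s] by simp
    define d where "d = \<gamma>2 s + \<gamma> s"
    have dg: "d \<bullet> \<gamma> s = 0" using g N_D(2)[OF N[OF s]] by (simp add: d_def inner_add_left)
    have "A (q (\<gamma> s)) d = d" by (simp add: d_def qw[OF s] A0[OF s] A2[OF s])
    from TN_I[OF this dg, of 0] have "d \<in> TN (\<gamma> s)" by simp
    from acc[OF s this] dg have "d \<bullet> d = 0" by (simp add: d_def inner_add_left inner_commute)
    then show ?thesis by (simp add: d_def eq_neg_iff_add_eq_0)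
  qed
  have "((\<lambda>s. cos s *\<^sub>R \<gamma> s - sin s *\<^sub>R \<gamma>1 s) has_vector_derivative 0) (at s)"
    "((\<lambda>s. sin s *\<^sub>R \<gamma> s + cos s *\<^sub>R \<gamma>1 s) has_vector_derivative 0) (at s)" if s: "s \<in> ?I" for s
  proof -
    have c: "(cos has_real_derivative - sin s) (at s)" and si: "(sin has_real_derivative cos s) (at s)"
      by (rule DERIV_cos DERIV_sin)+
    note ds = d1[OF s] d2[OF s, unfolded g2[OF s]]
    show "((\<lambda>s. cos s *\<^sub>R \<gamma> s - sin s *\<^sub>R \<gamma>1 s) has_vector_derivative 0) (at s)"
      using has_vector_derivative_diff[OF has_vector_derivative_scaleR[OF c ds(1)] has_vector_derivative_scaleR[OF si ds(2)]]
      by simp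
    show "((\<lambda>s. sin s *\<^sub>R \<gamma> s + cos s *\<^sub>R \<gamma>1 s) has_vector_derivative 0) (at s)"
      using has_vector_derivative_add[OF has_vector_derivative_scaleR[OF si ds(1)] has_vector_derivative_scaleR[OF c ds(2)]]
      by simp
  qed
  from const[OF this(1) t] const[OF this(2) t]
  have "cos t *\<^sub>R \<gamma> t - sin t *\<^sub>R \<gamma>1 t = x" "sin t *\<^sub>R \<gamma> t + cos t *\<^sub>R \<gamma>1 t = J x" by (simp_all add: x 0)
  then have "cos t *\<^sub>R x + sin t *\<^sub>R J x
      = cos t *\<^sub>R (cos t *\<^sub>R \<gamma> t - sin t *\<^sub>R \<gamma>1 t) + sin t *\<^sub>R (sin t *\<^sub>R \<gamma> t + cos t *\<^sub>R \<gamma>1 t)" by simp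
  also have "\<dots> = (cos t)\<^sup>2 *\<^sub>R \<gamma> t + (sin t)\<^sup>2 *\<^sub>R \<gamma> t"
    by (simp add: algebra_simps power2_eq_square)
  also have "\<dots> = \<gamma> t" by (simp flip: scaleR_left_distrib)
  finally show ?thesis by simp
qed

lemma great_circle_N:
  assumes x: "x \<in> Mc 0"
  shows "cos t *\<^sub>R x + sin t *\<^sub>R J x \<in> Mc (sin (2 * t))" "q (cos t *\<^sub>R x + sin t *\<^sub>R J x) = q x"
proof -
  have xN: "x \<in> N" "h x = 0" using x by (auto simp: Mc_iff)
  note n = N_D[OF xN(1)]
  have xJ: "x \<bullet> J x = 0" "J x \<bullet> x = 0" using xN by (simp_all add: h_def inner_commute)
  let ?y = "cos t *\<^sub>R x + sin t *\<^sub>R J x"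
  have 1: "?y \<bullet> ?y = 1"
    using n xJ by (simp add: inner_add_left inner_add_right J_inner_J flip: power2_eq_square)
  have 2: "A (q x) ?y = ?y" using F_J[OF n(5)] n by simp
  note y = N_I[OF 1 n(3) 2]
  show "q ?y = q x" by (rule y(2))
  have "h ?y = sin (2 * t)"
    using n xJ by (simp add: h_def inner_add_left inner_add_right J_inner_J sin_double)
  then show "?y \<in> Mc (sin (2 * t))" using y by (simp add: Mc_iff)
qed

lemma great_circle_geodesic:
  assumes x: "x \<in> Mc 0"
  shows "geodesic_on {a<..<b} N (\<lambda>t. cos t *\<^sub>R x + sin t *\<^sub>R J x)"
  unfolding geodesic_on_def
proof (intro conjI ballI)
  let ?\<gamma> = "\<lambda>t. cos t *\<^sub>R x + sin t *\<^sub>R J x"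
  show "smooth_on {a<..<b} ?\<gamma>" by (intro smooth_on_intros)
  have N: "?\<gamma> s \<in> N" for s using great_circle_N(1)[OF x] by (simp add: Mc_iff)
  then show "?\<gamma> ` {a<..<b} \<subseteq> N" by auto
  have "vector_derivative ?\<gamma> (at r) = (- sin r) *\<^sub>R x + cos r *\<^sub>R J x" for r
    by (rule vector_derivative_at) (auto intro!: derivative_eq_intros)
  then have 1: "(\<lambda>r. vector_derivative ?\<gamma> (at r)) = (\<lambda>r. (- sin r) *\<^sub>R x + cos r *\<^sub>R J x)" by blast
  have 2: "vector_derivative (\<lambda>r. (- sin r) *\<^sub>R x + cos r *\<^sub>R J x) (at s) = - ?\<gamma> s" for s
    by (rule vector_derivative_at) (auto intro!: derivative_eq_intros)
  fix s v assume "v \<in> tangent_space N (?\<gamma> s)"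
  then have "v \<bullet> ?\<gamma> s = 0" using TN_inner[OF N] by (simp add: tangent_N[OF N])
  then show "vector_derivative (\<lambda>r. vector_derivative ?\<gamma> (at r)) (at s) \<bullet> v = 0"
    by (simp only: 1 2 inner_minus_left inner_commute[of "?\<gamma> s" v] minus_zero)
qed

lemma \<nu>_0: "\<nu> 0 x = J x"
  using \<nu>_def[of 0 x] by simp

lemma parallel_Mc:
  assumes t: "\<bar>t\<bar> < pi / 4"
  shows "parallel N (Mc 0) (\<nu> 0) t = Mc (sin (2 * t))"
proof
  show "parallel N (Mc 0) (\<nu> 0) t \<subseteq> Mc (sin (2 * t))"
  proof
    fix y assume "y \<in> parallel N (Mc 0) (\<nu> 0) t"
    then obtain \<gamma> a b where "y = \<gamma> t" and *: "geodesic_on {a<..<b} N \<gamma>" "0 \<in> {a<..<b}" "\<gamma> 0 \<in> Mc 0"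
      "vector_derivative \<gamma> (at 0) = \<nu> 0 (\<gamma> 0)" "t \<in> {a<..<b}"
      unfolding parallel_def by blast
    then have "y = cos t *\<^sub>R \<gamma> 0 + sin t *\<^sub>R J (\<gamma> 0)"
      using geodesic_vertical[OF *(1,2) refl *(3) _ *(5)] by (simp add: \<nu>_0)
    then show "y \<in> Mc (sin (2 * t))" using great_circle_N(1)[OF *(3)] by simp
  qed
  show "Mc (sin (2 * t)) \<subseteq> parallel N (Mc 0) (\<nu> 0) t"
  proof
    fix y assume "y \<in> Mc (sin (2 * t))"
    then have y: "y \<in> N" "h y = sin (2 * t)" by (auto simp: Mc_iff)
    note n = N_D[OF y(1)]
    define C where "C = cos (2 * t)"
    have C: "0 < C" unfolding C_def by (rule cos_gt_zero_pi) (use t in auto)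
    define x where "x = inverse C *\<^sub>R (cos t *\<^sub>R y - sin t *\<^sub>R J y)"
    have Jyy: "J y \<bullet> y = sin (2 * t)" "y \<bullet> J y = sin (2 * t)" using y by (auto simp: h_def inner_commute)
    have "(cos t *\<^sub>R y - sin t *\<^sub>R J y) \<bullet> (cos t *\<^sub>R y - sin t *\<^sub>R J y)
        = (cos t)\<^sup>2 + (sin t)\<^sup>2 - 2 * sin t * cos t * sin (2 * t)"
      using n Jyy by (simp add: inner_diff_left inner_diff_right J_inner_J power2_eq_square algebra_simps)
    also have "\<dots> = 1 - (sin (2 * t))\<^sup>2" by (simp add: sin_double power2_eq_square)
    also have "\<dots> = C * C" by (simp add: C_def cos_squared_eq flip: power2_eq_square)
    finally have "x \<bullet> x = inverse C * (inverse C * (C * C))"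
      by (simp only: x_def inner_scaleR_left inner_scaleR_right)
    then have 1: "x \<bullet> x = 1" using C by (simp add: field_simps)
    have 2: "A (q y) x = x" using n F_J[OF n(5)] by (simp add: x_def)
    have "h (cos t *\<^sub>R y - sin t *\<^sub>R J y) = (cos t)\<^sup>2 * sin (2 * t) + (sin t)\<^sup>2 * sin (2 * t) - 2 * sin t * cos t"
      using n Jyy by (simp add: h_def inner_diff_left inner_diff_right J_inner_J power2_eq_square algebra_simps)
    also have "\<dots> = ((cos t)\<^sup>2 + (sin t)\<^sup>2) * sin (2 * t) - 2 * sin t * cos t"
      by (simp only: distrib_right)
    finally have "h x = 0" by (simp add: x_def h_scaleR sin_double)
    then have x: "x \<in> Mc 0" using N_I(1)[OF 1 n(3) 2] by (simp add: Mc_iff)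
    have "cos t *\<^sub>R x + sin t *\<^sub>R J x = inverse C *\<^sub>R (((cos t)\<^sup>2 - (sin t)\<^sup>2) *\<^sub>R y)"
      by (simp add: x_def algebra_simps power2_eq_square)
    then have yx: "y = cos t *\<^sub>R x + sin t *\<^sub>R J x" using C by (simp add: C_def cos_double)
    let ?\<gamma> = "\<lambda>t. cos t *\<^sub>R x + sin t *\<^sub>R J x"
    have "vector_derivative ?\<gamma> (at 0) = J x"
      by (rule vector_derivative_at) (auto intro!: derivative_eq_intros)
    then have *: "0 \<in> {- (\<bar>t\<bar> + 1)<..<\<bar>t\<bar> + 1} \<and> t \<in> {- (\<bar>t\<bar> + 1)<..<\<bar>t\<bar> + 1} \<and>
        geodesic_on {- (\<bar>t\<bar> + 1)<..<\<bar>t\<bar> + 1} N ?\<gamma> \<and> ?\<gamma> 0 \<in> Mc 0 \<and> vector_derivative ?\<gamma> (at 0) = \<nu> 0 (?\<gamma> 0)"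
      using great_circle_geodesic[OF x] x by (auto simp: \<nu>_0)
    show "y \<in> parallel N (Mc 0) (\<nu> 0) t"
      unfolding parallel_def
      by (rule CollectI, rule exI[of _ ?\<gamma>], rule conjI[OF yx], rule exI, rule exI, rule *)
  qed
qed

lemma totally_isoparametric_Mc: "totally_isoparametric N (Mc 0)"
  unfolding totally_isoparametric_def
proof (intro conjI exI allI impI)
  show "const_principal_curvatures N (Mc 0)" by (rule const_principal_curvatures_Mc) auto
  show "unit_normal_field N (Mc 0) (\<nu> 0)" by (rule unit_normal_field_Mc) auto
  show "0 < pi / 4" by simp
  fix t :: real assume t: "\<bar>t\<bar> < pi / 4"
  have "0 < cos (2 * t)" by (rule cos_gt_zero_pi) (use t in auto)
  then have "(sin (2 * t))\<^sup>2 < 1" using sin_squared_eq[of "2 * t"] by simp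
  then have "\<bar>sin (2 * t)\<bar> < 1" by (simp add: abs_square_less_1)
  then show "const_principal_curvatures N (parallel N (Mc 0) (\<nu> 0) t)"
    unfolding parallel_Mc[OF t] by (intro const_principal_curvatures_Mc) auto
qed

end

section \<open>Gradient and Laplacian\<close>

context clifford_pair begin

lemma h_has_derivative: "(h has_derivative (\<lambda>v. 2 * (J x \<bullet> v))) (at x within S)"
proof -
  have "((\<lambda>x. J x \<bullet> x) has_derivative (\<lambda>v. J x \<bullet> v + J v \<bullet> x)) (at x within S)"
    by (intro has_derivative_inner has_derivative_ident linear_imp_has_derivative linear_J)
  moreover have "J x \<bullet> v + J v \<bullet> x = 2 * (J x \<bullet> v)" for v
    by (simp add: J_sym[of v x] inner_commute[of v])
  ultimately show ?thesis by (simp add: h_def[abs_def])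
qed

lemma grad_vertical:
  assumes "x \<in> N"
  shows "A (q x) (J x - h x *\<^sub>R x) = J x - h x *\<^sub>R x" "(J x - h x *\<^sub>R x) \<bullet> x = 0"
    "(J x - h x *\<^sub>R x) \<bullet> (J x - h x *\<^sub>R x) = 1 - (h x)\<^sup>2"
  using F_J[OF N_D(5)[OF assms]] N_D[OF assms]
  by (simp_all add: inner_diff_left inner_diff_right J_inner_J h_def inner_commute power2_eq_square)

lemma grad_h:
  assumes x: "x \<in> N"
  shows "grad N h x = 2 *\<^sub>R (J x - h x *\<^sub>R x)"
proof (rule grad_eq)
  show "subspace (tangent_space N x)" by (simp add: tangent_N[OF x] subspace_TN)
  show "(h has_derivative (\<lambda>v. 2 * (J x \<bullet> v))) (at x within N)" by (rule h_has_derivative)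
  have "J x - h x *\<^sub>R x \<in> TN x" using TN_I[OF grad_vertical(1,2)[OF x], of 0] by simp
  then show "2 *\<^sub>R (J x - h x *\<^sub>R x) \<in> tangent_space N x"
    unfolding tangent_N[OF x] by (intro subspace_scale subspace_TN)
  show "2 *\<^sub>R (J x - h x *\<^sub>R x) \<bullet> v = 2 * (J x \<bullet> v)" if "v \<in> tangent_space N x" for v
    using TN_inner[OF x, of v] that by (simp add: tangent_N[OF x] inner_diff_left inner_commute[of x])
qed

lemma norm_grad_h:
  assumes x: "x \<in> N"
  shows "(norm (grad N h x))\<^sup>2 = 4 * (1 - (h x)\<^sup>2)"
  using grad_vertical(3)[OF x] by (simp add: grad_h[OF x] power2_norm_eq_inner)

lemma trace_J_F:
  assumes w: "norm w = 1" and B: "orthonormal_basis_of B (F w)"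
  shows "(\<Sum>b\<in>B. J b \<bullet> b) = 0"
proof -
  obtain C where C: "orthonormal_basis_of C (V w 1)" using orthonormal_basis_of_exists[OF subspace_V] .
  obtain D where D: "orthonormal_basis_of D (V w (-1))" using orthonormal_basis_of_exists[OF subspace_V] .
  note CD = orthonormal_basis_of_sums[OF C D V_orthogonal_J, folded F_eq]
  have "(\<Sum>b\<in>B. J b \<bullet> b) = (\<Sum>b\<in>C \<union> D. J b \<bullet> b)"
    by (rule trace_independent_of_basis[OF B CD(1) linear_J]) auto
  also have "\<dots> = (\<Sum>b\<in>C. J b \<bullet> b) + (\<Sum>b\<in>D. J b \<bullet> b)"
    using orthonormal_basis_of_facts(1)[OF C] orthonormal_basis_of_facts(1)[OF D] CD(2) by (intro sum.union_disjoint) auto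
  also have "(\<Sum>b\<in>C. J b \<bullet> b) = (\<Sum>b\<in>C. 1)"
    using C by (intro sum.cong refl) (auto simp: orthonormal_basis_of_def V_def norm_eq_1)
  also have "(\<Sum>b\<in>D. J b \<bullet> b) = (\<Sum>b\<in>D. -1)"
    using D by (intro sum.cong refl) (auto simp: orthonormal_basis_of_def V_def norm_eq_1)
  finally show ?thesis
    using orthonormal_basis_of_facts(3)[OF C] orthonormal_basis_of_facts(3)[OF D] dim_V[OF w] by simp
qed

lemma dim_TN_trace:
  assumes x: "x \<in> N" and B: "orthonormal_basis_of B (TN x)"
  shows "card B = 3 * k - 1" "(\<Sum>b\<in>B. J b \<bullet> b) = (real k - 1) * h x"
proof -
  note n = N_D[OF x]
  define G where "G = {e \<in> F (q x). e \<bullet> x = 0}"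
  have sG: "subspace G" using subspace_F[of "q x"] by (auto simp: G_def subspace_def inner_add_left)
  have sA: "subspace ((\<lambda>z. A z x) ` W (q x))" by (intro linear_subspace_image linear_A_left subspace_W)
  obtain C where C: "orthonormal_basis_of C G" using orthonormal_basis_of_exists[OF sG] .
  obtain D where D: "orthonormal_basis_of D ((\<lambda>z. A z x) ` W (q x))" using orthonormal_basis_of_exists[OF sA] .
  have TN: "TN x = {s + t |s t. s \<in> G \<and> t \<in> (\<lambda>z. A z x) ` W (q x)}"
    by (auto simp: TN_def F_def W_def G_def)
  have "s \<bullet> t = 0" if "s \<in> G" "t \<in> (\<lambda>z. A z x) ` W (q x)" for s t
    using that inner_A_F[OF n(5), of s] by (auto simp: G_def F_def W_def inner_commute)
  note CD = orthonormal_basis_of_sums[OF C D this, folded TN]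
  have x1: "orthonormal_basis_of {x} (span {x})" using n by (simp add: orthonormal_basis_of_def span_base)
  have Gx: "F (q x) = {s + t |s t. s \<in> G \<and> t \<in> span {x}}"
  proof (intro equalityI subsetI)
    fix y assume y: "y \<in> F (q x)"
    have "y - (y \<bullet> x) *\<^sub>R x \<in> G" using y n by (simp add: G_def F_def inner_diff_left)
    moreover have "(y \<bullet> x) *\<^sub>R x \<in> span {x}" by (simp add: span_base span_scale)
    moreover have "y = (y - (y \<bullet> x) *\<^sub>R x) + (y \<bullet> x) *\<^sub>R x" by simp
    ultimately show "y \<in> {s + t |s t. s \<in> G \<and> t \<in> span {x}}" by blast
  qed (use n in \<open>auto simp: G_def F_def span_singleton\<close>)
  have Gxo: "s \<bullet> t = 0" if "s \<in> G" "t \<in> span {x}" for s t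
    using that by (auto simp: G_def span_singleton)
  note Cx = orthonormal_basis_of_sums[OF C x1 Gxo, folded Gx]
  note fC = orthonormal_basis_of_facts[OF C] and fD = orthonormal_basis_of_facts[OF D]
  have x0: "x \<noteq> 0" using n by auto
  have cD: "card D = k" using fD(3) dim_A_image[OF x0 subspace_W] dim_W[OF n(3)] by simp
  have "(\<Sum>b\<in>C \<union> {x}. J b \<bullet> b) = 0" by (rule trace_J_F[OF n(3) Cx(1)]) auto
  then have tC: "(\<Sum>b\<in>C. J b \<bullet> b) = - h x"
    using fC(1) Cx(2) by (simp add: h_def)
  have "J b \<bullet> b = h x" if b: "b \<in> D" for b
  proof -
    obtain z where z: "b = A z x" using b D by (auto simp: orthonormal_basis_of_def)
    moreover have "b \<bullet> b = 1" using fD(5)[OF b b] by simp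
    ultimately show ?thesis using n by (simp add: J_A_inner A_inner_A h_def)
  qed
  then have tD: "(\<Sum>b\<in>D. J b \<bullet> b) = real k * h x" using cD by simp
  have cC: "card C = 2 * k - 1"
    using orthonormal_basis_of_facts(1,3)[OF Cx(1)] Cx(2) fC(1) dim_F[OF n(3)] by auto
  show "card B = 3 * k - 1"
    using orthonormal_basis_of_facts(3)[OF B] orthonormal_basis_of_facts(3)[OF CD(1)] CD(2) fC(1) fD(1) cC cD k_pos
    by (auto simp: card_Un_disjoint)
  have "(\<Sum>b\<in>B. J b \<bullet> b) = (\<Sum>b\<in>C \<union> D. J b \<bullet> b)"
    by (rule trace_independent_of_basis[OF B CD(1) linear_J]) auto
  then show "(\<Sum>b\<in>B. J b \<bullet> b) = (real k - 1) * h x"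
    using fC(1) fD(1) CD(2) tC tD by (simp add: sum.union_disjoint algebra_simps)
qed

lemma laplacian_h:
  assumes x: "x \<in> N"
  shows "laplacian N h x = - 4 * real k * h x"
proof -
  define B where "B = (SOME B. orthonormal_basis_of B (tangent_space N x))"
  have T: "tangent_space N x = TN x" by (rule tangent_N[OF x])
  have "\<exists>B. orthonormal_basis_of B (tangent_space N x)"
    using orthonormal_basis_of_exists[OF subspace_TN] unfolding T by metis
  then have "orthonormal_basis_of B (tangent_space N x)" unfolding B_def by (rule someI_ex)
  then have B: "orthonormal_basis_of B (TN x)" by (simp add: T)
  have d: "((\<lambda>y. 2 *\<^sub>R (J y - h y *\<^sub>R y)) has_derivative
      (\<lambda>v. 2 *\<^sub>R (J v - (h x *\<^sub>R v + (2 * (J x \<bullet> v)) *\<^sub>R x)))) (at x within N)"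
    by (intro has_derivative_scaleR_right has_derivative_diff linear_imp_has_derivative linear_J
        has_derivative_scaleR h_has_derivative has_derivative_ident)
  then have g: "(grad N h has_derivative (\<lambda>v. 2 *\<^sub>R (J v - (h x *\<^sub>R v + (2 * (J x \<bullet> v)) *\<^sub>R x)))) (at x within N)"
    by (rule has_derivative_transform[OF x, rotated]) (simp add: grad_h)
  have "covariant_deriv N (grad N h) x e \<bullet> e = 2 * (J e \<bullet> e - h x)" if e: "e \<in> B" for e
  proof -
    have eT: "e \<in> tangent_space N x" using B e by (auto simp: T orthonormal_basis_of_def)
    have ee: "e \<bullet> e = 1" using orthonormal_basis_of_facts(5)[OF B e e] by simp
    have ex: "x \<bullet> e = 0" using TN_inner[OF x, of e] eT by (simp add: T inner_commute)
    have "covariant_deriv N (grad N h) x e \<bullet> e = deriv_along N (grad N h) x e \<bullet> e"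
      unfolding covariant_deriv_def by (rule tangent_proj_inner[OF _ eT]) (simp add: T subspace_TN)
    also have "\<dots> = 2 * (J e \<bullet> e - h x)"
      unfolding deriv_along_eq[OF g eT] by (simp add: inner_diff_left inner_add_left ee ex)
    finally show ?thesis .
  qed
  then have "laplacian N h x = (\<Sum>e\<in>B. 2 * (J e \<bullet> e - h x))"
    unfolding laplacian_def Let_def B_def[symmetric] by (rule sum.cong[OF refl])
  also have "\<dots> = 2 * ((\<Sum>e\<in>B. J e \<bullet> e) - real (card B) * h x)"
    by (simp add: sum_subtractf flip: sum_distrib_left)
  also have "\<dots> = - 4 * real k * h x"
    using k_pos by (simp add: dim_TN_trace[OF x B] of_nat_diff algebra_simps)
  finally show ?thesis .
qed

lemma isoparametric_h: "isoparametric N h"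
  unfolding isoparametric_def
proof (intro conjI)
  show "\<exists>j. submanifold j N" using submanifold_N by blast
  show "smooth_on N h" unfolding h_def by (intro smooth_on_intros smooth_on_linear linear_J)
  have "smooth_on (h ` N) (\<lambda>s. 4 * (1 - s\<^sup>2))" unfolding power2_eq_square by (intro smooth_on_intros)
  moreover have "continuous_on (h ` N) (\<lambda>s. - 4 * real k * s)" by (intro continuous_intros)
  ultimately show "\<exists>b a. smooth_on (h ` N) b \<and> continuous_on (h ` N) a \<and>
      (\<forall>x\<in>N. (norm (grad N h x))\<^sup>2 = b (h x) \<and> laplacian N h x = a (h x))"
    by (intro exI[of _ "\<lambda>s. 4 * (1 - s\<^sup>2)"] exI[of _ "\<lambda>s. - 4 * real k * s"])
      (simp add: norm_grad_h laplacian_h)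
qed

lemma grad_h_eq_0_iff:
  assumes "x \<in> N"
  shows "grad N h x = 0 \<longleftrightarrow> \<bar>h x\<bar> = 1"
proof -
  have "grad N h x = 0 \<longleftrightarrow> (norm (grad N h x))\<^sup>2 = 0" by simp
  also have "\<dots> \<longleftrightarrow> (h x)\<^sup>2 = 1" unfolding norm_grad_h[OF assms] by auto
  finally show ?thesis by (simp add: abs_square_eq_1)
qed

lemma Mc_0_nonempty: "Mc 0 \<noteq> {}"
proof -
  obtain w :: 'b where "w \<in> Basis" using nonempty_Basis by blast
  then have w: "norm w = 1" by simp
  obtain u v where uv: "u \<in> V w 1" "u \<noteq> 0" "v \<in> V w (-1)" "v \<noteq> 0"
    using V_ne_0[OF w] by (metis (no_types))
  define x where "x = (inverse (norm u) / sqrt 2) *\<^sub>R u + (inverse (norm v) / sqrt 2) *\<^sub>R v"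
  have J: "J ((inverse (norm u) / sqrt 2) *\<^sub>R u) = (inverse (norm u) / sqrt 2) *\<^sub>R u"
    "J ((inverse (norm v) / sqrt 2) *\<^sub>R v) = - (inverse (norm v) / sqrt 2) *\<^sub>R v"
    using uv by (simp_all add: V_def)
  have p: "pp x = (inverse (norm u) / sqrt 2) *\<^sub>R u" "pm x = (inverse (norm v) / sqrt 2) *\<^sub>R v"
    unfolding x_def by (rule pp_pm_eqI; use J in simp)+
  have "x \<in> Mc 0"
  proof (rule Mc_I[OF w])
    show "A w x = x" using uv by (simp add: x_def V_def)
    show "pp x \<bullet> pp x = (1 + 0) / 2" "pm x \<bullet> pm x = (1 - 0) / 2"
      using uv by (simp_all add: p power2_eq_square field_simps flip: power2_norm_eq_inner)
  qed
  then show ?thesis by blast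
qed

lemma regular_level_h: "regular_level N h 0"
  using Mc_0_nonempty grad_h_eq_0_iff unfolding regular_level_def Mc_def by (auto simp: level_set_def)

lemma focal_variety_h: "focal_variety N h = {x \<in> N. J x = x \<or> J x = - x}"
proof -
  have "focal_variety N h = {x \<in> N. \<bar>h x\<bar> = 1}"
    using grad_h_eq_0_iff by (auto simp: focal_variety_def level_set_def)
  then show ?thesis using h_bound(2) N_D(2) by blast
qed

text \<open>On the sphere the twisted quadratic forms all vanish iff the two Hopf images agree.\<close>

lemma Mc_0_eq_twisted: "Mc 0 = {x. norm x = 1 \<and> (\<forall>w. A w (J x) \<bullet> x = 0)}"
proof (intro equalityI subsetI)
  fix x assume "x \<in> Mc 0"
  then have x: "x \<in> N" "h x = 0" by (auto simp: Mc_iff)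
  note n = N_D[OF x(1)]
  have "A w (J x) \<bullet> x = 0" for w
    using Q_eigenvectors[OF F_J[OF n(5)] n(5)] x(2) inner_Q[of w "J x" x] by (simp add: h_def)
  then show "x \<in> {x. norm x = 1 \<and> (\<forall>w. A w (J x) \<bullet> x = 0)}" using n by simp
next
  fix x assume "x \<in> {x. norm x = 1 \<and> (\<forall>w. A w (J x) \<bullet> x = 0)}"
  then have x: "norm x = 1" "\<And>w. A w (J x) \<bullet> x = 0" by auto
  have qpm: "q (pp x) = q (pm x)"
  proof (rule q_eqI)
    fix w
    have pm: "A w (pp x) \<bullet> pm x = 0" "A w (pm x) \<bullet> pp x = 0"
      using J_sym[of "A w (pp x)" "pm x"] J_sym[of "A w (pm x)" "pp x"] by (simp_all add: J_A J_pp J_pm)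
    have "A w (pp x - pm x) \<bullet> (pp x + pm x) = 0" unfolding pp_pm by (rule x(2))
    then show "A w (pp x) \<bullet> pp x = w \<bullet> q (pm x)"
      using pm by (simp add: inner_add_right inner_diff_left inner_q)
  qed
  have nq: "norm (q (pp x)) = pp x \<bullet> pp x" "norm (q (pm x)) = pm x \<bullet> pm x"
    using norm_q_J[of "pp x" 1] norm_q_J[of "pm x" "-1"] by (simp_all add: J_pp J_pm)
  have xx: "x \<bullet> x = 1" using x(1) by (simp add: norm_eq_1)
  have eq: "pp x \<bullet> pp x = pm x \<bullet> pm x" using nq qpm by simp
  then have h0: "h x = 0" by (simp add: pp_inner_pp pm_inner_pm)
  have pm0: "A w (pp x) \<bullet> pm x = 0" for w
    using J_sym[of "A w (pp x)" "pm x"] by (simp add: J_A J_pp J_pm)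
  have "q x = 2 *\<^sub>R q (pp x)"
  proof (rule q_eqI)
    fix w
    have "A w x \<bullet> x = A w (pp x + pm x) \<bullet> (pp x + pm x)" by (simp only: pp_pm)
    also have "\<dots> = A w (pp x) \<bullet> pp x + A w (pm x) \<bullet> pm x"
      using pm0[of w] A_sym[of w "pm x" "pp x"] by (simp add: inner_add_left inner_add_right inner_commute)
    finally show "A w x \<bullet> x = w \<bullet> (2 *\<^sub>R q (pp x))" using qpm by (simp flip: inner_q)
  qed
  then have "norm (q x) = 1" using nq h0 xx by (simp add: pp_inner_pp)
  then show "x \<in> Mc 0" using x h0 by (simp add: Mc_iff N_def)
qed

end

section \<open>Condition A\<close>

lemma tangent_sphere:
  fixes x :: "'a::euclidean_space"
  assumes "norm x = 1"
  shows "tangent_space (sphere 0 1) x = {v. v \<bullet> x = 0}"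
proof (intro equalityI subsetI)
  fix v assume v: "v \<in> tangent_space (sphere 0 1) x"
  have d: "((\<lambda>y. y \<bullet> y) has_derivative (\<lambda>v. x \<bullet> v + v \<bullet> x)) (at x)"
    by (auto intro!: derivative_eq_intros)
  have "x \<bullet> v + v \<bullet> x = 0" by (rule tangent_space_const[OF d _ v, of 1]) (simp add: norm_eq_1)
  then show "v \<in> {v. v \<bullet> x = 0}" by (simp add: inner_commute)
next
  fix v assume "v \<in> {v. v \<bullet> x = 0}"
  then have v: "(t *\<^sub>R v) \<bullet> x = 0" for t by simp
  have x: "x \<noteq> 0" "x \<bullet> x = 1" using assms by (auto simp: norm_eq_1)
  show "v \<in> tangent_space (sphere 0 1) x"
  proof (rule tangent_spaceI[of 1 "\<lambda>t. central x (t *\<^sub>R v)"])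
    show "smooth_on {- 1<..<1::real} (\<lambda>t. central x (t *\<^sub>R v))"
      by (intro smooth_on_central x smooth_on_intros)
    show "(\<lambda>t. central x (t *\<^sub>R v)) ` {- 1<..<1::real} \<subseteq> sphere 0 1"
      using central_facts(1)[OF x(1) v] x by (auto simp: norm_eq_1)
    show "((\<lambda>t. central x (t *\<^sub>R v)) has_vector_derivative v) (at 0)"
      by (rule central_has_vector_derivative[OF x(1)])
  qed (simp_all add: central_0 x)
qed

context clifford_pair begin

definition NN :: "'a \<Rightarrow> 'a set" where
  "NN x = {\<eta>. A (q x) \<eta> = - \<eta> \<and> (\<forall>z. z \<bullet> q x = 0 \<longrightarrow> \<eta> \<bullet> A z x = 0)}"

lemma NN_orthogonal_F: "\<eta> \<in> NN x \<Longrightarrow> A (q x) e = e \<Longrightarrow> e \<bullet> \<eta> = 0"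
  by (rule A_inner_opposite) (auto simp: NN_def)

lemma normal_sphere_N:
  assumes x: "x \<in> N"
  shows "normal_space (sphere 0 1) N x = NN x"
proof (intro equalityI subsetI)
  note n = N_D[OF x]
  fix \<eta> assume "\<eta> \<in> normal_space (sphere 0 1) N x"
  then have \<eta>: "\<eta> \<bullet> x = 0" "\<And>v. v \<in> TN x \<Longrightarrow> \<eta> \<bullet> v = 0"
    by (auto simp: normal_space_def tangent_sphere[OF n(1)] tangent_N[OF x])
  have z: "\<eta> \<bullet> A z x = 0" if "z \<bullet> q x = 0" for z
    using \<eta>(2)[OF TN_I[of x 0 z]] that by simp
  have e: "\<eta> \<bullet> e = 0" if "A (q x) e = e" for e
  proof -
    have "e - (e \<bullet> x) *\<^sub>R x + A 0 x \<in> TN x"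
      by (rule TN_I) (use that n in \<open>simp_all add: inner_diff_left\<close>)
    from \<eta>(2)[OF this] show ?thesis using \<eta>(1) by (simp add: inner_diff_right)
  qed
  have "A (q x) (\<eta> + A (q x) \<eta>) = \<eta> + A (q x) \<eta>" using n by (simp add: A_A add.commute)
  from e[OF this] have "(\<eta> + A (q x) \<eta>) \<bullet> (\<eta> + A (q x) \<eta>) = 0"
    using n by (simp add: inner_add_left inner_add_right A_inner_A inner_commute)
  then have "A (q x) \<eta> = - \<eta>" by (simp add: eq_neg_iff_add_eq_0 add.commute)
  then show "\<eta> \<in> NN x" using z by (simp add: NN_def)
next
  note n = N_D[OF x]
  fix \<eta> assume \<eta>: "\<eta> \<in> NN x"
  have "\<eta> \<bullet> v = 0" if "v \<in> TN x" for v
    using that NN_orthogonal_F[OF \<eta>] \<eta> by (auto simp: inner_add_right NN_def inner_commute elim!: TN_E)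
  then show "\<eta> \<in> normal_space (sphere 0 1) N x"
    using NN_orthogonal_F[OF \<eta> n(5)]
    by (simp add: normal_space_def tangent_sphere[OF n(1)] tangent_N[OF x] inner_commute)
qed

definition proj_NN :: "'a \<Rightarrow> 'a \<Rightarrow> 'a" where
  "proj_NN y \<xi> = (1/2) *\<^sub>R (\<xi> - A (q y) \<xi>) - A (Q y \<xi>) y + (Q y \<xi> \<bullet> q y) *\<^sub>R y"

lemma proj_NN_facts:
  assumes y: "y \<in> N"
  shows "proj_NN y \<xi> \<in> NN y" "\<xi> \<in> NN y \<Longrightarrow> proj_NN y \<xi> = \<xi>"
proof -
  note n = N_D[OF y]
  define r where "r = Q y \<xi> - (Q y \<xi> \<bullet> q y) *\<^sub>R q y"
  have r: "r \<bullet> q y = 0" using n by (simp add: r_def inner_diff_left)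
  have p: "proj_NN y \<xi> = (1/2) *\<^sub>R (\<xi> - A (q y) \<xi>) - A r y"
    using n by (simp add: proj_NN_def r_def)
  have "A (q y) (proj_NN y \<xi>) = - proj_NN y \<xi>"
    using n anticommute_orthogonal[OF r, of y] by (simp add: p A_A algebra_simps)
  moreover have "proj_NN y \<xi> \<bullet> A z y = 0" if z: "z \<bullet> q y = 0" for z
  proof -
    have "A (q y) \<xi> \<bullet> A z y = - (\<xi> \<bullet> A z y)"
      using anticommute_orthogonal[OF z, of y] n by (simp add: A_sym)
    moreover have "r \<bullet> z = \<xi> \<bullet> A z y"
      using z by (simp add: r_def inner_diff_left Q_inner inner_commute[of "q y" z] inner_commute[of \<xi>])
    ultimately show ?thesis using n by (simp add: p inner_diff_left A_inner_A)
  qed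
  ultimately show "proj_NN y \<xi> \<in> NN y" by (simp add: NN_def)
  assume \<xi>: "\<xi> \<in> NN y"
  then have "\<xi> \<bullet> A r y = 0" using r by (simp add: NN_def)
  then have "r \<bullet> Q y \<xi> = 0" by (simp add: inner_Q inner_commute)
  then have "r \<bullet> r = 0" using r by (subst (2) r_def) (simp add: inner_diff_right)
  then have "r = 0" by simp
  then show "proj_NN y \<xi> = \<xi>" using \<xi> by (simp add: p NN_def flip: scaleR_2)
qed

lemma shape_sphere_N:
  assumes x: "x \<in> N" and \<eta>: "\<eta> \<in> NN x" and e: "A (q x) e = e" "e \<bullet> x = 0" and z: "z \<bullet> q x = 0"
  defines "v \<equiv> e + A z x"
  shows "shape_op (sphere 0 1) N x \<eta> v = A z \<eta> + A (Q v \<eta> - (Q v \<eta> \<bullet> q x) *\<^sub>R q x) x"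
proof -
  note n = N_D[OF x]
  have \<eta>w: "A (q x) \<eta> = - \<eta>" using \<eta> by (simp add: NN_def)
  have v: "v \<in> tangent_space N x" unfolding tangent_N[OF x] v_def by (rule TN_I[OF e z])
  have "Q x \<eta> = 0"
  proof (rule Q_eqI)
    fix y
    define y' where "y' = y - (y \<bullet> q x) *\<^sub>R q x"
    have "y' \<bullet> q x = 0" using n by (simp add: y'_def inner_diff_left)
    then have "\<eta> \<bullet> A y' x = 0" using \<eta> by (simp add: NN_def)
    then show "A y x \<bullet> \<eta> = y \<bullet> 0" using n NN_orthogonal_F[OF \<eta> n(5)]
      by (simp add: y'_def inner_diff_right inner_commute)
  qed
  note Q0 = this
  have "Q x (A z x) = z" by (rule Q_eqI) (simp add: A_inner_A n)
  then have Qv: "Q x v = z"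
    using Q_eigenvectors[OF n(5) e(1)] e(2) bilinear_Q by (simp add: v_def bilinear_radd inner_commute)
  define r where "r = Q v \<eta> - (Q v \<eta> \<bullet> q x) *\<^sub>R q x"
  have r: "r \<bullet> q x = 0" using n by (simp add: r_def inner_diff_left)
  define D where "D u = (1/2) *\<^sub>R (0 - (A (q x) 0 + A (2 *\<^sub>R Q x u) \<eta>)) - (A (Q x \<eta>) u + A (Q u \<eta>) x)
    + ((Q x \<eta> \<bullet> q x) *\<^sub>R u + (Q x \<eta> \<bullet> (2 *\<^sub>R Q x u) + Q u \<eta> \<bullet> q x) *\<^sub>R x)" for u
  have dQ: "((\<lambda>y. Q y \<eta>) has_derivative (\<lambda>u. Q u \<eta>)) (at x within N)"
    using bilinear_Q by (intro linear_imp_has_derivative) (simp add: bilinear_def)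
  have dA: "((\<lambda>y. A (q y) \<eta>) has_derivative (\<lambda>u. A (q x) 0 + A (2 *\<^sub>R Q x u) \<eta>)) (at x within N)"
    by (rule bounded_bilinear.FDERIV[OF bounded_bilinear_A q_has_derivative has_derivative_const])
  have dAQ: "((\<lambda>y. A (Q y \<eta>) y) has_derivative (\<lambda>u. A (Q x \<eta>) u + A (Q u \<eta>) x)) (at x within N)"
    by (rule bounded_bilinear.FDERIV[OF bounded_bilinear_A dQ has_derivative_ident])
  have D: "((\<lambda>y. proj_NN y \<eta>) has_derivative D) (at x within N)"
    unfolding proj_NN_def D_def
    by (intro has_derivative_add has_derivative_diff has_derivative_scaleR_right has_derivative_scaleR
        has_derivative_inner has_derivative_const has_derivative_ident q_has_derivative dA dAQ dQ)
  have "shape_op (sphere 0 1) N x \<eta> v = - tangent_proj N x (D v)"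
  proof (rule shape_op_eq[OF x, where Z = proj_NN])
    show "linear (proj_NN y)" for y
      using bilinear_Q by (auto intro!: linearI simp: proj_NN_def bilinear_radd bilinear_rmul inner_add_left algebra_simps)
    show "smooth_on N (\<lambda>y. proj_NN y \<xi>)" for \<xi>
      unfolding proj_NN_def by (intro smooth_intros)
  qed (use proj_NN_facts \<eta> v D in \<open>simp_all add: normal_sphere_N x\<close>)
  moreover have "D v = - (A z \<eta> + A r x)"
    using n by (simp add: D_def Q0 Qv r_def)
  moreover have "A z \<eta> + A r x \<in> TN x"
    by (rule TN_I[OF _ _ r]) (use \<eta> z \<eta>w in \<open>simp_all add: anticommute_orthogonal NN_def A_sym\<close>)
  then have "- (A z \<eta> + A r x) \<in> tangent_space N x"
    unfolding tangent_N[OF x] by (rule subspace_neg[OF subspace_TN])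
  then have "tangent_proj N x (- (A z \<eta> + A r x)) = - (A z \<eta> + A r x)"
    by (intro tangent_proj_eq) (simp_all add: tangent_N[OF x] subspace_TN)
  ultimately show ?thesis by (simp add: r_def)
qed

definition K :: "'a \<Rightarrow> 'a \<Rightarrow> 'a set" where
  "K x \<eta> = {e \<in> F (q x). e \<bullet> x = 0 \<and> (\<forall>z. z \<bullet> q x = 0 \<longrightarrow> A z e \<bullet> \<eta> = 0)}"

lemma kernel_shape_sphere_N:
  assumes x: "x \<in> N" and \<eta>: "\<eta> \<in> NN x" "\<eta> \<noteq> 0"
  shows "{v \<in> tangent_space N x. shape_op (sphere 0 1) N x \<eta> v = 0} = K x \<eta>"
proof -
  note n = N_D[OF x]
  have \<eta>w: "A (q x) \<eta> = - \<eta>" using \<eta> by (simp add: NN_def)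
  have x0: "x \<noteq> 0" using n by auto
  have eq: "shape_op (sphere 0 1) N x \<eta> (e + A z x) = 0 \<longleftrightarrow> z = 0 \<and> (\<forall>y. y \<bullet> q x = 0 \<longrightarrow> A y e \<bullet> \<eta> = 0)"
    if e: "A (q x) e = e" "e \<bullet> x = 0" and z: "z \<bullet> q x = 0" for e z
  proof -
    define r where "r = Q (e + A z x) \<eta> - (Q (e + A z x) \<eta> \<bullet> q x) *\<^sub>R q x"
    have r: "r \<bullet> q x = 0" using n by (simp add: r_def inner_diff_left)
    have Az: "A (q x) (A z \<eta>) = A z \<eta>" using z \<eta>w by (simp add: anticommute_orthogonal)
    have o: "A z \<eta> \<bullet> A r x = 0"
      using inner_A_F[OF n(5) Az r] by (simp add: inner_commute)
    have "shape_op (sphere 0 1) N x \<eta> (e + A z x) = A z \<eta> + A r x + 0"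
      using shape_sphere_N[OF x \<eta>(1) e z] by (simp add: r_def)
    then have "shape_op (sphere 0 1) N x \<eta> (e + A z x) = 0 \<longleftrightarrow> A z \<eta> = 0 \<and> A r x = 0"
      using orthogonal_sum_eq_0[of "A z \<eta>" "A r x" 0] o by simp
    also have "\<dots> \<longleftrightarrow> z = 0 \<and> r = 0" using \<eta>(2) x0 by (simp add: A_eq_0_iff)
    also have "\<dots> \<longleftrightarrow> z = 0 \<and> (\<forall>y. y \<bullet> q x = 0 \<longrightarrow> A y e \<bullet> \<eta> = 0)"
    proof (rule conj_cong[OF refl])
      assume z0: "z = 0"
      have yr: "y \<bullet> r = A y e \<bullet> \<eta>" if "y \<bullet> q x = 0" for y
        using that z0 by (simp add: r_def inner_diff_right inner_Q)
      show "r = 0 \<longleftrightarrow> (\<forall>y. y \<bullet> q x = 0 \<longrightarrow> A y e \<bullet> \<eta> = 0)"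
        using yr r yr[OF r] by (metis inner_eq_zero_iff inner_zero_right)
    qed
    finally show ?thesis .
  qed
  show ?thesis
  proof (intro equalityI subsetI)
    fix v assume v: "v \<in> {v \<in> tangent_space N x. shape_op (sphere 0 1) N x \<eta> v = 0}"
    then obtain e z where ez: "v = e + A z x" "A (q x) e = e" "e \<bullet> x = 0" "z \<bullet> q x = 0"
      by (auto simp: tangent_N[OF x] elim: TN_E)
    then show "v \<in> K x \<eta>" using v eq[OF ez(2-4)] by (simp add: K_def F_def)
  next
    fix v assume v: "v \<in> K x \<eta>"
    then have "A (q x) v = v" "v \<bullet> x = 0" by (auto simp: K_def F_def)
    then show "v \<in> {v \<in> tangent_space N x. shape_op (sphere 0 1) N x \<eta> v = 0}"
      using eq[of v 0] TN_I[of x v 0] v by (simp add: tangent_N[OF x] K_def)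
  qed
qed

lemma condition_A_iff:
  assumes x: "x \<in> N"
  shows "condition_A (sphere 0 1) N x \<longleftrightarrow> (\<forall>\<eta>\<in>NN x. \<forall>\<xi>\<in>NN x. \<eta> \<noteq> 0 \<longrightarrow> \<xi> \<noteq> 0 \<longrightarrow> K x \<eta> = K x \<xi>)"
proof -
  have Ks: "K x (c *\<^sub>R \<eta>) = K x \<eta>" if "c \<noteq> 0" for c \<eta> using that by (simp add: K_def)
  have Ns: "c *\<^sub>R \<eta> \<in> NN x" if "\<eta> \<in> NN x" for c \<eta> using that by (simp add: NN_def)
  have ker: "{v \<in> tangent_space N x. shape_op (sphere 0 1) N x \<eta> v = 0} = K x \<eta>" if "\<eta> \<in> NN x" "norm \<eta> = 1" for \<eta>
  proof -
    have "\<eta> \<noteq> 0" using that(2) by auto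
    then show ?thesis by (rule kernel_shape_sphere_N[OF x that(1)])
  qed
  show ?thesis
  proof
    assume c: "condition_A (sphere 0 1) N x"
    show "\<forall>\<eta>\<in>NN x. \<forall>\<xi>\<in>NN x. \<eta> \<noteq> 0 \<longrightarrow> \<xi> \<noteq> 0 \<longrightarrow> K x \<eta> = K x \<xi>"
    proof (intro ballI impI)
      fix \<eta> \<xi> assume *: "\<eta> \<in> NN x" "\<xi> \<in> NN x" "\<eta> \<noteq> 0" "\<xi> \<noteq> 0"
      let ?\<eta> = "inverse (norm \<eta>) *\<^sub>R \<eta>" and ?\<xi> = "inverse (norm \<xi>) *\<^sub>R \<xi>"
      have u: "?\<eta> \<in> NN x" "?\<xi> \<in> NN x" "norm ?\<eta> = 1" "norm ?\<xi> = 1" using * Ns by auto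
      then have "K x ?\<eta> = K x ?\<xi>"
        using c ker[OF u(1,3)] ker[OF u(2,4)] unfolding condition_A_def normal_sphere_N[OF x] by blast
      then show "K x \<eta> = K x \<xi>" using * Ks[of "inverse (norm \<eta>)"] Ks[of "inverse (norm \<xi>)"] by simp
    qed
  next
    assume *: "\<forall>\<eta>\<in>NN x. \<forall>\<xi>\<in>NN x. \<eta> \<noteq> 0 \<longrightarrow> \<xi> \<noteq> 0 \<longrightarrow> K x \<eta> = K x \<xi>"
    show "condition_A (sphere 0 1) N x"
      unfolding condition_A_def normal_sphere_N[OF x]
    proof (intro ballI impI)
      fix \<eta> \<xi> assume u: "\<eta> \<in> NN x" "\<xi> \<in> NN x" "norm \<eta> = 1" "norm \<xi> = 1"
      then have "\<eta> \<noteq> 0" "\<xi> \<noteq> 0" by auto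
      with * u have "K x \<eta> = K x \<xi>" by blast
      then show "{v \<in> tangent_space N x. shape_op (sphere 0 1) N x \<eta> v = 0} =
          {v \<in> tangent_space N x. shape_op (sphere 0 1) N x \<xi> v = 0}"
        using ker u by simp
    qed
  qed
qed

lemma condition_A_at_poles:
  assumes x: "x \<in> N" and t: "J x = t *\<^sub>R x" "t = 1 \<or> t = -1"
  shows "condition_A (sphere 0 1) N x"
proof -
  note n = N_D[OF x]
  define w where "w = q x"
  have w: "norm w = 1" "A w x = x" "x \<noteq> 0" using n by (auto simp: w_def)
  have t': "- t = 1 \<or> - t = -1" using t by auto
  have xV: "x \<in> V w t" using w t by (simp add: V_def)
  have "K x \<eta> = {e \<in> F w. e \<bullet> x = 0 \<and> (\<forall>f\<in>V w (- t). e \<bullet> f = 0)}" if \<eta>: "\<eta> \<in> NN x" "\<eta> \<noteq> 0" for \<eta>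
  proof -
    have \<eta>w: "A w \<eta> = - \<eta>" using \<eta> by (simp add: NN_def w_def)
    have "\<eta> + t *\<^sub>R J \<eta> \<in> V (- w) t"
      using \<eta>w t(2) by (auto simp: V_def F_J simp flip: J_A)
    then obtain z where z: "\<eta> + t *\<^sub>R J \<eta> = A z x" "z \<bullet> w = 0"
      using V_uminus_eq_A_image[OF w(1) t(2) xV w(3)] by (auto simp: W_def)
    then have o: "\<eta> \<bullet> (\<eta> + t *\<^sub>R J \<eta>) = 0" using \<eta> by (simp add: NN_def w_def)
    have "(\<eta> + t *\<^sub>R J \<eta>) \<bullet> (\<eta> + t *\<^sub>R J \<eta>) = 2 * (\<eta> \<bullet> (\<eta> + t *\<^sub>R J \<eta>))"
      using t(2) by (auto simp: inner_add_left inner_add_right inner_diff_left inner_diff_right J_inner_J inner_commute)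
    then have "\<eta> + t *\<^sub>R J \<eta> = 0" using o by simp
    then have "t *\<^sub>R (\<eta> + t *\<^sub>R J \<eta>) = 0" by simp
    then have "t *\<^sub>R \<eta> + J \<eta> = 0" using t(2) by (auto simp: scaleR_right_distrib)
    then have "J \<eta> = - t *\<^sub>R \<eta>" by (simp add: eq_neg_iff_add_eq_0 add.commute)
    then have "\<eta> \<in> V (- w) (- t)" using \<eta>w by (simp add: V_def)
    from V_uminus_eq_A_image[OF _ t' this \<eta>(2)]
    have "V w (- t) = (\<lambda>z. A z \<eta>) ` W w" using w by (simp add: W_def)
    then show ?thesis by (auto simp: K_def w_def W_def A_sym)
  qed
  then show ?thesis unfolding condition_A_iff[OF x] by simp
qed

end

section \<open>Products over orthonormal bases\<close>

definition orthonormal_list :: "'b::euclidean_space list \<Rightarrow> bool" where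
  "orthonormal_list ys \<longleftrightarrow> distinct ys \<and> pairwise orthogonal (set ys) \<and> (\<forall>y\<in>set ys. norm y = 1)"

lemma orthonormal_list_Nil [simp]: "orthonormal_list []"
  by (simp add: orthonormal_list_def)

lemma orthonormal_list_Cons [simp]: "orthonormal_list (y # ys) \<longleftrightarrow> norm y = 1 \<and> (\<forall>a\<in>set ys. a \<bullet> y = 0) \<and> orthonormal_list ys"
  by (auto simp: orthonormal_list_def pairwise_insert orthogonal_def inner_commute)
    (metis inner_eq_zero_iff norm_zero zero_neq_one)+

lemma orthonormal_list_extend:
  fixes ys :: "'b::euclidean_space list"
  assumes "length ys < DIM('b)" "orthonormal_list ys"
  obtains y where "orthonormal_list (y # ys)"
proof -
  have "dim (set ys) \<le> card (set ys)" by (rule dim_le_card') simp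
  also have "\<dots> \<le> length ys" by (rule card_length)
  finally have "dim (set ys) < DIM('b)" using assms(1) by simp
  then obtain y where y: "y \<noteq> 0" "\<And>a. a \<in> span (set ys) \<Longrightarrow> orthogonal y a"
    by (rule orthogonal_to_subspace_exists) blast
  have "orthonormal_list ((inverse (norm y) *\<^sub>R y) # ys)"
    using y assms(2) by (auto simp: orthogonal_def inner_commute span_base)
  then show thesis by (rule that)
qed

lemma span_onl:
  fixes ys :: "'b::euclidean_space list"
  assumes "orthonormal_list ys" "length ys = DIM('b)"
  shows "span (set ys) = UNIV"
proof -
  have "independent (set ys)"
    by (rule pairwise_orthogonal_independent) (use assms in \<open>force simp: orthonormal_list_def\<close>)+
  then have "dim (set ys) = card (set ys)" by (rule dim_eq_card_independent)
  also have "\<dots> = DIM('b)" using assms by (simp add: orthonormal_list_def distinct_card)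
  finally show ?thesis by (simp add: dim_eq_full)
qed

lemma orthonormal_list_map:
  assumes "orthonormal_list ys" "\<And>a b. f a \<bullet> f b = a \<bullet> b"
  shows "orthonormal_list (map f ys)"
  using assms(1) by (induction ys) (auto simp: assms(2) norm_eq_sqrt_inner)

definition reflect :: "'b::real_inner \<Rightarrow> 'b \<Rightarrow> 'b" where "reflect r y = y - (2 * (y \<bullet> r)) *\<^sub>R r"

lemma reflect_inner:
  assumes "norm r = 1"
  shows "reflect r a \<bullet> reflect r b = a \<bullet> b"
proof -
  have "r \<bullet> r = 1" using assms by (simp add: norm_eq_1)
  then show ?thesis
    by (simp add: reflect_def inner_diff_left inner_diff_right inner_commute)
qed

lemma reflect_exchange:
  fixes a b :: "'b::real_inner"
  assumes "norm a = 1" "norm b = 1" "a \<noteq> b"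
  defines "r \<equiv> inverse (norm (a - b)) *\<^sub>R (a - b)"
  shows "norm r = 1" "reflect r a = b" "\<And>c. c \<bullet> a = 0 \<Longrightarrow> c \<bullet> b = 0 \<Longrightarrow> reflect r c = c"
proof -
  define n where "n = norm (a - b)"
  have n: "0 < n" using assms by (simp add: n_def)
  then show "norm r = 1" by (simp add: r_def n_def)
  have r: "r = inverse n *\<^sub>R (a - b)" by (simp add: r_def n_def)
  have "n * n = (a - b) \<bullet> (a - b)" by (simp add: n_def flip: power2_norm_eq_inner power2_eq_square)
  also have "\<dots> = 2 * (a \<bullet> (a - b))"
    using assms by (simp add: inner_diff_left inner_diff_right norm_eq_1 inner_commute)
  finally have nn: "n * n = 2 * (a \<bullet> (a - b))" .
  have "2 * (a \<bullet> r) * inverse n = inverse n * inverse n * (2 * (a \<bullet> (a - b)))" by (simp add: r)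
  also have "\<dots> = 1" unfolding nn[symmetric] using n by (simp add: field_simps)
  finally have "2 * (a \<bullet> r) * inverse n = 1" .
  then have "(2 * (a \<bullet> r)) *\<^sub>R r = a - b" by (simp add: r)
  then show "reflect r a = b" by (simp add: reflect_def)
  show "reflect r c = c" if "c \<bullet> a = 0" "c \<bullet> b = 0" for c
    using that by (simp add: reflect_def r inner_diff_right)
qed

context clifford_action begin

lemma linear_foldr_A: "linear (foldr A ys)"
proof (induction ys)
  case (Cons y ys)
  have "foldr A (y # ys) = A y \<circ> foldr A ys" by (simp add: fun_eq_iff)
  then show ?case using linear_compose[OF Cons linear_A] by (simp only:)
qed (simp add: linear_iff)

lemmas foldr_A_scaleR = linear_scale[OF linear_foldr_A]

lemma A_foldr_orthogonal:
  "(\<And>y. y \<in> set ys \<Longrightarrow> y \<bullet> z = 0) \<Longrightarrow> A z (foldr A ys x) = (-1) ^ length ys *\<^sub>R foldr A ys (A z x)"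
  by (induction ys) (simp_all add: anticommute_orthogonal)

lemma A_foldr_member:
  "orthonormal_list ys \<Longrightarrow> z \<in> set ys \<Longrightarrow> A z (foldr A ys x) = (-1) ^ Suc (length ys) *\<^sub>R foldr A ys (A z x)"
proof (induction ys)
  case (Cons y ys)
  show ?case
  proof (cases "z = y")
    case True
    then show ?thesis using A_foldr_orthogonal[of ys y x] Cons.prems by simp
  next
    case False
    then have "z \<in> set ys" "y \<bullet> z = 0" using Cons.prems by (auto simp: inner_commute)
    then show ?thesis using Cons by (simp add: anticommute_orthogonal)
  qed
qed simp

lemma A_foldr_basis:
  assumes "orthonormal_list ys" "length ys = DIM('b)" "odd (DIM('b))"
  shows "A z (foldr A ys x) = foldr A ys (A z x)"
proof -
  have "subspace {z. A z (foldr A ys x) = foldr A ys (A z x)}"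
    by (auto simp: subspace_def linear_add[OF linear_foldr_A] foldr_A_scaleR linear_0[OF linear_foldr_A])
  moreover have "set ys \<subseteq> {z. A z (foldr A ys x) = foldr A ys (A z x)}"
    using A_foldr_member[OF assms(1)] assms(2,3) by auto
  ultimately have "span (set ys) \<subseteq> {z. A z (foldr A ys x) = foldr A ys (A z x)}"
    by (intro span_minimal)
  then show ?thesis using span_onl[OF assms(1,2)] by auto
qed

lemma A_reflect: "norm r = 1 \<Longrightarrow> A (reflect r y) x = - A r (A y (A r x))"
  using anticommute[of r y "A r x"]
  by (simp add: reflect_def A_A norm_eq_1 inner_commute algebra_simps eq_neg_iff_add_eq_0)

lemma foldr_reflect:
  assumes "norm r = 1"
  shows "foldr A (map (reflect r) ys) x = (-1) ^ length ys *\<^sub>R A r (foldr A ys (A r x))"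
proof (induction ys)
  case Nil
  then show ?case using assms by (simp add: A_A norm_eq_1)
next
  case (Cons y ys)
  have "r \<bullet> r = 1" using assms by (simp add: norm_eq_1)
  then show ?case using Cons by (simp add: A_reflect[OF assms] A_A)
qed

text \<open>A reflection changes the product of an orthonormal basis of odd length only by a sign, and
  reflections carry any orthonormal basis to any other.\<close>

lemma foldr_basis_unique:
  assumes "orthonormal_list ys" "length ys = DIM('b)" "orthonormal_list zs" "length zs = DIM('b)" "odd (DIM('b))"
  shows "\<exists>\<delta>::real. (\<delta> = 1 \<or> \<delta> = -1) \<and> (\<forall>x. foldr A ys x = \<delta> *\<^sub>R foldr A zs x)"
proof -
  have "\<exists>\<delta>::real. (\<delta> = 1 \<or> \<delta> = -1) \<and> (\<forall>x. foldr A ys x = \<delta> *\<^sub>R foldr A zs x)"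
    if "orthonormal_list ys" "length ys = DIM('b)" "take (DIM('b) - j) ys = take (DIM('b) - j) zs" for j ys
    using that
  proof (induction j arbitrary: ys)
    case 0
    then have "ys = zs" using assms by simp
    then show ?case by (intro exI[of _ 1]) simp
  next
    case (Suc j)
    show ?case
    proof (cases "Suc j \<le> DIM('b)")
      case False
      then show ?thesis using Suc by simp
    next
      case True
      define m where "m = DIM('b) - Suc j"
      have m: "m < DIM('b)" "DIM('b) - j = Suc m" using True by (auto simp: m_def)
      have tk: "take m ys = take m zs" using Suc.prems(3) by (simp add: m_def)
      define a where "a = ys ! m"
      define b where "b = zs ! m"
      show ?thesis
      proof (cases "a = b")
        case True
        then have "take (Suc m) ys = take (Suc m) zs"
          using tk m Suc.prems(2) assms(4) by (simp add: take_Suc_conv_app_nth a_def b_def)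
        then show ?thesis using Suc.IH[OF Suc.prems(1,2)] m by simp
      next
        case False
        have nab: "norm a = 1" "norm b = 1"
          using Suc.prems(1,2) assms(3,4) m by (auto simp: orthonormal_list_def a_def b_def)
        define r where "r = inverse (norm (a - b)) *\<^sub>R (a - b)"
        note r = reflect_exchange[OF nab False, folded r_def]
        have fixd: "reflect r c = c" if cm: "c \<in> set (take m ys)" for c
        proof (rule r(3))
          obtain i where i': "i < length (take m ys)" "c = take m ys ! i"
            using cm by (metis in_set_conv_nth)
          then have "i < m" by simp
          then have i: "i < m" "c = ys ! i" "c = zs ! i"
            using i'(2) i'(2)[unfolded tk] by simp_all
          have "ys ! i \<noteq> ys ! m" "zs ! i \<noteq> zs ! m"
            using i m Suc.prems(1,2) assms(3,4) by (auto simp: orthonormal_list_def nth_eq_iff_index_eq)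
          moreover have "ys ! i \<in> set ys" "ys ! m \<in> set ys" "zs ! i \<in> set zs" "zs ! m \<in> set zs"
            using i(1) m Suc.prems(2) assms(4) by (simp_all only: nth_mem)
          ultimately have "ys ! i \<bullet> a = 0" "zs ! i \<bullet> b = 0"
            using Suc.prems(1) assms(3) unfolding orthonormal_list_def a_def b_def pairwise_def orthogonal_def by blast+
          then show "c \<bullet> a = 0" "c \<bullet> b = 0" using i(2,3) by simp_all
        qed
        let ?ys = "map (reflect r) ys"
        have "take (Suc m) ?ys = map (reflect r) (take m ys) @ [reflect r a]"
          using m Suc.prems(2) by (simp add: take_Suc_conv_app_nth take_map a_def)
        also have "map (reflect r) (take m ys) = take m zs"
          using fixd tk by (metis map_idI)
        also have "take m zs @ [reflect r a] = take (Suc m) zs"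
          using m assms(4) r(2) by (simp add: take_Suc_conv_app_nth b_def)
        finally have "take (DIM('b) - j) ?ys = take (DIM('b) - j) zs" by (simp add: m)
        moreover have "orthonormal_list ?ys" by (rule orthonormal_list_map[OF Suc.prems(1) reflect_inner[OF r(1)]])
        ultimately obtain \<delta> :: real where \<delta>: "\<delta> = 1 \<or> \<delta> = -1" "\<And>x. foldr A ?ys x = \<delta> *\<^sub>R foldr A zs x"
          using Suc.IH[of ?ys] Suc.prems(2) by auto
        have "r \<bullet> r = 1" using r(1) by (simp add: norm_eq_1)
        then have neg: "foldr A ?ys x = - foldr A ys x" for x
          using foldr_reflect[OF r(1)] A_foldr_basis[OF Suc.prems(1,2) assms(5), of r "A r x"] Suc.prems(2) assms(5)
          by (simp add: A_A)
        then have "foldr A ys x = (- \<delta>) *\<^sub>R foldr A zs x" for x using \<delta>(2)[of x] neg[of x] by (metis minus_minus scaleR_minus_left)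
        then show ?thesis using \<delta>(1) by (intro exI[of _ "- \<delta>"]) auto
      qed
    qed
  qed
  from this[OF assms(1,2), of "DIM('b)"] show ?thesis by simp
qed

lemma foldr_inner: "foldr A ys x \<bullet> y = x \<bullet> foldr A (rev ys) y"
  by (induction ys arbitrary: x y) (simp_all add: A_sym)

lemma foldr_rev: "orthonormal_list ys \<Longrightarrow> foldr A (rev ys) x = (\<Prod>i<length ys. (-1) ^ i) *\<^sub>R foldr A ys x"
proof (induction ys arbitrary: x)
  case (Cons y ys)
  have "A y (foldr A ys x) = (-1) ^ length ys *\<^sub>R foldr A ys (A y x)"
    using Cons.prems by (intro A_foldr_orthogonal) auto
  then have "foldr A ys (A y x) = (-1) ^ length ys *\<^sub>R A y (foldr A ys x)"
    by (simp flip: power_mult_distrib)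
  then show ?case using Cons by simp
qed simp

lemma foldr_foldr_rev: "orthonormal_list ys \<Longrightarrow> foldr A ys (foldr A (rev ys) x) = x"
  by (induction ys arbitrary: x) (simp_all add: A_A norm_eq_1)

lemma foldr_twisted:
  assumes "\<And>x. J (J x) = x" "\<And>w x. J (A w x) = A w (J x)"
  shows "foldr (\<lambda>w x. A w (J x)) ys x = (if even (length ys) then foldr A ys x else J (foldr A ys x))"
  by (induction ys) (simp_all add: assms)

end

context clifford_pair begin

lemma J_opposite: "J a = a \<Longrightarrow> J b = - b \<Longrightarrow> a \<bullet> b = 0"
  using J_sym[of a b] by simp

lemma condition_A_four_products:
  assumes x: "x \<in> N" and c: "condition_A (sphere 0 1) N x" and ne: "pp x \<noteq> 0" "pm x \<noteq> 0"
    and o: "orthonormal_list [y1, y2, q x]" and a: "a \<bullet> q x = 0" "a \<noteq> 0" and b: "b \<bullet> q x = 0"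
  shows "(A a (A b (A y1 (A y2 (pp x)))) \<bullet> pp x) * (pm x \<bullet> pm x) = (A a (A b (A y1 (A y2 (pm x)))) \<bullet> pm x) * (pp x \<bullet> pp x)"
proof -
  note n = N_D[OF x]
  define u where "u = pp x"
  define v where "v = pm x"
  have uv: "J u = u" "J v = - v" "u \<bullet> u \<noteq> 0" "v \<bullet> v \<noteq> 0" "x = u + v" "A (q x) u = u" "A (q x) v = v"
    using ne A_pp[OF n(5)] A_pm[OF n(5)] by (simp_all add: u_def v_def J_pp J_pm pp_pm)
  define \<eta> where "\<eta> z = inverse (u \<bullet> u) *\<^sub>R A z u - inverse (v \<bullet> v) *\<^sub>R A z v" for z
  have cross: "A z u \<bullet> A z' v = 0" "A z v \<bullet> A z' u = 0" for z z'
    using J_opposite[of "A z u" "A z' v"] J_opposite[of "A z' u" "A z v"] uv by (simp_all add: J_A inner_commute)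
  have \<eta>NN: "\<eta> z \<in> NN x" if "z \<bullet> q x = 0" for z
  proof -
    have "A (q x) (\<eta> z) = - \<eta> z"
      using that uv by (simp add: \<eta>_def anticommute_orthogonal)
    moreover have "\<eta> z \<bullet> A z' x = 0" for z'
      using uv(3,4) cross[of z z'] by (simp add: \<eta>_def uv(5) inner_diff_left inner_add_right A_inner_A)
    ultimately show ?thesis by (simp add: NN_def)
  qed
  have \<eta>0: "\<eta> z \<noteq> 0" if "z \<noteq> 0" for z
  proof
    assume "\<eta> z = 0"
    then have "\<eta> z \<bullet> A z u = 0" by simp
    then show False using uv(3) cross[of z z] that by (simp add: \<eta>_def inner_diff_left A_inner_A)
  qed
  have y: "norm y1 = 1" "norm y2 = 1" "y2 \<bullet> y1 = 0" "y1 \<bullet> q x = 0" "y2 \<bullet> q x = 0"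
    using o by (auto simp: inner_commute)
  define e where "e = A y1 (A y2 x)"
  have inner: "A z e \<bullet> \<eta> z' = inverse (u \<bullet> u) * (A z (A y1 (A y2 u)) \<bullet> A z' u) - inverse (v \<bullet> v) * (A z (A y1 (A y2 v)) \<bullet> A z' v)" for z z'
  proof -
    have "A z (A y1 (A y2 u)) \<bullet> A z' v = 0" "A z' u \<bullet> A z (A y1 (A y2 v)) = 0"
      by (rule J_opposite; simp add: J_A uv(1,2))+
    then show ?thesis
      by (simp add: e_def uv(5) \<eta>_def inner_diff_right inner_add_left inner_commute[of "A z' u" "A z (A y1 (A y2 v))"])
  qed
  have "e \<in> K x (\<eta> y2)"
  proof -
    have "A (q x) e = e" using y n by (simp add: e_def anticommute_orthogonal)
    moreover have "e \<bullet> x = 0" using y by (simp add: e_def A_sym[of y1] A_inner_A)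
    moreover have "A z e \<bullet> \<eta> y2 = 0" if "z \<bullet> q x = 0" for z
    proof -
      have 1: "A z (A y1 (A y2 s)) \<bullet> A y2 s = (y1 \<bullet> z) * (s \<bullet> s)" for s
      proof -
        have "A z (A y1 (A y2 s)) \<bullet> A y2 s = A y1 (A y2 s) \<bullet> A z (A y2 s)" by (rule A_sym)
        also have "\<dots> = (y1 \<bullet> z) * ((y2 \<bullet> y2) * (s \<bullet> s))" by (simp add: A_inner_A)
        finally show ?thesis using y(2) by (simp add: norm_eq_1)
      qed
      show ?thesis unfolding inner 1 using uv(3,4) by simp
    qed
    ultimately show ?thesis by (simp add: K_def F_def)
  qed
  moreover have "y2 \<noteq> 0" using y(2) by auto
  ultimately have "e \<in> K x (\<eta> a)"
    using c \<eta>NN[OF a(1)] \<eta>NN[OF y(5)] \<eta>0[OF a(2)] \<eta>0[of y2] unfolding condition_A_iff[OF x] by blast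
  then have "A b e \<bullet> \<eta> a = 0" using b by (simp add: K_def)
  then have "inverse (u \<bullet> u) * (A a (A b (A y1 (A y2 u))) \<bullet> u) = inverse (v \<bullet> v) * (A a (A b (A y1 (A y2 v))) \<bullet> v)"
    unfolding inner by (simp add: A_sym[of a])
  then show ?thesis using uv(3,4) by (simp add: u_def[symmetric] v_def[symmetric] field_simps)
qed

lemma eq_if_inner_eq:
  fixes a b :: "'c::real_inner"
  assumes "a \<bullet> b = b \<bullet> b" "a \<bullet> a = b \<bullet> b"
  shows "a = b"
proof -
  have "(a - b) \<bullet> (a - b) = 0" using assms by (simp add: inner_diff_left inner_diff_right inner_commute)
  then show ?thesis by simp
qed

text \<open>The vector \<open>y0\<close> is chosen such that \<open>y0 y1 y2 y3\<close> fixes the \<open>J = 1\<close> part \<open>u\<close> of \<open>x\<close>. Under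
  Condition A this product and that of the complementary \<open>y4, \<dots>, y7\<close> act on \<open>u\<close> and on the
  \<open>J = -1\<close> part \<open>v\<close> by the same scalars, but the product of all of them is \<open>\<plusminus> J\<close>.\<close>

lemma not_condition_A:
  assumes k: "k = 8"
    and vol: "\<And>ys. orthonormal_list ys \<Longrightarrow> length ys = 9 \<Longrightarrow> \<exists>\<delta>::real. (\<delta> = 1 \<or> \<delta> = -1) \<and> (\<forall>x. foldr A ys x = \<delta> *\<^sub>R J x)"
    and x: "x \<in> N" and ne: "J x \<noteq> x" "J x \<noteq> - x"
  shows "\<not> condition_A (sphere 0 1) N x"
proof
  assume c: "condition_A (sphere 0 1) N x"
  note n = N_D[OF x]
  define w where "w = q x"
  define u where "u = pp x"
  define v where "v = pm x"
  have uv0: "u \<noteq> 0" "v \<noteq> 0" using ne by (auto simp: u_def v_def pp_eq_0_iff pm_eq_0_iff)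
  have uv: "J u = u" "J v = - v" "A w u = u" "A w v = v"
    using A_pp[OF n(5)] A_pm[OF n(5)] by (simp_all add: u_def v_def J_pp J_pm w_def)
  have w: "orthonormal_list [w]" "norm w = 1" using n by (simp_all add: w_def)
  have D: "DIM('b) = 9" using DIM_b k by simp
  obtain y3 where y3: "orthonormal_list [y3, w]" by (rule orthonormal_list_extend[OF _ w(1)]) (simp add: D)
  obtain y2 where y2: "orthonormal_list [y2, y3, w]" by (rule orthonormal_list_extend[OF _ y3]) (simp add: D)
  obtain y1 where y1: "orthonormal_list [y1, y2, y3, w]" by (rule orthonormal_list_extend[OF _ y2]) (simp add: D)
  have o: "norm y1 = 1" "norm y2 = 1" "norm y3 = 1" "y1 \<bullet> w = 0" "y2 \<bullet> w = 0" "y3 \<bullet> w = 0"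
    "y2 \<bullet> y1 = 0" "y3 \<bullet> y1 = 0" "y3 \<bullet> y2 = 0"
    using y1 by (auto simp: inner_commute)
  have "A y1 (A y2 (A y3 u)) \<in> V (- w) 1"
    using uv o by (simp add: V_def J_A anticommute_orthogonal)
  then obtain y0 where y0: "A y1 (A y2 (A y3 u)) = A y0 u" "y0 \<bullet> w = 0"
    using V_uminus_eq_A_image[OF w(2), of 1 u] uv uv0 by (auto simp: V_def W_def)
  have oo: "y1 \<bullet> y1 = 1" "y2 \<bullet> y2 = 1" "y3 \<bullet> y3 = 1" using o by (simp_all add: norm_eq_1)
  have uu: "u \<bullet> u \<noteq> 0" "v \<bullet> v \<noteq> 0" using uv0 by simp_all
  have "(y0 \<bullet> y0) * (u \<bullet> u) = u \<bullet> u"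
    using A_inner_A[of y0 u y0] unfolding y0(1)[symmetric] by (simp add: A_inner_A oo)
  then have y00: "y0 \<bullet> y0 = 1" using uu by simp
  have iso: "A y a \<bullet> A y b = (y \<bullet> y) * (a \<bullet> b)" for y a b by (simp add: A_sym A_A)
  have "A y1 (A y2 (A y3 u)) \<bullet> A y1 u = 0"
    unfolding iso A_sym[of y2] A_inner_A using o by simp
  then have "(y0 \<bullet> y1) * (u \<bullet> u) = 0" unfolding A_inner_A[symmetric] y0(1) .
  moreover have "A y1 (A y2 (A y3 u)) \<bullet> A y2 u = 0"
    unfolding anticommute_orthogonal[OF o(7)] inner_minus_left iso A_sym[of y1] A_inner_A using o by simp
  then have "(y0 \<bullet> y2) * (u \<bullet> u) = 0" unfolding A_inner_A[symmetric] y0(1) .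
  moreover have "A y1 (A y2 (A y3 u)) \<bullet> A y3 u = 0"
    unfolding A_sym[of y1] A_inner_A using o by simp
  then have "(y0 \<bullet> y3) * (u \<bullet> u) = 0" unfolding A_inner_A[symmetric] y0(1) .
  ultimately have "y1 \<bullet> y0 = 0" "y2 \<bullet> y0 = 0" "y3 \<bullet> y0 = 0" using uu by (simp_all add: inner_commute)
  then have l5: "orthonormal_list [y0, y1, y2, y3, w]"
    using y1 y00 y0(2) by (simp add: norm_eq_1 inner_commute)
  obtain y4 where l6: "orthonormal_list [y4, y0, y1, y2, y3, w]" by (rule orthonormal_list_extend[OF _ l5]) (simp add: D)
  obtain y5 where l7: "orthonormal_list [y5, y4, y0, y1, y2, y3, w]" by (rule orthonormal_list_extend[OF _ l6]) (simp add: D)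
  obtain y6 where l8: "orthonormal_list [y6, y5, y4, y0, y1, y2, y3, w]" by (rule orthonormal_list_extend[OF _ l7]) (simp add: D)
  obtain y7 where l9: "orthonormal_list [y7, y6, y5, y4, y0, y1, y2, y3, w]" by (rule orthonormal_list_extend[OF _ l8]) (simp add: D)
  define X where "X s = A y0 (A y1 (A y2 (A y3 s)))" for s
  define Y where "Y s = A y7 (A y6 (A y5 (A y4 s)))" for s
  obtain \<delta> :: real where \<delta>: "\<delta> = 1 \<or> \<delta> = -1" "\<And>s. Y (X (A w s)) = \<delta> *\<^sub>R J s"
    using vol[OF l9] by (auto simp: X_def Y_def)
  have Xu: "X u = u" by (simp add: X_def y0(1) A_A y00)
  have Yu: "Y u = \<delta> *\<^sub>R u" using \<delta>(2)[of u] by (simp add: uv Xu)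
  have "norm y0 = 1" using y00 by (simp add: norm_eq_1)
  then have "y0 \<noteq> 0" by auto
  have "norm y7 = 1" "norm y6 = 1" "norm y5 = 1" "norm y4 = 1" using l9 by simp_all
  then have y77: "y7 \<noteq> 0" "y7 \<bullet> y7 = 1" "y6 \<bullet> y6 = 1" "y5 \<bullet> y5 = 1" "y4 \<bullet> y4 = 1" by (auto simp: norm_eq_1)
  have y7w: "y7 \<bullet> w = 0" "y6 \<bullet> w = 0" "orthonormal_list [y5, y4, w]" "orthonormal_list [y2, y3, w]" using l9 by (auto simp: inner_commute)
  note four = condition_A_four_products[OF x c uv0[unfolded u_def v_def], folded u_def v_def w_def]
  have "(X u \<bullet> u) * (v \<bullet> v) = (X v \<bullet> v) * (u \<bullet> u)"
    unfolding X_def by (rule four) (use y7w y0 o \<open>y0 \<noteq> 0\<close> in auto)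
  then have "X v \<bullet> v = v \<bullet> v" using uu by (simp add: Xu mult.commute)
  moreover have "X v \<bullet> X v = v \<bullet> v" by (simp add: X_def A_inner_A oo y00)
  ultimately have Xv: "X v = v" by (rule eq_if_inner_eq)
  have "(Y u \<bullet> u) * (v \<bullet> v) = (Y v \<bullet> v) * (u \<bullet> u)"
    unfolding Y_def by (rule four) (use y7w y77 in auto)
  then have "Y v \<bullet> v = \<delta> * (v \<bullet> v)" using uu by (simp add: Yu mult.commute)
  then have "Y v \<bullet> (\<delta> *\<^sub>R v) = (\<delta> *\<^sub>R v) \<bullet> (\<delta> *\<^sub>R v)" by simp
  moreover have "Y v \<bullet> Y v = (\<delta> *\<^sub>R v) \<bullet> (\<delta> *\<^sub>R v)"
    using \<delta>(1) by (auto simp: Y_def A_inner_A y77)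
  ultimately have "Y v = \<delta> *\<^sub>R v" by (rule eq_if_inner_eq)
  then have "\<delta> *\<^sub>R v = - (\<delta> *\<^sub>R v)" using \<delta>(2)[of v] by (simp add: uv Xv)
  then have "(\<delta> *\<^sub>R v) \<bullet> (\<delta> *\<^sub>R v) = - ((\<delta> *\<^sub>R v) \<bullet> (\<delta> *\<^sub>R v))"
    by (metis inner_minus_left)
  then have "\<delta> *\<^sub>R v = 0" by simp
  then show False using \<delta>(1) uv0 by auto
qed

end

section \<open>Matrices\<close>

lemma (in clifford_pair) twisted_clifford_pair: "clifford_pair (\<lambda>w x. A w (J x)) J k"
proof
  show "bilinear (\<lambda>w x. A w (J x))"
    by (auto simp: bilinear_def intro!: linearI)
  show "A w (J x) \<bullet> y = x \<bullet> A w (J y)" for w x y by (simp add: A_sym J_sym J_A)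
  show "J x \<bullet> y = x \<bullet> J y" for x y by (rule J_sym)
qed (simp_all add: A_A linear_J J_A DIM_a DIM_b k_pos J_not_id J_not_uminus)

lemma (in clifford_pair) isoparametric_family:
  shows "isoparametric N h" "regular_level N h 0" "totally_isoparametric N (Mc 0)" "austere N (Mc 0)"
    "level_set N h 0 = Mc 0"
  by (fact isoparametric_h regular_level_h totally_isoparametric_Mc austere_Mc Mc_def[symmetric])+

lemma matrix_inner_transpose:
  fixes M :: "real^'n^'n"
  shows "(M *v x) \<bullet> y = x \<bullet> (transpose M *v y)"
  by (metis dot_lmul_matrix inner_commute transpose_matrix_vector transpose_transpose)

definition matrix_action :: "('i::finite \<Rightarrow> real^'n^'n) \<Rightarrow> real^'i \<Rightarrow> real^'n \<Rightarrow> real^'n" where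
  "matrix_action P w x = (\<Sum>i\<in>UNIV. (w $ i) *\<^sub>R (P i *v x))"

lemma matrix_action_axis: "matrix_action P (axis i 1) x = P i *v x"
  by (simp add: matrix_action_def axis_def if_distrib[of "\<lambda>c. c *\<^sub>R _"] cong: if_cong)

lemma clifford_action_matrix_action:
  fixes P :: "'i::finite \<Rightarrow> real^'n^'n"
  assumes sym: "\<And>i. transpose (P i) = P i"
    and anti: "\<And>i j. P i ** P j + P j ** P i = mat (if i = j then 2 else 0)"
  shows "clifford_action (matrix_action P)"
proof
  have lin: "linear ((*v) (P i))" for i by simp
  show "bilinear (matrix_action P)"
    by (auto simp: bilinear_def matrix_action_def linear_add[OF lin] linear_scale[OF lin]
        scaleR_sum_right sum.distrib scaleR_left_distrib scaleR_right_distrib mult.commute intro!: linearI)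
  show "matrix_action P w x \<bullet> y = x \<bullet> matrix_action P w y" for w x y
    by (simp add: matrix_action_def inner_sum_left inner_sum_right matrix_inner_transpose sym)
  show "matrix_action P w (matrix_action P w x) = (w \<bullet> w) *\<^sub>R x" for w x
  proof -
    have PP: "P i *v (P j *v x) + P j *v (P i *v x) = (if i = j then 2 *\<^sub>R x else 0)" for i j
    proof -
      have "P i *v (P j *v x) + P j *v (P i *v x) = (P i ** P j + P j ** P i) *v x"
        by (simp add: matrix_vector_mul_assoc matrix_vector_mult_add_rdistrib)
      also have "\<dots> = (if i = j then 2 *\<^sub>R x else 0)"
        unfolding anti by (simp add: vec_eq_iff matrix_vector_mult_def mat_def if_distrib[of "\<lambda>a. a * _"] cong: if_cong)
      finally show ?thesis .
    qed
    define S where "S = (\<Sum>i\<in>UNIV. \<Sum>j\<in>UNIV. (w $ i * w $ j) *\<^sub>R (P i *v (P j *v x)))"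
    have S: "matrix_action P w (matrix_action P w x) = S"
      by (simp add: matrix_action_def S_def linear_sum[OF lin] linear_scale[OF lin] scaleR_sum_right)
    have S2: "S = (\<Sum>j\<in>UNIV. \<Sum>i\<in>UNIV. (w $ i * w $ j) *\<^sub>R (P i *v (P j *v x)))"
      unfolding S_def by (rule sum.swap)
    have "S + S = (\<Sum>i\<in>UNIV. \<Sum>j\<in>UNIV. (w $ i * w $ j) *\<^sub>R (P i *v (P j *v x)))
        + (\<Sum>i\<in>UNIV. \<Sum>j\<in>UNIV. (w $ j * w $ i) *\<^sub>R (P j *v (P i *v x)))"
      unfolding S2[symmetric] S_def[symmetric] ..
    also have "\<dots> = (\<Sum>i\<in>UNIV. \<Sum>j\<in>UNIV. (w $ i * w $ j) *\<^sub>R (P i *v (P j *v x) + P j *v (P i *v x)))"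
      by (simp only: sum.distrib[symmetric] scaleR_right_distrib mult.commute)
    also have "\<dots> = (\<Sum>i\<in>UNIV. (w $ i * w $ i) *\<^sub>R (2 *\<^sub>R x))"
      unfolding PP by (simp add: if_distrib[of "\<lambda>a. _ *\<^sub>R a"] cong: if_cong)
    also have "\<dots> = 2 *\<^sub>R ((w \<bullet> w) *\<^sub>R x)"
      by (simp add: inner_vec_def scaleR_sum_left scaleR_sum_right mult.commute)
    finally have "2 *\<^sub>R S = 2 *\<^sub>R ((w \<bullet> w) *\<^sub>R x)" by (simp only: scaleR_2)
    then show ?thesis unfolding S by (metis scaleR_cancel_left zero_neq_numeral)
  qed
qed

lemma foldr_matrix_mult:
  "foldr (\<lambda>\<alpha> M. P \<alpha> ** M) xs (mat 1) *v x = foldr (\<lambda>\<alpha>. (*v) (P \<alpha>)) xs x"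
  by (induction xs) (simp_all flip: matrix_vector_mul_assoc)

lemma orthonormal_list_axis:
  assumes "distinct xs"
  shows "orthonormal_list (map (\<lambda>i. axis i (1::real)) xs)"
  using assms by (induction xs) (auto simp: inner_axis_axis)

lemma matrix_action_norm_q:
  fixes P :: "nat \<Rightarrow> real^'n^'n"
  assumes "clifford_action (matrix_action (P \<circ> b))" and b: "bij_betw b (UNIV :: 'i::finite set) {..m}"
  shows "(norm (clifford_action.q (matrix_action (P \<circ> b)) x))\<^sup>2 = (\<Sum>\<alpha>\<le>m. ((P \<alpha> *v x) \<bullet> x)\<^sup>2)"
proof -
  interpret clifford_action "matrix_action (P \<circ> b)" by fact
  have qi: "q x $ i = (P (b i) *v x) \<bullet> x" for i
    using inner_q[of "axis i 1" x] by (simp add: matrix_action_axis inner_axis')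
  have "(norm (q x))\<^sup>2 = (\<Sum>i\<in>UNIV. ((P (b i) *v x) \<bullet> x)\<^sup>2)"
    unfolding power2_norm_eq_inner inner_vec_def[of "q x"] qi by (simp add: power2_eq_square)
  also have "\<dots> = (\<Sum>\<alpha>\<le>m. ((P \<alpha> *v x) \<bullet> x)\<^sup>2)"
    by (rule sum.reindex_bij_betw[OF b])
  finally show ?thesis .
qed

lemma M_minus_matrix_action:
  assumes "clifford_action (matrix_action (P \<circ> b))" "bij_betw b (UNIV :: 'i::finite set) {..m}"
  shows "M_minus m P = {x. norm x = 1 \<and> norm (clifford_action.q (matrix_action (P \<circ> b)) x) = 1}"
proof -
  have "s ^ 2 = 1 \<longleftrightarrow> s = 1" if "0 \<le> s" for s :: real
    using that by (simp add: power2_eq_1_iff)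
  then show ?thesis
    by (auto simp: M_minus_def FKM_poly_def matrix_action_norm_q[OF assms, symmetric])
qed

lemma M_plus_matrix_action:
  assumes "clifford_action (matrix_action (P \<circ> b))" "bij_betw b (UNIV :: 'i::finite set) {..m}"
  shows "M_plus m P = {x. norm x = 1 \<and> (\<forall>w. matrix_action (P \<circ> b) w x \<bullet> x = 0)}"
proof -
  interpret clifford_action "matrix_action (P \<circ> b)" by fact
  have "q x = 0 \<longleftrightarrow> (\<forall>w. matrix_action (P \<circ> b) w x \<bullet> x = 0)" for x
    using inner_q[of _ x] by (metis inner_eq_zero_iff inner_zero_right)
  then show ?thesis
    by (auto simp: M_plus_def FKM_poly_def matrix_action_norm_q[OF assms, symmetric])
qed

theorem proposition1p2:
  fixes P :: "nat \<Rightarrow> real^32^32"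
  assumes "symmetric_clifford_system 8 P"
    and "clifford_prod 8 P \<noteq> mat 1"
    and "clifford_prod 8 P \<noteq> - mat 1"
  shows "symmetric_clifford_system 8 (twisted_system 8 P) \<and>
    clifford_prod 8 (twisted_system 8 P) = mat 1 \<and>
    (\<exists>h. isoparametric (M_minus 8 P) h \<and>
       regular_level (M_minus 8 P) h 0 \<and>
       level_set (M_minus 8 P) h 0 = M_plus 8 (twisted_system 8 P) \<and>
       totally_isoparametric (M_minus 8 P) (M_plus 8 (twisted_system 8 P)) \<and>
       austere (M_minus 8 P) (M_plus 8 (twisted_system 8 P)) \<and>
       focal_variety (M_minus 8 P) h = {x \<in> M_minus 8 P. condition_A (sphere 0 1) (M_minus 8 P) x}) \<and>
    (\<exists>h. isoparametric (M_minus 8 (twisted_system 8 P)) h \<and>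
       regular_level (M_minus 8 (twisted_system 8 P)) h 0 \<and>
       level_set (M_minus 8 (twisted_system 8 P)) h 0 = M_plus 8 P \<and>
       totally_isoparametric (M_minus 8 (twisted_system 8 P)) (M_plus 8 P) \<and>
       austere (M_minus 8 (twisted_system 8 P)) (M_plus 8 P))"
proof -
  let ?T = "twisted_system 8 P"
  define C where "C = clifford_prod 8 P"
  define J where "J x = C *v x" for x
  obtain b where b: "bij_betw b (UNIV :: 9 set) {..8::nat}"
    using finite_same_card_bij[of "UNIV :: 9 set" "{..8::nat}"] by auto
  define A where "A = matrix_action (P \<circ> b)"
  have sym: "transpose (P \<alpha>) = P \<alpha>" and anti: "P \<alpha> ** P \<beta> + P \<beta> ** P \<alpha> = mat (if \<alpha> = \<beta> then 2 else 0)"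
    if "\<alpha> \<le> 8" "\<beta> \<le> 8" for \<alpha> \<beta>
    using assms(1) that by (auto simp: symmetric_clifford_system_def)
  have b8: "b i \<le> 8" "b i = b j \<longleftrightarrow> i = j" for i j
    using b by (auto simp: bij_betw_def inj_on_def)
  have act: "clifford_action A"
    unfolding A_def by (rule clifford_action_matrix_action) (use sym[OF b8(1) b8(1)] anti[OF b8(1) b8(1)] b8(2) in simp_all)
  interpret clifford_action A by (fact act)
  define es where "es = map (\<lambda>\<alpha>. axis (inv b \<alpha>) (1::real) :: real^9) [0..<Suc 8]"
  have binv: "b (inv b \<alpha>) = \<alpha>" if "\<alpha> \<le> 8" for \<alpha>
    using b that by (intro f_inv_into_f) (auto simp: bij_betw_def)
  have A_es: "A (axis (inv b \<alpha>) 1) x = P \<alpha> *v x" if "\<alpha> \<le> 8" for \<alpha> x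
    by (simp add: A_def matrix_action_axis binv[OF that])
  have es: "orthonormal_list es" "length es = 9"
  proof -
    have "inj_on (inv b) (set [0..<Suc 8])"
      by (rule inj_on_inverseI[where g = b]) (simp add: binv del: upt_Suc)
    then have "distinct (map (inv b) [0..<Suc 8])"
      by (simp add: distinct_map del: upt_Suc)
    from orthonormal_list_axis[OF this] show "orthonormal_list es" by (simp add: es_def o_def del: upt_Suc)
    show "length es = 9" by (simp add: es_def del: upt_Suc)
  qed
  have idx: "set [0..<Suc 8] \<subseteq> {..8::nat}" by auto
  have J: "J x = foldr A es x" for x
  proof -
    have "foldr (\<lambda>\<alpha>. (*v) (P \<alpha>)) xs x = foldr A (map (\<lambda>\<alpha>. axis (inv b \<alpha>) 1) xs) x" if "set xs \<subseteq> {..8}" for xs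
      using that by (induction xs) (auto simp: A_es)
    from this[OF idx] show ?thesis
      unfolding J_def C_def clifford_prod_def foldr_matrix_mult es_def .
  qed
  have J_A: "J (A w x) = A w (J x)" for w x
    using A_foldr_basis[OF es(1)] es(2) by (simp add: J)
  have rev: "foldr A (rev es) x = J x" for x
    using foldr_rev[OF es(1), of x] es(2) by (simp add: J lessThan_nat_numeral lessThan_Suc eval_nat_numeral)
  have J_J: "J (J x) = x" for x
    using foldr_foldr_rev[OF es(1), of x] by (simp add: rev) (simp add: J)
  have J_sym: "J x \<bullet> y = x \<bullet> J y" for x y
    using foldr_inner[of es x y] by (simp add: rev) (simp add: J)
  have "\<exists>x. J x \<noteq> x"
    using assms(2) matrix_eq[of C "mat 1"] by (auto simp: J_def C_def)
  moreover have "\<exists>x. J x \<noteq> - x"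
  proof -
    have "(- mat 1 :: real^32^32) *v x = - x" for x
    proof -
      have "(- mat 1 :: real^32^32) *v x = - (mat 1 *v x)"
        by (simp add: vec_eq_iff matrix_vector_mult_def sum_negf)
      then show ?thesis by simp
    qed
    then show ?thesis using assms(3) matrix_eq[of C "- mat 1"] by (auto simp: J_def C_def)
  qed
  moreover have "linear J" unfolding J_def[abs_def] by simp
  moreover have "DIM(real^32) = 4 * 8" "DIM(real^9) = Suc 8" "(0::nat) < 8" by simp_all
  ultimately have "clifford_pair A J 8"
    by (intro clifford_pair.intro act clifford_pair_axioms.intro J_J J_sym J_A)
  then interpret I: clifford_pair A J 8 .
  interpret D: clifford_pair "\<lambda>w x. A w (J x)" J 8
    by (rule I.twisted_clifford_pair)
  have tw: "?T \<alpha> *v x = P \<alpha> *v J x" for \<alpha> x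
    by (simp add: twisted_system_def J_def C_def matrix_vector_mul_assoc)
  have AT: "matrix_action (?T \<circ> b) = (\<lambda>w x. A w (J x))"
    by (simp add: fun_eq_iff A_def matrix_action_def tw)
  have PJ: "P \<alpha> *v J x = J (P \<alpha> *v x)" if "\<alpha> \<le> 8" for \<alpha> x
    using J_A[of "axis (inv b \<alpha>) 1" x] by (simp add: A_es[OF that])
  have symT: "symmetric_clifford_system 8 ?T"
    unfolding symmetric_clifford_system_def
  proof (intro conjI allI impI)
    fix \<alpha> :: nat assume \<alpha>: "\<alpha> \<le> 8"
    have inner: "(transpose (?T \<alpha>) *v x) \<bullet> y = (?T \<alpha> *v x) \<bullet> y" for x y
    proof -
      have "(transpose (?T \<alpha>) *v x) \<bullet> y = x \<bullet> (?T \<alpha> *v y)"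
        unfolding matrix_inner_transpose transpose_transpose ..
      also have "\<dots> = (P \<alpha> *v x) \<bullet> J y"
        unfolding tw matrix_inner_transpose sym[OF \<alpha> \<alpha>] ..
      also have "\<dots> = (?T \<alpha> *v x) \<bullet> y" by (simp add: tw PJ[OF \<alpha>] J_sym)
      finally show ?thesis .
    qed
    have "transpose (?T \<alpha>) *v x = ?T \<alpha> *v x" for x
      by (rule vector_eq_rdot[THEN iffD1]) (rule allI, rule inner)
    then show "transpose (?T \<alpha>) = ?T \<alpha>" by (intro matrix_eq[THEN iffD2] allI)
    fix \<beta> :: nat assume \<beta>: "\<beta> \<le> 8"
    have "(?T \<alpha> ** ?T \<beta> + ?T \<beta> ** ?T \<alpha>) *v x = (P \<alpha> ** P \<beta> + P \<beta> ** P \<alpha>) *v x" for x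
      by (simp add: matrix_vector_mult_add_rdistrib tw PJ[OF \<alpha>] PJ[OF \<beta>] J_J flip: matrix_vector_mul_assoc)
    then show "?T \<alpha> ** ?T \<beta> + ?T \<beta> ** ?T \<alpha> = mat (if \<alpha> = \<beta> then 2 else 0)"
      using anti[OF \<alpha> \<beta>] by (metis matrix_eq)
  qed
  have prodT: "clifford_prod 8 ?T = mat 1"
  proof -
    have "clifford_prod 8 ?T *v x = mat 1 *v x" for x
    proof -
      have "foldr (\<lambda>\<alpha>. (*v) (?T \<alpha>)) xs x = foldr (\<lambda>w x. A w (J x)) (map (\<lambda>\<alpha>. axis (inv b \<alpha>) 1) xs) x"
        if "set xs \<subseteq> {..8}" for xs
        using that by (induction xs) (auto simp: A_es tw)
      from this[OF idx] have "clifford_prod 8 ?T *v x = foldr (\<lambda>w x. A w (J x)) es x"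
        unfolding clifford_prod_def foldr_matrix_mult es_def .
      also have "\<dots> = J (foldr A es x)" using foldr_twisted[of J es x] es(2) J_J J_A by simp
      also have "\<dots> = x" by (simp add: J_J flip: J)
      finally show ?thesis by simp
    qed
    then show ?thesis by (simp add: matrix_eq)
  qed
  have actT: "clifford_action (matrix_action (?T \<circ> b))"
    unfolding AT by (rule D.clifford_action_axioms)
  have NI: "M_minus 8 P = I.N"
    unfolding I.N_def by (rule M_minus_matrix_action[OF act[unfolded A_def] b, folded A_def])
  have ND: "M_minus 8 ?T = D.N"
    unfolding D.N_def by (rule M_minus_matrix_action[OF actT b, unfolded AT])
  have MI: "M_plus 8 P = D.Mc 0"
    unfolding D.Mc_0_eq_twisted J_J by (rule M_plus_matrix_action[OF act[unfolded A_def] b, folded A_def])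
  have MD: "M_plus 8 ?T = I.Mc 0"
    unfolding I.Mc_0_eq_twisted by (rule M_plus_matrix_action[OF actT b, unfolded AT])
  have "condition_A (sphere 0 1) I.N x \<longleftrightarrow> J x = x \<or> J x = - x" if "x \<in> I.N" for x
  proof
    assume "condition_A (sphere 0 1) I.N x"
    moreover have "\<exists>\<delta>::real. (\<delta> = 1 \<or> \<delta> = -1) \<and> (\<forall>x. foldr A ys x = \<delta> *\<^sub>R J x)" if "orthonormal_list ys" "length ys = 9" for ys
      using foldr_basis_unique[OF that(1) _ es(1)] that(2) es(2) by (simp add: J)
    ultimately show "J x = x \<or> J x = - x" using I.not_condition_A[OF refl _ that] by blast
  next
    assume "J x = x \<or> J x = - x"
    then show "condition_A (sphere 0 1) I.N x"
      using I.condition_A_at_poles[OF that, of 1] I.condition_A_at_poles[OF that, of "-1"] by auto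
  qed
  then have "focal_variety I.N I.h = {x \<in> I.N. condition_A (sphere 0 1) I.N x}"
    unfolding I.focal_variety_h by blast
  then show ?thesis
    using symT prodT I.isoparametric_family D.isoparametric_family unfolding NI ND MI MD by blast
qed

end
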